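(* Let $N\ge1$, $p>1+2/N$ and $r>0$. Let $f\in C^1([0,\infty))\cap C^2((0,\infty))$ satisfy $f(0)=0$, and $f(u)>0$, $f'(u)>0$, $f''(u)>0$ for all $u>0$, and $\int_u^\infty\frac{ds}{f(s)}<\infty$ for all $u>0$, and $$f(u)=u^p\left[\log\left(e+\frac1u\right)\right]^{-r}\qquad\text{for } u\in(0,1).$$ For $c>0$ put $$u_0(x)=c\,(|x|+1)^{-\frac{2}{p-1}}\bigl[\log(|x|+e)\bigr]^{\frac{r}{p-1}},\qquad x\in\mathbb{R}^N,$$ and consider the problem $$\partial_t u=\Delta u+f(u)\ \text{ in } \mathbb{R}^N\times(0,\infty),\qquad u(x,0)=u_0(x)\ \text{ in } \mathbb{R}^N .$$ Then there exist positive constants $c_0\le c_1$ such that: if $0<c<c_0$, the solution of the problem exists globally in time; if $c>c_1$, there exists no global in time solution of the problem.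
   Context: A global in time solution (for a bounded continuous nonnegative $u_0$) is a nonnegative function $u\in C^{2,1}(\mathbb{R}^N\times(0,\infty))\cap C(\mathbb{R}^N\times[0,\infty))$, bounded on $\mathbb{R}^N\times[0,T]$ for every $T<\infty$, satisfying the equation pointwise for $t>0$ and $u(\cdot,0)=u_0$. *)

theory Defs
  imports "HOL-Analysis.Analysis"
begin

text \<open>
  A function on space-time is a curried \<open>u :: 'a \<Rightarrow> real \<Rightarrow> real\<close>, where \<open>'a\<close> is a Euclidean
  space of dimension \<open>N = DIM('a)\<close>. The derivatives below are meaningful only where the
  corresponding differentiability holds, which \<open>C21\<close> demands.
\<close>

definition time_deriv :: "('a \<Rightarrow> real \<Rightarrow> real) \<Rightarrow> 'a \<Rightarrow> real \<Rightarrow> real" where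
  "time_deriv u x t = deriv (u x) t"

definition space_deriv ::
  "'a::euclidean_space \<Rightarrow> ('a \<Rightarrow> real \<Rightarrow> real) \<Rightarrow> 'a \<Rightarrow> real \<Rightarrow> real" where
  "space_deriv i u x t = deriv (\<lambda>h. u (x + h *\<^sub>R i) t) 0"

definition laplacian :: "('a::euclidean_space \<Rightarrow> real \<Rightarrow> real) \<Rightarrow> 'a \<Rightarrow> real \<Rightarrow> real" where
  "laplacian u x t = (\<Sum>i\<in>Basis. space_deriv i (space_deriv i u) x t)"

text \<open>
  The class \<open>C\<^sup>2\<^sup>,\<^sup>1\<close> on \<open>\<real>\<^sup>N \<times> (0,\<infinity>)\<close>: \<open>u\<close>, its time derivative and its space derivatives
  of order one and two exist and are jointly continuous.
\<close>

definition C21 :: "('a::euclidean_space \<Rightarrow> real \<Rightarrow> real) \<Rightarrow> bool" where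
  "C21 u \<longleftrightarrow>
     continuous_on (UNIV \<times> {0<..}) (\<lambda>(x, t). u x t) \<and>
     (\<forall>x. \<forall>t>0. u x field_differentiable at t) \<and>
     continuous_on (UNIV \<times> {0<..}) (\<lambda>(x, t). time_deriv u x t) \<and>
     (\<forall>i\<in>Basis.
        (\<forall>x. \<forall>t>0. (\<lambda>h. u (x + h *\<^sub>R i) t) field_differentiable at 0) \<and>
        continuous_on (UNIV \<times> {0<..}) (\<lambda>(x, t). space_deriv i u x t)) \<and>
     (\<forall>i\<in>Basis. \<forall>j\<in>Basis.
        (\<forall>x. \<forall>t>0. (\<lambda>h. space_deriv i u (x + h *\<^sub>R j) t) field_differentiable at 0) \<and>
        continuous_on (UNIV \<times> {0<..}) (\<lambda>(x, t). space_deriv j (space_deriv i u) x t))"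

definition global_solution ::
  "(real \<Rightarrow> real) \<Rightarrow> ('a::euclidean_space \<Rightarrow> real) \<Rightarrow> ('a \<Rightarrow> real \<Rightarrow> real) \<Rightarrow> bool" where
  "global_solution f u0 u \<longleftrightarrow>
     (\<forall>x. \<forall>t\<ge>0. 0 \<le> u x t) \<and>
     C21 u \<and>
     continuous_on (UNIV \<times> {0..}) (\<lambda>(x, t). u x t) \<and>
     (\<forall>T. bounded ((\<lambda>(x, t). u x t) ` (UNIV \<times> {0..T}))) \<and>
     (\<forall>x. \<forall>t>0. time_deriv u x t = laplacian u x t + f (u x t)) \<and>
     (\<forall>x. u x 0 = u0 x)"

definition initial_datum :: "real \<Rightarrow> real \<Rightarrow> real \<Rightarrow> 'a::euclidean_space \<Rightarrow> real" where
  "initial_datum p r c x =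
     c * (norm x + 1) powr (- 2 / (p - 1)) * ln (norm x + exp 1) powr (r / (p - 1))"

end

theory Submission
  imports Defs "HOL-Probability.Distributions"
begin

text \<open>
  Let \<open>\<Phi>\<close> solve \<open>\<Phi>' = f(\<Phi>)\<close>; up to constants, \<open>\<Phi>(-|x|\<^sup>2)\<close> has the decay of the initial datum.
  Since \<open>f' > 0\<close>, \<open>\<Phi>(z)\<close> is a subsolution as soon as \<open>z\<^sub>t \<le> \<Delta>z + 1\<close>. Taking
  \<open>z = -a(1 + |x|\<^sup>2) + t/2\<close> with \<open>a = 1/(4N)\<close> gives a subsolution that blows up in finite time and lies
  below the datum initially when \<open>c\<close> is large; comparison excludes global solutions.

  For small \<open>c\<close> one fixes \<open>\<kappa>\<close> strictly between \<open>1/(p-1)\<close> and \<open>N/2\<close> and an explicit strictly supercaloric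
  \<open>v\<close> comparable to \<open>(1 + t + |x|\<^sup>2)\<^sup>-\<^sup>\<kappa>\<close>. The function \<open>\<Phi>(-A v\<^sup>-\<^sup>1\<^sup>/\<^sup>\<kappa>)\<close> is increasing and concave in
  \<open>v\<close>, because \<open>f'(u) \<integral>\<^sub>u\<^sup>1 ds/f(s) \<le> \<kappa> + 1\<close> for small \<open>u\<close>, and it is a bounded global supersolution.
  After truncating \<open>f\<close> above the supersolution, the equation has a bounded Lipschitz nonlinearity and is
  solved by a fixed point of Duhamel's formula; comparison removes the truncation. The source
  \<open>f(u)\<close> is Lipschitz in \<open>x\<close> because the datum is, so the second derivatives of the heat kernel acting on it
  are \<open>O((t-s)\<^sup>-\<^sup>1\<^sup>/\<^sup>2)\<close>, hence integrable, and the fixed point is a classical solution.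
\<close>

section \<open>Parabolic derivatives and the maximum principle\<close>

text \<open>All comparisons with the datum are made through \<open>G\<close>, the primitive of
  \<open>1 / f\<close> inverse to \<open>Phi\<close>. In that variable the datum behaves like
  \<open>- c powr (1 - p)\<close> times \<open>1 + |x|^2\<close>, because its logarithmic factor is
  tuned to cancel the logarithm in \<open>f\<close>; hence large \<open>c\<close> lifts it above a
  prescribed paraboloid and small \<open>c\<close> pushes it below one. The lower end of the range
  of \<kappa> comes from concavity: the bound proved for \<open>f' u * (- G u)\<close> tends to
  \<open>p / (p - 1) = 1 + 1 / (p - 1)\<close> as \<open>u\<close> tends to 0, and its logarithmic
  error is absorbed only by a strict gap. The upper end is the decay rate of the Gaussian. That the
  range is nonempty is exactly \<open>p > 1 + 2 / N\<close>. In the existence part the obstacle is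
  the time derivative of the Duhamel integral, whose kernel is singular at elapsed time 0. It is
  never differentiated directly: Fubini on a triangle exhibits the integral as a primitive of a
  continuous function. Comparison uses pointwise jets instead of \<open>C21\<close>, so that
  explicit barriers need no continuity of their derivatives.\<close>

text \<open>Here \<open>a\<close>, \<open>p i\<close> and \<open>q i\<close> are the values at \<open>(x, t)\<close> of \<open>v\<^sub>t\<close>, \<open>\<partial>\<^sub>i v\<close> and \<open>\<partial>\<^sub>i\<partial>\<^sub>i v\<close>.\<close>

definition parabolic_jet ::
  "('a::euclidean_space \<Rightarrow> real \<Rightarrow> real) \<Rightarrow> 'a \<Rightarrow> real \<Rightarrow> real \<Rightarrow> ('a \<Rightarrow> real) \<Rightarrow> ('a \<Rightarrow> real) \<Rightarrow> bool" where
  "parabolic_jet v x t a p q \<longleftrightarrow>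
     (v x has_real_derivative a) (at t) \<and>
     (\<forall>i\<in>Basis. \<exists>g. (\<forall>\<^sub>F h in nhds 0. ((\<lambda>h. v (x + h *\<^sub>R i) t) has_real_derivative g h) (at h)) \<and>
        g 0 = p i \<and> (g has_real_derivative q i) (at 0))"

lemma parabolic_jet_cong:
  assumes "parabolic_jet v x t a p q" "a = a'" "\<And>i. i \<in> Basis \<Longrightarrow> p i = p' i" "\<And>i. i \<in> Basis \<Longrightarrow> q i = q' i"
  shows "parabolic_jet v x t a' p' q'"
  using assms unfolding parabolic_jet_def by auto

lemma parabolic_jet_add:
  assumes "parabolic_jet v x t a p q" "parabolic_jet w x t b p' q'"
  shows "parabolic_jet (\<lambda>x t. v x t + w x t) x t (a + b) (\<lambda>i. p i + p' i) (\<lambda>i. q i + q' i)"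
  unfolding parabolic_jet_def
proof (intro conjI ballI)
  show "((\<lambda>t. v x t + w x t) has_real_derivative a + b) (at t)"
    using assms unfolding parabolic_jet_def by (auto intro!: derivative_eq_intros)
  fix i :: 'a assume i: "i \<in> Basis"
  obtain g where g: "\<forall>\<^sub>F h in nhds 0. ((\<lambda>h. v (x + h *\<^sub>R i) t) has_real_derivative g h) (at h)"
    "g 0 = p i" "(g has_real_derivative q i) (at 0)"
    using assms(1) i unfolding parabolic_jet_def by blast
  obtain g' where g': "\<forall>\<^sub>F h in nhds 0. ((\<lambda>h. w (x + h *\<^sub>R i) t) has_real_derivative g' h) (at h)"
    "g' 0 = p' i" "(g' has_real_derivative q' i) (at 0)"
    using assms(2) i unfolding parabolic_jet_def by blast
  show "\<exists>g. (\<forall>\<^sub>F h in nhds 0. ((\<lambda>h. v (x + h *\<^sub>R i) t + w (x + h *\<^sub>R i) t) has_real_derivative g h) (at h)) \<and>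
        g 0 = p i + p' i \<and> (g has_real_derivative q i + q' i) (at 0)"
  proof (intro exI[of _ "\<lambda>h. g h + g' h"] conjI)
    show "\<forall>\<^sub>F h in nhds 0. ((\<lambda>h. v (x + h *\<^sub>R i) t + w (x + h *\<^sub>R i) t) has_real_derivative g h + g' h) (at h)"
      using eventually_conj[OF g(1) g'(1)] by eventually_elim (auto intro!: derivative_eq_intros)
  qed (use g g' in \<open>auto intro!: derivative_eq_intros\<close>)
qed

lemma parabolic_jet_time_mult:
  assumes "parabolic_jet v x t a p q" "(c has_real_derivative c') (at t)"
  shows "parabolic_jet (\<lambda>x t. c t * v x t) x t (c' * v x t + c t * a) (\<lambda>i. c t * p i) (\<lambda>i. c t * q i)"
  unfolding parabolic_jet_def
proof (intro conjI ballI)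
  show "((\<lambda>t. c t * v x t) has_real_derivative c' * v x t + c t * a) (at t)"
    using assms unfolding parabolic_jet_def by (auto intro!: derivative_eq_intros)
  fix i :: 'a assume i: "i \<in> Basis"
  obtain g where g: "\<forall>\<^sub>F h in nhds 0. ((\<lambda>h. v (x + h *\<^sub>R i) t) has_real_derivative g h) (at h)"
    "g 0 = p i" "(g has_real_derivative q i) (at 0)"
    using assms(1) i unfolding parabolic_jet_def by blast
  show "\<exists>g. (\<forall>\<^sub>F h in nhds 0. ((\<lambda>h. c t * v (x + h *\<^sub>R i) t) has_real_derivative g h) (at h)) \<and>
        g 0 = c t * p i \<and> (g has_real_derivative c t * q i) (at 0)"
  proof (intro exI[of _ "\<lambda>h. c t * g h"] conjI)
    show "\<forall>\<^sub>F h in nhds 0. ((\<lambda>h. c t * v (x + h *\<^sub>R i) t) has_real_derivative c t * g h) (at h)"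
      using g(1) by eventually_elim (auto intro!: derivative_eq_intros)
  qed (use g in \<open>auto intro!: derivative_eq_intros\<close>)
qed

lemma parabolic_jet_cmult:
  assumes "parabolic_jet v x t a p q"
  shows "parabolic_jet (\<lambda>x t. c * v x t) x t (c * a) (\<lambda>i. c * p i) (\<lambda>i. c * q i)"
  using parabolic_jet_time_mult[OF assms, of "\<lambda>_. c" 0] by simp

lemma parabolic_jet_diff:
  assumes "parabolic_jet v x t a p q" "parabolic_jet w x t b p' q'"
  shows "parabolic_jet (\<lambda>x t. v x t - w x t) x t (a - b) (\<lambda>i. p i - p' i) (\<lambda>i. q i - q' i)"
  using parabolic_jet_add[OF assms(1) parabolic_jet_cmult[OF assms(2), of "-1"]] by simp

lemma parabolic_jet_time:
  assumes "(c has_real_derivative c') (at t)"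
  shows "parabolic_jet (\<lambda>x t. c t) x t c' (\<lambda>i. 0) (\<lambda>i. 0)"
  unfolding parabolic_jet_def using assms by (auto intro!: exI[of _ "\<lambda>_. 0"])

lemma parabolic_jet_norm2: "parabolic_jet (\<lambda>x t. (norm x)\<^sup>2) x t 0 (\<lambda>i. 2 * (x \<bullet> i)) (\<lambda>i. 2)"
  unfolding parabolic_jet_def
proof (intro conjI ballI)
  fix i :: 'a assume i: "i \<in> Basis"
  have *: "(norm (x + h *\<^sub>R i))\<^sup>2 = (norm x)\<^sup>2 + 2 * h * (x \<bullet> i) + h^2" for h
    unfolding power2_norm_eq_inner using i
    by (simp add: inner_simps inner_commute power2_eq_square algebra_simps)
  show "\<exists>g. (\<forall>\<^sub>F h in nhds 0. ((\<lambda>h. (norm (x + h *\<^sub>R i))\<^sup>2) has_real_derivative g h) (at h)) \<and>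
        g 0 = 2 * (x \<bullet> i) \<and> (g has_real_derivative 2) (at 0)"
    unfolding * by (intro exI[of _ "\<lambda>h. 2 * (x \<bullet> i) + 2 * h"])
      (auto intro!: derivative_eq_intros always_eventually)
qed auto

text \<open>The chain rule to second order. \<open>P\<close> is differentiated only near the value
  \<open>v x t\<close>, which suits \<open>Phi\<close> and real powers, both meaningful on a
  half-line only.\<close>

lemma parabolic_jet_compose:
  assumes v: "parabolic_jet v x t a p q"
    and P: "\<forall>\<^sub>F y in nhds (v x t). (P has_real_derivative P1 y) (at y)"
    and P1: "(P1 has_real_derivative P2) (at (v x t))"
  shows "parabolic_jet (\<lambda>x t. P (v x t)) x t (P1 (v x t) * a) (\<lambda>i. P1 (v x t) * p i)
           (\<lambda>i. P2 * (p i)\<^sup>2 + P1 (v x t) * q i)"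
  unfolding parabolic_jet_def
proof (intro conjI ballI)
  have P0: "(P has_real_derivative P1 (v x t)) (at (v x t))"
    using P by (rule eventually_nhds_x_imp_x)
  show "((\<lambda>t. P (v x t)) has_real_derivative P1 (v x t) * a) (at t)"
    using v DERIV_chain2[of P "P1 (v x t)" "v x" t a UNIV] P0 unfolding parabolic_jet_def by auto
  fix i :: 'a assume i: "i \<in> Basis"
  obtain g where g: "\<forall>\<^sub>F h in nhds 0. ((\<lambda>h. v (x + h *\<^sub>R i) t) has_real_derivative g h) (at h)"
    "g 0 = p i" "(g has_real_derivative q i) (at 0)"
    using v i unfolding parabolic_jet_def by blast
  have d0: "((\<lambda>h. v (x + h *\<^sub>R i) t) has_real_derivative g 0) (at 0)"
    using g(1) by (rule eventually_nhds_x_imp_x)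
  have "isCont (\<lambda>h. v (x + h *\<^sub>R i) t) 0" using d0 by (rule DERIV_isCont)
  then have "filterlim (\<lambda>h. v (x + h *\<^sub>R i) t) (nhds (v x t)) (nhds 0)"
    using tendsto_at_iff_tendsto_nhds[of "\<lambda>h. v (x + h *\<^sub>R i) t" 0] unfolding isCont_def by simp
  from eventually_compose_filterlim[OF P this]
  have e: "\<forall>\<^sub>F h in nhds 0. (P has_real_derivative P1 (v (x + h *\<^sub>R i) t)) (at (v (x + h *\<^sub>R i) t))" .
  show "\<exists>g. (\<forall>\<^sub>F h in nhds 0. ((\<lambda>h. P (v (x + h *\<^sub>R i) t)) has_real_derivative g h) (at h)) \<and>
        g 0 = P1 (v x t) * p i \<and> (g has_real_derivative P2 * (p i)\<^sup>2 + P1 (v x t) * q i) (at 0)"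
  proof (intro exI[of _ "\<lambda>h. P1 (v (x + h *\<^sub>R i) t) * g h"] conjI)
    show "\<forall>\<^sub>F h in nhds 0. ((\<lambda>h. P (v (x + h *\<^sub>R i) t)) has_real_derivative P1 (v (x + h *\<^sub>R i) t) * g h) (at h)"
      using eventually_conj[OF e g(1)]
    proof eventually_elim
      case (elim h) then show ?case using DERIV_chain2[of P _ "\<lambda>h. v (x + h *\<^sub>R i) t" h _ UNIV] by auto
    qed
    have "((\<lambda>h. P1 (v (x + h *\<^sub>R i) t)) has_real_derivative P2 * g 0) (at 0)"
      using DERIV_chain2[of P1 P2 "\<lambda>h. v (x + h *\<^sub>R i) t" 0 "g 0" UNIV] P1 d0 by simp
    from DERIV_mult[OF this g(3)]
    show "((\<lambda>h. P1 (v (x + h *\<^sub>R i) t) * g h) has_real_derivative P2 * (p i)\<^sup>2 + P1 (v x t) * q i) (at 0)"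
      using g(2) by (simp add: power2_eq_square algebra_simps)
  qed (use g in auto)
qed

text \<open>If \<open>q\<close> were positive, \<open>g\<close>, which vanishes at the maximum,
  would be positive just to the right of 0, and the mean value theorem would make \<open>f\<close>
  exceed its maximum there.\<close>

lemma second_deriv_nonpos_at_max:
  fixes f g :: "real \<Rightarrow> real"
  assumes d: "\<forall>\<^sub>F h in nhds 0. (f has_real_derivative g h) (at h)"
    and m: "\<And>h. f h \<le> f 0"
    and g: "(g has_real_derivative q) (at 0)"
  shows "q \<le> 0"
proof (rule ccontr)
  assume "\<not> q \<le> 0" then have q: "q > 0" by simp
  have d0: "(f has_real_derivative g 0) (at 0)" using d by (rule eventually_nhds_x_imp_x)
  have g0: "g 0 = 0" using DERIV_local_max[OF d0, of 1] m by auto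
  obtain e where e: "e > 0" "\<And>h. \<bar>h\<bar> < e \<Longrightarrow> (f has_real_derivative g h) (at h)"
    using d unfolding eventually_nhds_metric by (auto simp: dist_real_def)
  obtain e' where e': "e' > 0" "\<And>h. 0 < h \<Longrightarrow> h < e' \<Longrightarrow> g h > 0"
    using DERIV_pos_inc_right[OF g q] g0 by auto
  define h where "h = min e e' / 2"
  have h: "h > 0" "h < e" "h < e'" using e e' by (auto simp: h_def)
  obtain z where z: "0 < z" "z < h" "f h - f 0 = (h - 0) * g z"
    using MVT2[of 0 h f g] h e(2) by auto
  have "f h - f 0 > 0" using z h e'(2)[of z] by auto
  with m[of h] show False by simp
qed

text \<open>The penalty makes \<open>F\<close> nonpositive outside a ball, so the positive supremum
  is that of a continuous function on a compact cylinder.\<close>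

lemma continuous_bounded_attains_max_penalized:
  fixes F :: "'a::euclidean_space \<Rightarrow> real \<Rightarrow> real"
  assumes c: "continuous_on (UNIV \<times> {0..T}) (\<lambda>(x,t). F x t)"
    and B: "\<And>x t. 0 \<le> t \<Longrightarrow> t \<le> T \<Longrightarrow> F x t \<le> B - e * (norm x)\<^sup>2"
    and e: "e > 0" and pos: "F x0 t0 > 0" "0 \<le> t0" "t0 \<le> T"
  shows "\<exists>x t. 0 \<le> t \<and> t \<le> T \<and> F x t > 0 \<and> (\<forall>y s. 0 \<le> s \<longrightarrow> s \<le> T \<longrightarrow> F y s \<le> F x t)"
proof -
  \<comment> \<open>Beyond this radius the norm is at least 1, so its square is at least the norm
    and hence at least \<open>\<bar>B\<bar> / e\<close>. The term \<open>norm x0\<close> keeps the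
    given positive point in the ball.\<close>
  define R where "R = max (norm x0) (1 + \<bar>B\<bar> / e)"
  have R: "F y s \<le> 0" if "norm y > R" "0 \<le> s" "s \<le> T" for y s
  proof -
    have n: "norm y \<ge> 1 + \<bar>B\<bar> / e" using that by (auto simp: R_def)
    have "norm y * 1 \<le> norm y * norm y"
      using n e by (intro mult_left_mono) (auto intro: order_trans[of _ "1 + \<bar>B\<bar> / e"])
    then have "(norm y)\<^sup>2 \<ge> \<bar>B\<bar> / e" using n by (simp add: power2_eq_square)
    then have "e * (norm y)\<^sup>2 \<ge> \<bar>B\<bar>" using e by (simp add: field_simps)
    with B[OF that(2,3), of y] show ?thesis by simp
  qed
  have "compact (cball (0::'a) R \<times> {0..T})" by (intro compact_Times) auto
  moreover have "cball (0::'a) R \<times> {0..T} \<noteq> {}" using pos by (auto simp: R_def)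
  moreover have "continuous_on (cball (0::'a) R \<times> {0..T}) (\<lambda>(x,t). F x t)"
    using c by (rule continuous_on_subset) auto
  ultimately obtain z where z: "z \<in> cball (0::'a) R \<times> {0..T}"
    "\<forall>y\<in>cball (0::'a) R \<times> {0..T}. (\<lambda>(x,t). F x t) y \<le> (\<lambda>(x,t). F x t) z"
    using continuous_attains_sup by blast
  obtain x t where xt: "z = (x,t)" by (cases z)
  have "F x0 t0 \<le> F x t" using z xt pos by (auto simp: R_def)
  then have p: "F x t > 0" using pos by simp
  have "F y s \<le> F x t" if s: "0 \<le> s" "s \<le> T" for y s
  proof (cases "norm y \<le> R")
    case True then show ?thesis using z xt s by auto
  next
    case False then show ?thesis using R[of y s] s p by simp
  qed
  with z xt p show ?thesis by auto
qed

text \<open>The penalty \<open>\<epsilon> (|x|\<^sup>2 + (2N+1) t + 1)\<close> is a strict supersolution of the heat equation that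
  forces the maximum to be attained.\<close>

lemma parabolic_maximum_principle:
  fixes d :: "'a::euclidean_space \<Rightarrow> real \<Rightarrow> real"
  assumes c: "continuous_on (UNIV \<times> {0..T}) (\<lambda>(x,t). d x t)"
    and B: "\<And>x t. 0 \<le> t \<Longrightarrow> t \<le> T \<Longrightarrow> d x t \<le> B"
    and init: "\<And>x. d x 0 \<le> 0"
    and K: "K \<ge> 0"
    and ineq: "\<And>x t. 0 < t \<Longrightarrow> t \<le> T \<Longrightarrow> d x t > 0 \<Longrightarrow>
       \<exists>a p q. parabolic_jet d x t a p q \<and> a \<le> (\<Sum>i\<in>Basis. q i) + K * d x t"
    and t1: "0 \<le> t1" "t1 \<le> T"
  shows "d x1 t1 \<le> 0"
proof (rule ccontr)
  assume "\<not> d x1 t1 \<le> 0"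
  then have d1: "d x1 t1 > 0" by simp
  define m where "m = (norm x1)\<^sup>2 + (2 * real DIM('a) + 1) * t1 + 1"
  have m: "m > 0" using t1 by (auto simp: m_def intro!: add_nonneg_pos)
  \<comment> \<open>\<open>m\<close> is the penalty at \<open>(x1, t1)\<close>; this \<epsilon>
    spends half of the positive weighted value there.\<close>
  define \<epsilon> where "\<epsilon> = exp (- K * t1) * d x1 t1 / (2 * m)"
  have \<epsilon>: "\<epsilon> > 0" using d1 m by (simp add: \<epsilon>_def)
  \<comment> \<open>The factor \<open>exp (- K * t)\<close> cancels the zero-order term
    \<open>K * d\<close> of the differential inequality.\<close>
  define F where "F = (\<lambda>x t. exp (- K * t) * d x t - \<epsilon> * ((norm x)\<^sup>2 + ((2 * real DIM('a) + 1) * t + 1)))"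
  have F1: "F x1 t1 > 0"
  proof -
    have "\<epsilon> * m = exp (- K * t1) * d x1 t1 / 2" using m by (simp add: \<epsilon>_def)
    then have "F x1 t1 = exp (- K * t1) * d x1 t1 / 2" by (simp add: F_def m_def algebra_simps)
    moreover have "exp (- K * t1) * d x1 t1 / 2 > 0" using d1 by simp
    ultimately show ?thesis by (rule ssubst)
  qed
  have Fc: "continuous_on (UNIV \<times> {0..T}) (\<lambda>(x,t). F x t)"
    using c unfolding F_def case_prod_beta by (intro continuous_intros)
  have FB: "F x t \<le> \<bar>B\<bar> - \<epsilon> * (norm x)\<^sup>2" if "0 \<le> t" "t \<le> T" for x t
  proof -
    have "exp (- K * t) * d x t \<le> exp (- K * t) * \<bar>B\<bar>"
      using B[OF that, of x] by (intro mult_left_mono) auto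
    also have "\<dots> \<le> 1 * \<bar>B\<bar>" using K that by (intro mult_right_mono) auto
    finally have "exp (- K * t) * d x t \<le> \<bar>B\<bar>" by simp
    moreover have "0 \<le> \<epsilon> * ((2 * real DIM('a) + 1) * t + 1)" using \<epsilon> that by simp
    ultimately show ?thesis by (simp add: F_def algebra_simps)
  qed
  obtain x t where xt: "0 \<le> t" "t \<le> T" "F x t > 0"
    "\<And>y s. 0 \<le> s \<Longrightarrow> s \<le> T \<Longrightarrow> F y s \<le> F x t"
    using continuous_bounded_attains_max_penalized[OF Fc FB \<epsilon> F1 t1] by metis
  have "0 \<le> \<epsilon> * ((norm x)\<^sup>2 + ((2 * real DIM('a) + 1) * t + 1))" using \<epsilon> xt by simp
  then have "exp (- K * t) * d x t > 0" using xt(3) unfolding F_def by linarith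
  then have dpos: "d x t > 0" by (simp add: zero_less_mult_iff)
  then have t: "t > 0" using init[of x] xt(1) by (cases "t = 0") auto
  obtain a p q where apq: "parabolic_jet d x t a p q" "a \<le> (\<Sum>i\<in>Basis. q i) + K * d x t"
    using ineq[OF t xt(2) dpos] by blast
  define E where "E = exp (- K * t)"
  have E: "E > 0" by (simp add: E_def)
  have pF: "parabolic_jet F x t (- K * E * d x t + E * a - \<epsilon> * (0 + (2 * real DIM('a) + 1)))
     (\<lambda>i. E * p i - \<epsilon> * (2 * (x \<bullet> i) + 0)) (\<lambda>i. E * q i - \<epsilon> * (2 + 0))"
    unfolding F_def E_def
    by (intro parabolic_jet_diff parabolic_jet_time_mult parabolic_jet_cmult parabolic_jet_add parabolic_jet_norm2 parabolic_jet_time apq)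
       (auto intro!: derivative_eq_intros)
  have Ft: "(F x has_real_derivative (- K * E * d x t + E * a - \<epsilon> * (2 * real DIM('a) + 1))) (at t)"
    using pF unfolding parabolic_jet_def by simp
  \<comment> \<open>The maximum may lie on the final slice \<open>t = T\<close>, where only earlier
    times compete; so the time derivative is shown to be nonnegative, not zero.\<close>
  have 1: "- K * E * d x t + E * a - \<epsilon> * (2 * real DIM('a) + 1) \<ge> 0"
  proof (rule ccontr)
    assume "\<not> ?thesis"
    then obtain b where b: "b > 0" "\<And>h. h > 0 \<Longrightarrow> h < b \<Longrightarrow> F x t < F x (t - h)"
      using DERIV_neg_dec_left[OF Ft] by auto
    define h where "h = min b t / 2"
    have "h > 0" "h < b" "h < t" using b t by (auto simp: h_def)
    then show False using b(2)[of h] xt(4)[of "t - h" x] xt(2) by auto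
  qed
  have 2: "E * q i - \<epsilon> * 2 \<le> 0" if i: "i \<in> Basis" for i
  proof -
    obtain g where "\<forall>\<^sub>F h in nhds 0. ((\<lambda>h. F (x + h *\<^sub>R i) t) has_real_derivative g h) (at h)"
      "(g has_real_derivative E * q i - \<epsilon> * 2) (at 0)"
      using pF i unfolding parabolic_jet_def by fastforce
    then show ?thesis using second_deriv_nonpos_at_max[of "\<lambda>h. F (x + h *\<^sub>R i) t" g "E * q i - \<epsilon> * 2"] xt(1,2,4) by auto
  qed
  have "(\<Sum>i\<in>Basis. E * q i) \<le> (\<Sum>i\<in>(Basis::'a set). \<epsilon> * 2)" using 2 by (intro sum_mono) auto
  then have "E * (\<Sum>i\<in>Basis. q i) \<le> 2 * \<epsilon> * real DIM('a)" by (simp add: sum_distrib_left mult_ac)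
  moreover have "E * a \<le> E * ((\<Sum>i\<in>Basis. q i) + K * d x t)" using apq E by (intro mult_left_mono) auto
  ultimately have "E * a - K * E * d x t \<le> 2 * \<epsilon> * real DIM('a)" by (simp add: algebra_simps)
  \<comment> \<open>The second-derivative tests allow at most \<open>2 * N * \<epsilon>\<close>, the
    time derivative demands at least \<open>(2 * N + 1) * \<epsilon>\<close>.\<close>
  with 1 \<epsilon> show False by (simp add: algebra_simps)
qed

section \<open>The nonlinearity and the separable ODE\<close>

locale fujita_nonlinearity =
  fixes f f' :: "real \<Rightarrow> real" and p r :: real
  assumes p: "p > 1" and r: "r > 0"
    and f_deriv: "\<And>u. u \<ge> 0 \<Longrightarrow> (f has_real_derivative f' u) (at u within {0..})"
    and f'_cont: "continuous_on {0..} f'"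
    and f_zero: "f 0 = 0"
    and f_pos: "\<And>u. u > 0 \<Longrightarrow> f u > 0"
    and f'_pos: "\<And>u. u > 0 \<Longrightarrow> f' u > 0"
    and f_int: "\<And>u. u > 0 \<Longrightarrow> set_integrable lborel {u..} (\<lambda>s. 1 / f s)"
    and f_near_0: "\<And>u. 0 < u \<Longrightarrow> u < 1 \<Longrightarrow> f u = u powr p * ln (exp 1 + 1 / u) powr (- r)"
begin

lemma f_deriv_at: "u > 0 \<Longrightarrow> (f has_real_derivative f' u) (at u)"
  using f_deriv[of u] at_within_interior[of u "{0..}"] by (simp add: interior_Ici[of 0 "-1"])

lemma f_nonneg: "u \<ge> 0 \<Longrightarrow> f u \<ge> 0"
  using f_pos[of u] f_zero by (cases "u = 0") auto

lemma f_isCont: "u > 0 \<Longrightarrow> isCont f u"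
  using f_deriv_at by (rule DERIV_isCont)

lemma f_lipschitz:
  obtains K where "K > 0" "\<And>u v. 0 \<le> u \<Longrightarrow> u \<le> M \<Longrightarrow> 0 \<le> v \<Longrightarrow> v \<le> M \<Longrightarrow> \<bar>f u - f v\<bar> \<le> K * \<bar>u - v\<bar>"
proof -
  have "compact (f' ` {0..M})"
    using f'_cont by (intro compact_continuous_image) (auto intro: continuous_on_subset)
  then obtain K where K: "K > 0" "\<And>u. u \<in> {0..M} \<Longrightarrow> \<bar>f' u\<bar> \<le> K"
    using compact_imp_bounded[of "f' ` {0..M}"] unfolding bounded_pos by auto
  have "\<bar>f u - f v\<bar> \<le> K * \<bar>u - v\<bar>" if "0 \<le> u" "u \<le> M" "0 \<le> v" "v \<le> M" for u v
  proof -
    have "(f has_real_derivative f' z) (at z within {0..M})" if "z \<in> {0..M}" for z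
      using that by (intro has_field_derivative_subset[OF f_deriv]) auto
    from field_differentiable_bound[OF _ this, of K v u] show ?thesis using that K by (simp add: abs_minus_commute)
  qed
  with K(1) show ?thesis using that by blast
qed

section \<open>The separable ODE: the primitive \<open>G\<close> of \<open>1 / f\<close> and its
  inverse \<open>Phi\<close>\<close>

definition G :: "real \<Rightarrow> real" where "G u = (LBINT s=ereal 1..ereal u. 1 / f s)"

lemma G_deriv: assumes "u > 0" shows "(G has_real_derivative 1 / f u) (at u)"
proof -
  define a b where "a = min (u / 2) 1" and "b = max (u + 1) 1"
  have ab: "0 < a" "a \<le> 1" "1 \<le> b" "a < u" "u < b" using assms by (auto simp: a_def b_def)
  have nz: "s > 0" "f s \<noteq> 0" if "s \<in> {a..b}" for s using f_pos[of s] ab that by auto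
  have "continuous_on {a..b} (\<lambda>s. 1 / f s)"
    using nz f_isCont by (intro continuous_intros continuous_at_imp_continuous_on ballI) auto
  from interval_integral_FTC2[OF ab(2,3) this, of u] ab
  have "(G has_real_derivative 1 / f u) (at u within {a..b})"
    by (simp add: G_def[abs_def] has_real_derivative_iff_has_vector_derivative)
  then show ?thesis using at_within_interior[of u "{a..b}"] ab by simp
qed

lemma G_1 [simp]: "G 1 = 0"
  by (simp add: G_def)

lemma G_isCont: "u > 0 \<Longrightarrow> isCont G u"
  using G_deriv by (rule DERIV_isCont)

lemma G_strict: assumes "0 < u" "u < v" shows "G u < G v"
  using DERIV_pos_imp_increasing[OF assms(2), of G] G_deriv f_pos assms by (meson divide_pos_pos less_le_trans zero_less_one)

lemma G_le_iff: "0 < u \<Longrightarrow> 0 < v \<Longrightarrow> G u \<le> G v \<longleftrightarrow> u \<le> v"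
  using G_strict[of u v] G_strict[of v u] by (cases u v rule: linorder_cases) auto

text \<open>Convergence of the integral of \<open>1 / f\<close> at infinity means finite-time
  blow-up for the ODE. The bound allows a time horizon to be fixed before the height of a barrier is
  chosen.\<close>

lemma G_bounded_above: obtains C where "\<And>u. u > 0 \<Longrightarrow> G u < C"
proof -
  define C where "C = (\<integral>s. indicator {1..} s * (1 / f s) \<partial>lborel)"
  have int: "integrable lborel (\<lambda>s. indicator {1..} s * (1 / f s))"
    using f_int[of 1] by (simp add: set_integrable_def)
  have 1: "G u \<le> C" if "u \<ge> 1" for u
  proof -
    have "G u - G 1 = (\<integral>s. (1 / f s) * indicator {1..u} s \<partial>lborel)"
    proof (rule integral_FTC_Icc_real[symmetric])
      show "isCont (\<lambda>s. 1 / f s) s" if "1 \<le> s" for s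
        using that f_isCont[of s] f_pos[of s] by (intro continuous_intros) auto
    qed (use that G_deriv in auto)
    also have "\<dots> = (\<integral>s. indicator {1..u} s * (indicator {1..} s * (1 / f s)) \<partial>lborel)"
      by (rule Bochner_Integration.integral_cong) (auto simp: indicator_def)
    also have "\<dots> \<le> C"
      unfolding C_def
    proof (rule integral_mono[OF _ int])
      show "integrable lborel (\<lambda>s. indicator {1..u} s * (indicator {1..} s * (1 / f s)))"
        using integrable_real_mult_indicator[OF _ int, of "{1..u}"] by (simp add: mult_ac)
    qed (use f_pos in \<open>auto simp: indicator_def less_imp_le\<close>)
    finally show ?thesis by simp
  qed
  have "G u < C + 1" if "u > 0" for u
  proof (cases "u \<ge> 1")
    case False
    then show ?thesis using 1[of 1] G_strict[of u 1] that by simp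
  qed (use 1[of u] in simp)
  then show ?thesis by (rule that)
qed

text \<open>Since \<open>f\<close> is Lipschitz and vanishes at 0, \<open>f u \<le> K * u\<close>
  near 0, so the integral of \<open>1 / f\<close> diverges at least logarithmically there. This
  makes \<open>Phi\<close> meaningful arbitrarily far to the left.\<close>

lemma G_unbounded_below: assumes m: "m > 0" obtains u where "0 < u" "u < m" "G u < z"
proof -
  obtain K where K: "K > 0" "\<And>u v. 0 \<le> u \<Longrightarrow> u \<le> 1 \<Longrightarrow> 0 \<le> v \<Longrightarrow> v \<le> 1 \<Longrightarrow> \<bar>f u - f v\<bar> \<le> K * \<bar>u - v\<bar>"
    using f_lipschitz[of 1] by blast
  have fK: "f u \<le> K * u" if "0 < u" "u \<le> 1" for u
    using K(2)[of u 0] that f_zero by auto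
  have le: "G u \<le> ln u / K" if u: "0 < u" "u \<le> 1" for u
  proof -
    have "(\<lambda>u. G u - ln u / K) u \<le> (\<lambda>u. G u - ln u / K) 1"
    proof (rule DERIV_nonneg_imp_nondecreasing[OF u(2)])
      fix s assume s: "u \<le> s" "s \<le> 1"
      have "((\<lambda>u. G u - ln u / K) has_real_derivative 1 / f s - 1 / s / K) (at s)"
        using u s K by (auto intro!: derivative_eq_intros G_deriv)
      moreover have "1 / s / K \<le> 1 / f s"
        using fK[of s] f_pos[of s] u s K by (simp add: field_simps)
      ultimately show "\<exists>y. ((\<lambda>u. G u - ln u / K) has_real_derivative y) (at s) \<and> 0 \<le> y" by auto
    qed
    then show ?thesis by simp
  qed
  \<comment> \<open>The last entry forces \<open>ln u / K \<le> z - 1\<close>, strictly below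
    \<open>z\<close>.\<close>
  define u where "u = min (min (m / 2) 1) (exp (K * (z - 1)))"
  have u: "0 < u" "u \<le> 1" "u < m" using m by (auto simp: u_def)
  have "ln u \<le> ln (exp (K * (z - 1)))" using u by (subst ln_le_cancel_iff) (auto simp: u_def)
  then have "ln u \<le> K * (z - 1)" by simp
  then have "ln u / K < z" using K by (simp add: field_simps)
  then have "G u < z" using le[of u] u by simp
  with u show ?thesis using that m by blast
qed

text \<open>Above the supremum of \<open>G\<close> the value is arbitrary; this is why later
  statements about \<open>Phi z\<close> carry a bound \<open>z \<le> G m\<close>.\<close>

definition Phi :: "real \<Rightarrow> real" where "Phi z = inv_into {0<..} G z"

lemma Phi_G [simp]: "u > 0 \<Longrightarrow> Phi (G u) = u"
  unfolding Phi_def by (rule inv_into_f_f) (auto intro!: linorder_inj_onI' dest: G_strict)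

lemma G_surj: assumes "m > 0" "z \<le> G m" obtains u where "0 < u" "u \<le> m" "G u = z"
proof -
  obtain a where a: "0 < a" "a < m" "G a < z" using G_unbounded_below[of m z] assms by blast
  obtain u where "a \<le> u" "u \<le> m" "G u = z"
    using IVT[of G a z m] a assms G_isCont by auto
  with a show ?thesis using that[of u] by auto
qed

lemma Phi_props:
  assumes "m > 0" "z \<le> G m"
  shows "Phi z > 0" "Phi z \<le> m" "G (Phi z) = z"
  using G_surj[OF assms] by (metis Phi_G)+

lemma Phi_deriv: assumes "u > 0" shows "(Phi has_real_derivative f u) (at (G u))"
proof -
  define b where "b = G (u + 1)"
  have b: "G u < b" using G_strict[of u "u + 1"] assms by (simp add: b_def)
  have "isCont Phi (G u)"
    by (rule isCont_inverse_function[where d = "u / 2" and f = G and x = u])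
      (use assms in \<open>auto intro!: G_isCont Phi_G simp: abs_if split: if_splits\<close>)
  moreover have "G (Phi y) = y" if "y < b" for y
    using Phi_props(3)[of "u + 1" y] that assms by (simp add: b_def)
  ultimately have "(Phi has_real_derivative inverse (1 / f u)) (at (G u))"
    using b assms f_pos[of u]
    by (intro DERIV_inverse_function[where a = "G u - 1" and b = b and f = G]) (auto intro!: G_deriv)
  then show ?thesis by simp
qed

lemma Phi_deriv_eventually:
  assumes "u > 0" shows "\<forall>\<^sub>F z in nhds (G u). (Phi has_real_derivative f (Phi z)) (at z)"
proof -
  have "G u < G (u + 1)" using G_strict[of u "u + 1"] assms by simp
  then have "\<forall>\<^sub>F z in nhds (G u). z < G (u + 1)"
    by (intro eventually_nhds_in_open[of "{..<G (u + 1)}", simplified]) auto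
  then show ?thesis
  proof eventually_elim
    case (elim z)
    then show ?case using Phi_props[of "u + 1" z] Phi_deriv[of "Phi z"] assms by simp
  qed
qed

lemma f_Phi_deriv:
  assumes "u > 0" shows "((\<lambda>z. f (Phi z)) has_real_derivative f' u * f u) (at (G u))"
  using DERIV_chain2[of f "f' u" Phi "G u" "f u" UNIV] f_deriv_at[OF assms] Phi_deriv[OF assms] assms by simp

section \<open>Size of \<open>G\<close> and of \<open>f'\<close> near zero\<close>

definition L :: "real \<Rightarrow> real" where "L u = ln (exp 1 + 1 / u)"

lemma L_ge_1: assumes "u > 0" shows "L u > 1"
proof -
  have "ln (exp 1) < ln (exp 1 + 1 / u)" using assms by (subst ln_less_cancel_iff) (auto intro: add_pos_pos)
  then show ?thesis by (simp add: L_def)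
qed

lemma L_antimono: assumes "0 < u" "u \<le> v" shows "L v \<le> L u"
proof -
  have "1 / v \<le> 1 / u" using assms by (simp add: field_simps)
  then show ?thesis unfolding L_def using assms by (subst ln_le_cancel_iff) (auto intro: add_pos_pos)
qed

lemma f_eq: "0 < u \<Longrightarrow> u < 1 \<Longrightarrow> f u = u powr p * L u powr (- r)"
  using f_near_0 by (simp add: L_def)

lemma inverse_f_eq: "0 < u \<Longrightarrow> u < 1 \<Longrightarrow> 1 / f u = u powr (- p) * L u powr r"
  using L_ge_1[of u] by (simp add: f_eq powr_minus field_simps)

text \<open>On \<open>(u, 1)\<close> the logarithm is largest at the left end, so
  \<open>1 / f s\<close> is at most \<open>L u powr r * s powr (- p)\<close>, whose integral is
  explicit. The comparison is phrased as monotonicity of the difference \<open>H\<close>.\<close>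

lemma minus_G_upper:
  assumes u: "0 < u" "u < 1"
  shows "- G u \<le> L u powr r * u powr (1 - p) / (p - 1)"
proof -
  define H where "H s = G s + L u powr r * s powr (1 - p) / (p - 1)" for s
  have "H 1 \<le> H u"
  proof (rule DERIV_nonpos_imp_decreasing_open[of u 1 H])
    fix s assume s: "u < s" "s < 1"
    have "(H has_real_derivative 1 / f s + L u powr r * ((1 - p) * s powr (1 - p - 1)) / (p - 1)) (at s)"
      unfolding H_def[abs_def] using s u p by (auto intro!: derivative_eq_intros G_deriv)
    moreover have "L u powr r * ((1 - p) * s powr (1 - p - 1)) / (p - 1) = - (L u powr r * s powr (- p))"
      using p by (simp add: field_simps)
    moreover have "1 / f s \<le> L u powr r * s powr (- p)"
      using L_antimono[of u s] L_ge_1[of s] s u r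
      by (simp add: inverse_f_eq mult.commute[of "s powr _"] mult_right_mono powr_mono2)
    ultimately show "\<exists>y. (H has_real_derivative y) (at s) \<and> y \<le> 0" by force
  next
    show "continuous_on {u..1} H"
      unfolding H_def[abs_def] using u p
      by (intro continuous_at_imp_continuous_on ballI continuous_intros G_isCont) auto
  qed (use u in auto)
  moreover have "H 1 \<ge> 0" using p by (simp add: H_def)
  ultimately show ?thesis by (simp add: H_def)
qed

text \<open>Only the stretch from \<open>u\<close> to \<open>2 * u\<close> is kept, where
  \<open>1 / f\<close> is bounded below by its expression at \<open>2 * u\<close>; compared with the
  upper bound this loses only constants and the shift in \<open>L\<close>.\<close>

lemma minus_G_lower:
  assumes u: "0 < u" "2 * u \<le> 1"
  shows "- G u \<ge> 2 powr (- p) * u powr (1 - p) * L (2 * u) powr r"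
proof -
  obtain s where s: "u < s" "s < 2 * u" "G (2 * u) - G u = (2 * u - u) * (1 / f s)"
    using MVT2[of u "2 * u" G "\<lambda>s. 1 / f s"] G_deriv u by force
  have "G (2 * u) \<le> G 1" using G_le_iff[of "2 * u" 1] u by simp
  then have "- G u \<ge> u * (1 / f s)" using s by simp
  moreover have "1 / f s \<ge> (2 * u) powr (- p) * L (2 * u) powr r"
    unfolding inverse_f_eq[of s, OF less_trans[OF u(1) s(1)] less_le_trans[OF s(2) u(2)]]
    using s u p r L_ge_1[of "2 * u"] L_antimono[of s "2 * u"]
    by (intro mult_mono powr_mono2' powr_mono2) auto
  then have "u * (1 / f s) \<ge> u * ((2 * u) powr (- p) * L (2 * u) powr r)"
    using u by (intro mult_left_mono) auto
  moreover have "u * (2 * u) powr (- p) = 2 powr (- p) * u powr (1 - p)"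
    using u by (simp add: powr_mult powr_diff powr_minus field_simps)
  ultimately show ?thesis by (simp add: mult.assoc[symmetric])
qed

text \<open>The logarithmic derivative of \<open>f\<close> is
  \<open>(p + r / (L u * (1 + e * u))) / u\<close>. Dropping \<open>e * u\<close> and multiplying by
  the upper bound for \<open>- G u\<close>, all powers of \<open>u\<close> and \<open>L u\<close>
  cancel.\<close>

lemma f'_minus_G:
  assumes u: "0 < u" "u < 1"
  shows "f' u * (- G u) \<le> (p + r / L u) / (p - 1)"
proof -
  have L: "L u > 1" using L_ge_1 u by simp
  define E where "E = exp (1::real) + 1 / u"
  have E: "E > 0" using u by (auto simp: E_def intro: add_pos_pos)
  have LE: "L u = ln E" by (simp add: L_def E_def)
  have dL: "(L has_real_derivative - (1 / u\<^sup>2) / E) (at u)"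
    unfolding L_def[abs_def] E_def using u E
    by (auto intro!: derivative_eq_intros simp: E_def power2_eq_square divide_inverse)
  have "((\<lambda>u. u powr p * L u powr (- r)) has_real_derivative
      p * u powr (p - 1) * L u powr (- r) + (- r * L u powr (- r - 1) * (- (1 / u\<^sup>2) / E)) * u powr p) (at u)"
    using L u by (auto intro!: derivative_eq_intros dL)
  moreover have "(f has_real_derivative f' u) (at u within {0<..<1})"
    using f_deriv_at[OF u(1)] by (rule has_field_derivative_at_within)
  \<comment> \<open>The explicit formula holds on \<open>(0, 1)\<close> only, so the derivative is
    first identified within that interval, which is open.\<close>
  then have "((\<lambda>u. u powr p * L u powr (- r)) has_real_derivative f' u) (at u within {0<..<1})"
    by (rule has_field_derivative_transform_within[OF _ zero_less_one]) (use u f_eq in auto)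
  then have "((\<lambda>u. u powr p * L u powr (- r)) has_real_derivative f' u) (at u)"
    using at_within_open[of u "{0<..<1}"] u by simp
  ultimately have "f' u = p * u powr (p - 1) * L u powr (- r) + (- r * L u powr (- r - 1) * (- (1 / u\<^sup>2) / E)) * u powr p"
    using DERIV_unique by blast
  also have "\<dots> = u powr (p - 1) * L u powr (- r) * (p + r / L u * (1 / (u * E)))"
  proof -
    have "u powr p = u powr (p - 1) * u" using u by (simp add: powr_diff)
    moreover have "L u powr (- r - 1) = L u powr (- r) / L u" using L by (simp add: powr_diff)
    ultimately show ?thesis using u E L by (simp add: field_simps power2_eq_square)
  qed
  also have "\<dots> \<le> u powr (p - 1) * L u powr (- r) * (p + r / L u)"
  proof -
    have "u * E \<ge> 1" using u by (simp add: E_def algebra_simps)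
    then have "r / L u * (1 / (u * E)) \<le> r / L u * 1"
      using L r by (intro mult_left_mono) (auto simp: divide_le_eq_1)
    then show ?thesis by (intro mult_left_mono) auto
  qed
  finally have 1: "f' u \<le> u powr (p - 1) * L u powr (- r) * (p + r / L u)" .
  have "f' u * (- G u) \<le> f' u * (L u powr r * u powr (1 - p) / (p - 1))"
    using minus_G_upper[OF u] f'_pos[of u] u by (intro mult_left_mono) auto
  also have "\<dots> \<le> (u powr (p - 1) * L u powr (- r) * (p + r / L u)) * (L u powr r * u powr (1 - p) / (p - 1))"
    using 1 p by (intro mult_right_mono) auto
  also have "\<dots> = (u powr (p - 1) * u powr (1 - p)) * (L u powr (- r) * L u powr r) * (p + r / L u) / (p - 1)"
    by simp
  also have "\<dots> = (p + r / L u) / (p - 1)"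
    using u L by (simp add: powr_add[symmetric])
  finally show ?thesis .
qed

text \<open>The condition under which \<open>v \<mapsto> \<Phi>(-A v\<^sup>-\<^sup>1\<^sup>/\<^sup>\<kappa>)\<close> is concave near \<open>0\<close>.\<close>

lemma f'_minus_G_small:
  assumes \<kappa>: "\<kappa> > 1 / (p - 1)"
  obtains m where "0 < m" "m < 1" "\<And>u. 0 < u \<Longrightarrow> u \<le> m \<Longrightarrow> f' u * (- G u) \<le> \<kappa> + 1"
proof -
  \<comment> \<open>\<open>\<delta> / (p - 1)\<close> is the gap between \<open>\<kappa> + 1\<close>
    and \<open>p / (p - 1)\<close>. The choice of \<open>m\<close> gives
    \<open>L m \<ge> ln (1 / m) = r / \<delta>\<close>, so the logarithmic error fits into the
    gap.\<close>
  define \<delta> where "\<delta> = (\<kappa> + 1) * (p - 1) - p"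
  have \<delta>: "\<delta> > 0" using \<kappa> p by (simp add: \<delta>_def field_simps)
  define m where "m = exp (- r / \<delta>)"
  have m: "0 < m" "m < 1" using r \<delta> by (auto simp: m_def)
  have "f' u * (- G u) \<le> \<kappa> + 1" if u: "0 < u" "u \<le> m" for u
  proof -
    have "r / \<delta> \<le> L m"
    proof -
      have "r / \<delta> = ln (1 / m)" by (simp add: m_def ln_div)
      also have "\<dots> \<le> L m" unfolding L_def using m by (subst ln_le_cancel_iff) (auto intro: add_pos_pos)
      finally show ?thesis .
    qed
    also have "L m \<le> L u" using L_antimono u by simp
    finally have "r / L u \<le> \<delta>" using \<delta> L_ge_1[of u] u by (simp add: field_simps)
    then have "(p + r / L u) / (p - 1) \<le> (p + \<delta>) / (p - 1)" using p by (intro divide_right_mono) auto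
    also have "\<dots> = \<kappa> + 1" using p by (simp add: \<delta>_def)
    finally show ?thesis using f'_minus_G[of u] u m by simp
  qed
  with m show ?thesis using that by blast
qed

end

section \<open>The initial datum seen through \<open>G\<close>\<close>

lemma ln_add_bounds:
  assumes "y \<ge> (0::real)"
  shows "1 \<le> ln (y + exp 1)" "ln (y + 1) \<le> ln (y + exp 1)" "ln (y + exp 1) \<le> 1 + ln (y + 1)"
proof -
  show "1 \<le> ln (y + exp 1)" using assms by (subst ln_ge_iff) (auto intro: add_nonneg_pos)
  show "ln (y + 1) \<le> ln (y + exp 1)" using assms by (subst ln_le_cancel_iff) (auto intro: add_nonneg_pos)
  have "y * 1 \<le> y * exp 1" using assms by (intro mult_left_mono) auto
  then have "y + exp 1 \<le> exp 1 * (y + 1)" by (simp add: algebra_simps)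
  then have "ln (y + exp 1) \<le> ln (exp 1 * (y + 1))" using assms by (subst ln_le_cancel_iff) (auto intro: add_nonneg_pos)
  also have "\<dots> = 1 + ln (y + 1)" using assms by (subst ln_mult) auto
  finally show "ln (y + exp 1) \<le> 1 + ln (y + 1)" .
qed

text \<open>Apply \<open>ln z \<le> z - 1\<close> to \<open>z = (y + 1) powr (1 / (1 + r))\<close>:
  raised to the power \<open>r * k\<close> this gives the exponent \<open>r * k / (1 + r)\<close>,
  which is at most \<open>k\<close>.\<close>

lemma ln_powr_le_powr:
  fixes r k :: real
  assumes r: "r > 0" and k: "k > 0"
  shows "\<exists>D>0. \<forall>y\<ge>0. ln (y + exp 1) powr (r * k) \<le> D * (y + 1) powr k"
proof -
  have "ln (y + exp 1) powr (r * k) \<le> (2 + r) powr (r * k) * (y + 1) powr k" if "y \<ge> 0" for y :: real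
  proof -
    have "ln (y + 1) / (1 + r) \<le> (y + 1) powr (1 / (1 + r))"
      using ln_le_minus_one[of "(y + 1) powr (1 / (1 + r))"] that by (simp add: ln_powr)
    then have "ln (y + 1) \<le> (1 + r) * (y + 1) powr (1 / (1 + r))" using r by (simp add: field_simps)
    moreover have "(y + 1) powr (1 / (1 + r)) \<ge> 1" using that r by (intro ge_one_powr_ge_zero) auto
    ultimately have "ln (y + exp 1) \<le> (2 + r) * (y + 1) powr (1 / (1 + r))"
      using ln_add_bounds(3)[OF that] by (simp add: algebra_simps)
    then have "ln (y + exp 1) powr (r * k) \<le> ((2 + r) * (y + 1) powr (1 / (1 + r))) powr (r * k)"
      using ln_add_bounds(1)[OF that] r k by (intro powr_mono2) auto
    also have "\<dots> = (2 + r) powr (r * k) * (y + 1) powr (1 / (1 + r) * (r * k))"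
      using r by (simp add: powr_mult powr_powr)
    also have "\<dots> \<le> (2 + r) powr (r * k) * (y + 1) powr k"
      using that r k by (intro mult_left_mono powr_mono) (auto simp: field_simps)
    finally show ?thesis .
  qed
  then show ?thesis using r by (intro exI[of _ "(2 + r) powr (r * k)"]) auto
qed

lemma initial_datum_pos:
  assumes "c > 0" shows "initial_datum p r c x > 0"
proof -
  have "norm x + 1 > 0" by (intro add_nonneg_pos) auto
  then show ?thesis
    using assms ln_add_bounds(1)[of "norm x"] by (auto simp: initial_datum_def intro!: mult_pos_pos)
qed

text \<open>The estimates of \<open>- G u\<close> contain \<open>u powr (1 - p)\<close> times an
  \<open>r\<close>-th power of a logarithm; at the datum the factor \<open>powr (- r)\<close> found
  here cancels that logarithm and leaves a quadratic.\<close>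

lemma initial_datum_powr:
  assumes "c > 0" "p > 1"
  shows "initial_datum p r c x powr (1 - p) = c powr (1 - p) * (norm x + 1)\<^sup>2 * ln (norm x + exp 1) powr (- r)"
proof -
  have "- 2 / (p - 1) * (1 - p) = 2" "r / (p - 1) * (1 - p) = - r" using assms by (auto simp: field_simps)
  then show ?thesis
    using assms unfolding initial_datum_def
    by (simp add: powr_mult powr_powr del: minus_mult_right)
qed

context fujita_nonlinearity
begin

text \<open>Where the datum is at least 1, \<open>G\<close> is nonnegative. Elsewhere
  \<open>minus_G_upper\<close> bounds \<open>- G\<close> by a multiple of
  \<open>c powr (1 - p) * (norm x + 1)\<^sup>2\<close>, and the factor in \<open>c\<close> decreases
  to 0.\<close>

lemma initial_datum_large:
  assumes a: "a > 0"
  obtains c1 where "c1 \<ge> 1"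
    "\<And>c (x::'a::euclidean_space). c > c1 \<Longrightarrow> - a * (1 + (norm x)\<^sup>2) \<le> G (initial_datum p r c x)"
proof -
  define k where "k = 2 / (p - 1)"
  have k: "k > 0" using p by (simp add: k_def)
  \<comment> \<open>The estimates below end in
    \<open>(a / 2) * (norm x + 1)\<^sup>2 * (C / c powr (p - 1))\<close>; the factor 1/2 pays for
    \<open>(norm x + 1)\<^sup>2 \<le> 2 * (1 + (norm x)\<^sup>2)\<close>. The bound
    \<open>c > 1\<close> is used for the polynomial lower bound of the datum.\<close>
  define C where "C = 2 * (2 + k) powr r / (a * (p - 1))"
  define c1 where "c1 = max 1 (C powr (1 / (p - 1)))"
  have C: "C > 0" using a p k by (simp add: C_def)
  have "- a * (1 + (norm x)\<^sup>2) \<le> G (initial_datum p r c x)" if c: "c > c1" for c and x :: 'a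
  proof (cases "initial_datum p r c x \<ge> 1")
    case True
    then have "G 1 \<le> G (initial_datum p r c x)" by (subst G_le_iff) auto
    moreover have "a * (1 + (norm x)\<^sup>2) \<ge> 0" using a by simp
    ultimately show ?thesis by simp
  next
    case False
    define u where "u = initial_datum p r c x"
    define l where "l = ln (norm x + exp 1)"
    have c': "c > 1" "c > C powr (1 / (p - 1))" using c by (auto simp: c1_def)
    have u: "0 < u" "u < 1" using False initial_datum_pos[of c p r x] c' by (auto simp: u_def)
    have l: "l \<ge> 1" "ln (norm x + 1) \<le> l" using ln_add_bounds[of "norm x"] by (auto simp: l_def)
    \<comment> \<open>Only \<open>u \<ge> (norm x + 1) powr (- k)\<close> is used: inside the
      logarithm a cruder power costs just a constant factor.\<close>
    have Lu: "L u \<le> (2 + k) * l"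
    proof -
      have "u \<ge> (norm x + 1) powr (- k)"
      proof -
        have "u = c * (norm x + 1) powr (- k) * l powr (r / (p - 1))"
          by (simp add: u_def initial_datum_def k_def l_def)
        moreover have "l powr (r / (p - 1)) \<ge> 1" using l r p by (intro ge_one_powr_ge_zero) auto
        moreover have "c * (norm x + 1) powr (- k) \<ge> 1 * (norm x + 1) powr (- k)"
          using c' by (intro mult_right_mono) auto
        ultimately show ?thesis using c'
          by (smt (verit, best) mult_le_cancel_left1 powr_ge_zero)
      qed
      moreover have P: "(1 + norm x) powr k > 0" using norm_ge_zero[of x] by (subst powr_gt_zero) linarith
      ultimately have "1 / u \<le> (norm x + 1) powr k"
        using u P by (simp add: powr_minus field_simps)
      moreover have "(norm x + 1) powr k \<ge> 1" using k by (intro ge_one_powr_ge_zero) auto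
      moreover have "exp 1 * 1 \<le> exp 1 * (norm x + 1) powr k"
        using calculation(2) by (intro mult_left_mono) auto
      moreover have "exp 1 * (norm x + 1) powr k \<ge> 1 * (norm x + 1) powr k"
        by (intro mult_right_mono) auto
      ultimately have "exp 1 + 1 / u \<le> 2 * exp 1 * (norm x + 1) powr k" by linarith
      also have "\<dots> \<le> exp 1 * exp 1 * (norm x + 1) powr k"
        using exp_ge_add_one_self[of 1] by (intro mult_right_mono) auto
      finally have "exp 1 + 1 / u \<le> exp 2 * (norm x + 1) powr k" by (simp add: exp_add[symmetric])
      then have "L u \<le> ln (exp 2 * (norm x + 1) powr k)"
        unfolding L_def using u P by (subst ln_le_cancel_iff) (auto intro: add_pos_pos simp: add_nonneg_eq_0_iff)
      also have "\<dots> = 2 + k * ln (norm x + 1)" by (subst ln_mult) (auto simp: ln_powr add_nonneg_eq_0_iff)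
      also have "\<dots> \<le> 2 * l + k * l" using l k by (intro add_mono mult_left_mono) auto
      finally show ?thesis by (simp add: algebra_simps)
    qed
    have cC: "c powr (p - 1) \<ge> C"
    proof -
      have "(C powr (1 / (p - 1))) powr (p - 1) \<le> c powr (p - 1)"
        using c' p by (intro powr_mono2) auto
      then show ?thesis using p C by (simp add: powr_powr)
    qed
    have "- G u \<le> L u powr r * u powr (1 - p) / (p - 1)" using minus_G_upper[OF u] .
    also have "\<dots> \<le> ((2 + k) * l) powr r * u powr (1 - p) / (p - 1)"
      using Lu L_ge_1[of u] u r p by (intro divide_right_mono mult_right_mono powr_mono2) auto
    also have "\<dots> = (2 + k) powr r * c powr (1 - p) * (norm x + 1)\<^sup>2 / (p - 1) * (l powr r * l powr (- r))"
      using initial_datum_powr[of c p r x] c' p k l by (simp add: u_def powr_mult l_def)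
    also have "l powr r * l powr (- r) = 1" using l by (simp add: powr_add[symmetric])
    also have "(2 + k) powr r * c powr (1 - p) * (norm x + 1)\<^sup>2 / (p - 1) * 1 = (a / 2) * (norm x + 1)\<^sup>2 * (C / c powr (p - 1))"
      using a p c' by (simp add: C_def powr_diff field_simps)
    also have "\<dots> \<le> (a / 2) * (norm x + 1)\<^sup>2 * 1"
      using cC a c' by (intro mult_left_mono) (auto simp: divide_le_eq_1)
    also have "\<dots> \<le> (a / 2) * (2 * (1 + (norm x)\<^sup>2))"
      unfolding mult_1_right using a zero_le_power2[of "norm x - 1"]
      by (intro mult_left_mono) (auto simp: power2_eq_square algebra_simps)
    finally show ?thesis by (simp add: u_def algebra_simps)
  qed
  then show ?thesis using that[of c1] by (auto simp: c1_def)
qed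

text \<open>The mirror image of the previous lemma: \<open>minus_G_lower\<close> bounds
  \<open>- G\<close> from below by a multiple of
  \<open>c powr (1 - p) * (norm x + 1)\<^sup>2\<close>, which grows without bound as
  \<open>c\<close> tends to 0.\<close>

lemma initial_datum_small:
  assumes A: "A > 0"
  obtains c0 where "c0 > 0" "c0 \<le> 1"
    "\<And>c (x::'a::euclidean_space). 0 < c \<Longrightarrow> c < c0 \<Longrightarrow> G (initial_datum p r c x) \<le> - A * (1 + (norm x)\<^sup>2)"
proof -
  define k where "k = 1 / (p - 1)"
  have k: "k > 0" using p by (simp add: k_def)
  \<comment> \<open>\<open>L (2 * u)\<close> is at least 1 and at least
    \<open>k * ln (norm x + 1)\<close>; averaging the two bounds produces
    \<open>\<eta> * l\<close>.\<close>
  define \<eta> where "\<eta> = min 1 k / 2"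
  have \<eta>: "\<eta> > 0" using k by (simp add: \<eta>_def)
  obtain D where D: "D > 0" "\<And>y::real. y \<ge> 0 \<Longrightarrow> ln (y + exp 1) powr (r * k) \<le> D * (y + 1) powr k"
    using ln_powr_le_powr[OF r k] by metis
  define E where "E = 2 powr (- p) * \<eta> powr r / A"
  have E: "E > 0" using A \<eta> by (simp add: E_def)
  \<comment> \<open>The three entries: \<open>2 * u \<le> 1\<close>, so that the formula for
    \<open>f\<close> near 0 applies; \<open>c0 \<le> 1\<close>, which later orders the two
    thresholds; and \<open>c powr (p - 1) \<le> E\<close>.\<close>
  define c0 where "c0 = min (1 / (2 * D)) (min 1 (E powr k))"
  have c0: "c0 > 0" using D E by (simp add: c0_def)
  have "G (initial_datum p r c x) \<le> - A * (1 + (norm x)\<^sup>2)" if c: "0 < c" "c < c0" for c and x :: 'a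
  proof -
    define u where "u = initial_datum p r c x"
    define l where "l = ln (norm x + exp 1)"
    have u: "u > 0" using initial_datum_pos[of c p r x] c by (simp add: u_def)
    have l: "l \<ge> 1" "l \<le> 1 + ln (norm x + 1)" using ln_add_bounds[of "norm x"] by (auto simp: l_def)
    \<comment> \<open>Half of the decay \<open>(norm x + 1) powr (- (2 * k))\<close> is spent on
      absorbing the logarithmic power.\<close>
    have ule: "2 * u \<le> (norm x + 1) powr (- k)"
    proof -
      have "2 * u = 2 * c * ((norm x + 1) powr (- (2 * k)) * l powr (r * k))"
        by (simp add: u_def initial_datum_def k_def l_def)
      also have "\<dots> \<le> 2 * c * ((norm x + 1) powr (- (2 * k)) * (D * (norm x + 1) powr k))"
        using D(2)[of "norm x"] c by (intro mult_left_mono) (auto simp: l_def)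
      also have "\<dots> = (2 * c * D) * ((norm x + 1) powr (- (2 * k)) * (norm x + 1) powr k)" by simp
      also have "(norm x + 1) powr (- (2 * k)) * (norm x + 1) powr k = (norm x + 1) powr (- k)"
        by (simp add: powr_add[symmetric])
      also have "2 * c * D * (norm x + 1) powr (- k) \<le> 1 * (norm x + 1) powr (- k)"
        using c D by (intro mult_right_mono) (auto simp: c0_def field_simps)
      finally show ?thesis by simp
    qed
    also have k1: "(norm x + 1) powr (- k) \<le> 1" using k powr_mono[of "-k" 0 "norm x + 1"] by (simp split: if_splits)
    finally have u2: "2 * u \<le> 1" .
    have Lu: "L (2 * u) \<ge> \<eta> * l"
    proof -
      have P: "(1 + norm x) powr k > 0" using norm_ge_zero[of x] by (subst powr_gt_zero) linarith
      have i: "1 / (2 * u) \<ge> (norm x + 1) powr k"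
        using ule u P by (simp add: powr_minus field_simps)
      have "k * ln (norm x + 1) = ln ((norm x + 1) powr k)" by (simp add: ln_powr)
      also have "\<dots> \<le> L (2 * u)"
        unfolding L_def using i u by (subst ln_le_cancel_iff) (auto intro: add_pos_pos order_trans add_nonneg_pos simp: add_nonneg_eq_0_iff)
      finally have "k * ln (norm x + 1) \<le> L (2 * u)" .
      moreover have "L (2 * u) \<ge> 1" using L_ge_1[of "2 * u"] u by simp
      moreover have "min 1 k * (1 + ln (norm x + 1)) \<le> 1 + k * ln (norm x + 1)"
        unfolding distrib_left using k by (intro add_mono mult_right_mono) auto
      moreover have "min 1 k * l \<le> min 1 k * (1 + ln (norm x + 1))"
        using l k by (intro mult_left_mono) auto
      ultimately show ?thesis by (simp add: \<eta>_def)
    qed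
    have cE: "c powr (p - 1) \<le> E"
    proof -
      have "c powr (p - 1) \<le> (E powr k) powr (p - 1)"
        using c p by (intro powr_mono2) (auto simp: c0_def)
      then show ?thesis using p E by (simp add: powr_powr k_def)
    qed
    have "A * (1 + (norm x)\<^sup>2) \<le> A * (norm x + 1)\<^sup>2 * 1"
      unfolding mult_1_right using A by (intro mult_left_mono) (auto simp: power2_eq_square algebra_simps)
    also have "\<dots> \<le> A * (norm x + 1)\<^sup>2 * (E / c powr (p - 1))"
      using cE A c by (intro mult_left_mono) (auto simp: le_divide_eq_1)
    also have "\<dots> = 2 powr (- p) * (c powr (1 - p) * (norm x + 1)\<^sup>2 * (l powr (- r) * l powr r)) * \<eta> powr r"
    proof -
      have "l powr (- r) * l powr r = 1" using l by (simp add: powr_add[symmetric])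
      moreover have "c powr (1 - p) = 1 / c powr (p - 1)" using c by (simp add: powr_diff)
      ultimately show ?thesis using A by (simp add: E_def field_simps)
    qed
    also have "\<dots> = 2 powr (- p) * u powr (1 - p) * (\<eta> * l) powr r"
      using initial_datum_powr[of c p r x] c p l \<eta> by (simp add: u_def powr_mult l_def)
    also have "\<dots> \<le> 2 powr (- p) * u powr (1 - p) * L (2 * u) powr r"
      using Lu \<eta> l r by (intro mult_left_mono powr_mono2) auto
    also have "\<dots> \<le> - G u" using minus_G_lower u u2 by simp
    finally show ?thesis by (simp add: u_def)
  qed
  with c0 show ?thesis using that[of c0] by (auto simp: c0_def)
qed

end

section \<open>A supersolution for a pure power nonlinearity\<close>

lemma sum_inner_Basis_power2: "(\<Sum>i\<in>Basis. (x \<bullet> i)\<^sup>2) = (norm x)\<^sup>2" for x :: "'a::euclidean_space"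
  unfolding power2_norm_eq_inner unfolding power2_eq_square by (rule euclidean_inner[symmetric])

lemma parabolic_jet_rho: "parabolic_jet (\<lambda>x t. (t + 1) + (norm x)\<^sup>2) (x::'a::euclidean_space) t 1 (\<lambda>i. 2 * (x \<bullet> i)) (\<lambda>i. 2)"
proof -
  have "((\<lambda>t. t + 1) has_real_derivative 1) (at t)" by (auto intro!: derivative_eq_intros)
  from parabolic_jet_add[OF parabolic_jet_time[OF this, of x] parabolic_jet_norm2[of x t]] show ?thesis by simp
qed

lemma parabolic_jet_rho_powr:
  fixes x :: "'a::euclidean_space"
  assumes "t \<ge> 0"
  defines "\<rho> \<equiv> (t + 1) + (norm x)\<^sup>2"
  shows "parabolic_jet (\<lambda>x t. ((t + 1) + (norm x)\<^sup>2) powr s) x t (s * \<rho> powr (s - 1))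
     (\<lambda>i. s * \<rho> powr (s - 1) * (2 * (x \<bullet> i)))
     (\<lambda>i. s * (s - 1) * \<rho> powr (s - 2) * (2 * (x \<bullet> i))\<^sup>2 + s * \<rho> powr (s - 1) * 2)"
proof -
  have \<rho>: "\<rho> > 0" using assms by (auto simp: \<rho>_def intro: add_pos_nonneg)
  have ev: "\<forall>\<^sub>F y in nhds \<rho>. ((\<lambda>y. y powr s) has_real_derivative s * y powr (s - 1)) (at y)"
    using eventually_nhds_in_open[of "{0<..}" \<rho>, simplified, OF \<rho>]
    by eventually_elim (auto intro!: derivative_eq_intros)
  have "((\<lambda>y. s * y powr (s - 1)) has_real_derivative s * ((s - 1) * \<rho> powr (s - 1 - 1))) (at \<rho>)"
    using \<rho> by (auto intro!: derivative_eq_intros)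
  then have "((\<lambda>y. s * y powr (s - 1)) has_real_derivative s * (s - 1) * \<rho> powr (s - 2)) (at \<rho>)"
    by (simp add: mult.assoc)
  from parabolic_jet_compose[OF parabolic_jet_rho ev[unfolded \<rho>_def] this[unfolded \<rho>_def]]
  show ?thesis by (rule parabolic_jet_cong) (auto simp: \<rho>_def)
qed

text \<open>The gradient term is controlled by \<open>(norm x)\<^sup>2 \<le> \<rho>\<close>; what
  remains is \<open>(2 * N - 1) * s * \<rho> powr (- s - 1)\<close>, which is nonnegative and
  dropped.\<close>

lemma heat_rho_powr_lower:
  fixes x :: "'a::euclidean_space"
  assumes "t \<ge> 0" "s > 0"
  defines "\<rho> \<equiv> (t + 1) + (norm x)\<^sup>2"
  shows "- s * \<rho> powr (- s - 1) - (\<Sum>i\<in>Basis. - s * (- s - 1) * \<rho> powr (- s - 2) * (2 * (x \<bullet> i))\<^sup>2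
           + - s * \<rho> powr (- s - 1) * 2) \<ge> - 4 * s * (s + 1) * \<rho> powr (- s - 1)"
proof -
  have \<rho>: "\<rho> > 0" using assms by (auto simp: \<rho>_def intro: add_pos_nonneg)
  have 1: "(\<Sum>i\<in>Basis. - s * (- s - 1) * \<rho> powr (- s - 2) * (2 * (x \<bullet> i))\<^sup>2 + - s * \<rho> powr (- s - 1) * 2)
     = 4 * s * (s + 1) * \<rho> powr (- s - 2) * (norm x)\<^sup>2 - 2 * s * real DIM('a) * \<rho> powr (- s - 1)"
  proof -
    have "- s * (- s - 1) * \<rho> powr (- s - 2) * (2 * (x \<bullet> i))\<^sup>2 + - s * \<rho> powr (- s - 1) * 2
       = 4 * s * (s + 1) * \<rho> powr (- s - 2) * (x \<bullet> i)\<^sup>2 - 2 * s * \<rho> powr (- s - 1)" for i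
      by (simp add: power_mult_distrib algebra_simps)
    then have "(\<Sum>i\<in>Basis. - s * (- s - 1) * \<rho> powr (- s - 2) * (2 * (x \<bullet> i))\<^sup>2 + - s * \<rho> powr (- s - 1) * 2)
       = (\<Sum>i\<in>Basis. 4 * s * (s + 1) * \<rho> powr (- s - 2) * (x \<bullet> i)\<^sup>2 - 2 * s * \<rho> powr (- s - 1))"
      by (intro sum.cong refl)
    also have "\<dots> = 4 * s * (s + 1) * \<rho> powr (- s - 2) * (\<Sum>i\<in>Basis. (x \<bullet> i)\<^sup>2) - real DIM('a) * (2 * s * \<rho> powr (- s - 1))"
      by (simp only: sum_subtractf sum_distrib_left[symmetric] sum_constant) (simp only: mult_ac)
    finally show ?thesis unfolding sum_inner_Basis_power2 by (simp only: mult_ac)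
  qed
  have "\<rho> powr (- s - 2) * (norm x)\<^sup>2 \<le> \<rho> powr (- s - 1)"
  proof -
    have "\<rho> powr (- s - 2) * (norm x)\<^sup>2 \<le> \<rho> powr (- s - 2) * \<rho>"
      using assms by (intro mult_left_mono) (auto simp: \<rho>_def)
    also have "\<dots> = \<rho> powr (- s - 2 + 1)" using \<rho> by (subst powr_add) simp
    also have "- s - 2 + 1 = - s - 1" by simp
    finally show ?thesis .
  qed
  then have 2: "4 * s * (s + 1) * (\<rho> powr (- s - 2) * (norm x)\<^sup>2) \<le> 4 * s * (s + 1) * \<rho> powr (- s - 1)"
    using assms by (intro mult_left_mono) auto
  have N: "1 \<le> 2 * real DIM('a)"
  proof -
    have "1 \<le> DIM('a)" using DIM_positive[where 'a='a] by linarith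
    then have "real 1 \<le> real DIM('a)" by (simp only: of_nat_le_iff)
    then show ?thesis unfolding of_nat_1 by linarith
  qed
  have 3: "s * \<rho> powr (- s - 1) * 1 \<le> s * \<rho> powr (- s - 1) * (2 * real DIM('a))"
    using assms N by (intro mult_left_mono) auto
  show ?thesis unfolding 1 using 2 3 by (simp add: algebra_simps)
qed

text \<open>With \<open>s = N / 2\<close> this is, up to a constant, the heat kernel at time
  \<open>t + 1\<close>. A slower decay \<open>s\<close> leaves only the difference of the two time
  factors, so the heat operator is positive for \<open>s < N / 2\<close>.\<close>

lemma parabolic_jet_gauss:
  fixes x :: "'a::euclidean_space"
  assumes t: "t \<ge> 0"
  defines "E \<equiv> exp (- (norm x)\<^sup>2 / (4 * (t + 1)))"
  shows "\<exists>a p q. parabolic_jet (\<lambda>x t. (t + 1) powr (- s) * exp (- (norm x)\<^sup>2 / (4 * (t + 1)))) x t a p q \<and>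
    a - (\<Sum>i\<in>Basis. q i) = (real DIM('a) / 2 - s) * (t + 1) powr (- s - 1) * E"
proof -
  define T where "T = t + 1"
  have T: "T > 0" using t by (simp add: T_def)
  have "((\<lambda>t. inverse (t + 1)) has_real_derivative - (inverse (t + 1) * 1 * inverse (t + 1))) (at t)"
    by (rule DERIV_inverse') (use T in \<open>auto intro!: derivative_eq_intros simp: T_def\<close>)
  from DERIV_cmult[OF this, of "- 1 / 4"]
  have c: "((\<lambda>t. - 1 / (4 * (t + 1))) has_real_derivative 1 / (4 * T\<^sup>2)) (at t)"
    by (simp add: inverse_eq_divide T_def power2_eq_square)
  have d: "((\<lambda>t. (t + 1) powr (- s)) has_real_derivative - s * T powr (- s - 1)) (at t)"
    using T by (auto intro!: derivative_eq_intros simp: T_def)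
  have p1: "parabolic_jet (\<lambda>x t. - 1 / (4 * (t + 1)) * (norm x)\<^sup>2) x t
     (1 / (4 * T\<^sup>2) * (norm x)\<^sup>2 + - 1 / (4 * (t + 1)) * 0)
     (\<lambda>i. - 1 / (4 * (t + 1)) * (2 * (x \<bullet> i))) (\<lambda>i. - 1 / (4 * (t + 1)) * 2)"
    by (rule parabolic_jet_time_mult[OF parabolic_jet_norm2 c])
  have p2: "parabolic_jet (\<lambda>x t. exp (- 1 / (4 * (t + 1)) * (norm x)\<^sup>2)) x t
     (exp (- 1 / (4 * (t + 1)) * (norm x)\<^sup>2) * (1 / (4 * T\<^sup>2) * (norm x)\<^sup>2 + - 1 / (4 * (t + 1)) * 0))
     (\<lambda>i. exp (- 1 / (4 * (t + 1)) * (norm x)\<^sup>2) * (- 1 / (4 * (t + 1)) * (2 * (x \<bullet> i))))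
     (\<lambda>i. exp (- 1 / (4 * (t + 1)) * (norm x)\<^sup>2) * (- 1 / (4 * (t + 1)) * (2 * (x \<bullet> i)))\<^sup>2
        + exp (- 1 / (4 * (t + 1)) * (norm x)\<^sup>2) * (- 1 / (4 * (t + 1)) * 2))"
    by (rule parabolic_jet_compose[OF p1, where P = exp and ?P1.0 = exp]) (auto intro!: always_eventually derivative_eq_intros)
  have E: "exp (- 1 / (4 * (t + 1)) * (norm x)\<^sup>2) = E" by (simp add: E_def)
  define a p q where "a = - s * T powr (- s - 1) * E + T powr (- s) * (E * (1 / (4 * T\<^sup>2) * (norm x)\<^sup>2))"
    and "p = (\<lambda>i. T powr (- s) * (E * (- 1 / (4 * T) * (2 * (x \<bullet> i)))))"
    and "q = (\<lambda>i. T powr (- s) * (E * (- 1 / (4 * T) * (2 * (x \<bullet> i)))\<^sup>2 + E * (- 1 / (4 * T) * 2)))"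
  have p3: "parabolic_jet (\<lambda>x t. (t + 1) powr (- s) * exp (- 1 / (4 * (t + 1)) * (norm x)\<^sup>2)) x t a p q"
    by (rule parabolic_jet_cong[OF parabolic_jet_time_mult[OF p2 d]])
       (use E in \<open>auto simp: a_def p_def q_def T_def\<close>)
  have "(\<Sum>i\<in>Basis. q i) = T powr (- s) * (E * (1 / (4 * T\<^sup>2) * (norm x)\<^sup>2)) - T powr (- s) * E * real DIM('a) / (2 * T)"
  proof -
    have "q i = T powr (- s) * E * (1 / (4 * T\<^sup>2)) * (x \<bullet> i)\<^sup>2 - T powr (- s) * E / (2 * T)" for i
      unfolding q_def using T by (simp add: power2_eq_square field_simps)
    then have "(\<Sum>i\<in>Basis. q i) = (\<Sum>i\<in>Basis. T powr (- s) * E * (1 / (4 * T\<^sup>2)) * (x \<bullet> i)\<^sup>2 - T powr (- s) * E / (2 * T))"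
      by (intro sum.cong refl)
    also have "\<dots> = T powr (- s) * E * (1 / (4 * T\<^sup>2)) * (\<Sum>i\<in>Basis. (x \<bullet> i)\<^sup>2) - real DIM('a) * (T powr (- s) * E / (2 * T))"
      by (simp only: sum_subtractf sum_distrib_left[symmetric] sum_constant)
    finally show ?thesis unfolding sum_inner_Basis_power2 by (simp add: mult_ac)
  qed
  moreover have "T powr (- s - 1) = T powr (- s) / T" using T by (simp add: powr_diff)
  moreover have "- s * (P / T) * E + W - (W - P * E * real DIM('a) / (2 * T)) = (real DIM('a) / 2 - s) * (P / T) * E"
    for P W :: real using T by (simp add: field_simps)
  ultimately have "a - (\<Sum>i\<in>Basis. q i) = (real DIM('a) / 2 - s) * T powr (- s - 1) * E"
    unfolding a_def by metis
  with p3 show ?thesis by (intro exI[of _ a] exI[of _ p] exI[of _ q]) (simp add: T_def)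
qed

text \<open>The far field of the caloric function with initial value \<open>|x|\<^sup>-\<^sup>2\<^sup>\<kappa>\<close> has the expansion
  \<open>|x|\<^sup>-\<^sup>2\<^sup>\<kappa> + \<mu> t |x|\<^sup>-\<^sup>2\<^sup>\<kappa>\<^sup>-\<^sup>2 + \<dots>\<close>; enlarging \<open>\<mu>\<close> makes the truncated expansion strictly
  supercaloric where \<open>|x|\<^sup>2 \<gtrsim> t\<close>. The Gaussian term, which is strictly supercaloric because
  \<open>\<kappa> < N/2\<close>, repairs the remaining region.\<close>

lemma power_supersolution:
  assumes \<kappa>: "\<kappa> > 0" "\<kappa> < real DIM('a::euclidean_space) / 2"
  obtains v :: "'a::euclidean_space \<Rightarrow> real \<Rightarrow> real" and \<delta> B where
    "\<delta> > 0" "continuous_on (UNIV \<times> {0..}) (\<lambda>(x, t). v x t)"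
    "\<And>x t. t \<ge> 0 \<Longrightarrow> 0 < v x t" "\<And>x t. t \<ge> 0 \<Longrightarrow> v x t \<le> B"
    "\<And>x. v x 0 \<ge> (1 + (norm x)\<^sup>2) powr (- \<kappa>)"
    "\<And>x t. t \<ge> 0 \<Longrightarrow> \<exists>a p q. parabolic_jet v x t a p q \<and> a - (\<Sum>i\<in>Basis. q i) \<ge> \<delta> * v x t powr (1 + 1 / \<kappa>)"
proof -
  \<comment> \<open>Budget, with \<open>R = \<rho> powr (- \<kappa> - 1)\<close> and
    \<open>T = t + 1\<close>: the heat operator on the three summands gives at least
    \<open>(2 - \<mu>) * R\<close>, \<open>\<mu> * R - M * (T / \<rho>) * R\<close> and
    \<open>(M * (T / \<rho>) - 1) * R\<close>, in total \<open>R\<close>. \<open>D\<close> is fixed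
    by \<open>D * \<delta>0 * exp (- M / 4) = M\<close>.\<close>
  define \<mu> where "\<mu> = 4 * \<kappa> * (\<kappa> + 1) + 2"
  define M where "M = \<mu> * (4 * (\<kappa> + 1) * (\<kappa> + 2))"
  define \<delta>0 where "\<delta>0 = real DIM('a) / 2 - \<kappa>"
  define D where "D = M * exp (M / 4) / \<delta>0"
  \<comment> \<open>Makes \<open>\<kappa> / m \<le> 1 / 4\<close>, so that a power \<kappa> of
    \<open>\<rho> / T\<close> is dominated by the reciprocal of the Gaussian factor.\<close>
  define m where "m = 4 * \<kappa> + 1"
  define C where "C = 1 + \<mu> + D * m powr \<kappa>"
  define v where "v = (\<lambda>(x::'a) t. ((t + 1) + (norm x)\<^sup>2) powr (- \<kappa>)
     + \<mu> * ((t + 1) * ((t + 1) + (norm x)\<^sup>2) powr (- (\<kappa> + 1)))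
     + D * ((t + 1) powr (- \<kappa>) * exp (- (norm x)\<^sup>2 / (4 * (t + 1)))))"
  have pos: "\<mu> > 0" "M > 0" "\<delta>0 > 0" "D > 0" "m > 0" "m \<ge> 1" "C > 0"
    using \<kappa> by (auto simp: \<mu>_def M_def \<delta>0_def D_def m_def C_def intro!: mult_pos_pos add_pos_pos divide_pos_pos)
  have lower: "v x t \<ge> ((t + 1) + (norm x)\<^sup>2) powr (- \<kappa>)" if "t \<ge> 0" for x t
    using that pos by (simp add: v_def)
  have vpos: "v x t > 0" if "t \<ge> 0" for x t
  proof -
    have "(t + 1) + (norm x)\<^sup>2 > 0" using that by (intro add_nonneg_pos add_pos_nonneg[of "t + 1"]) auto
    then show ?thesis using lower[OF that, of x] by (auto intro: less_le_trans[OF _ lower[OF that, of x]])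
  qed
  \<comment> \<open>This bound converts the gain \<open>\<rho> powr (- \<kappa> - 1)\<close> of the
    heat operator into a multiple of \<open>v x t powr (1 + 1 / \<kappa>)\<close>.\<close>
  have upper: "v x t \<le> C * ((t + 1) + (norm x)\<^sup>2) powr (- \<kappa>)" if t: "t \<ge> 0" for x t
  proof -
    define T \<rho> where "T = t + 1" and "\<rho> = T + (norm x)\<^sup>2"
    have T: "T > 0" and \<rho>: "\<rho> > 0" "T \<le> \<rho>" using t by (auto simp: T_def \<rho>_def intro: add_pos_nonneg)
    have "T * \<rho> powr (- (\<kappa> + 1)) \<le> \<rho> * \<rho> powr (- (\<kappa> + 1))" using \<rho> by (intro mult_right_mono) auto
    also have "\<dots> = \<rho> powr (- \<kappa>)" using \<rho> powr_add[of \<rho> 1 "- (\<kappa> + 1)"] by simp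
    finally have 1: "T * \<rho> powr (- (\<kappa> + 1)) \<le> \<rho> powr (- \<kappa>)" .
    have "\<rho> / T \<le> m * exp ((norm x)\<^sup>2 / T / m)"
    proof -
      have "(norm x)\<^sup>2 / T / m + 1 \<le> exp ((norm x)\<^sup>2 / T / m)" using exp_ge_add_one_self[of "(norm x)\<^sup>2 / T / m"] by linarith
      then have "m * ((norm x)\<^sup>2 / T / m + 1) \<le> m * exp ((norm x)\<^sup>2 / T / m)" using pos by (intro mult_left_mono) auto
      moreover have "\<rho> / T = 1 + (norm x)\<^sup>2 / T" using T by (simp add: \<rho>_def field_simps)
      ultimately show ?thesis using pos by (simp add: distrib_left)
    qed
    then have "(\<rho> / T) powr \<kappa> \<le> (m * exp ((norm x)\<^sup>2 / T / m)) powr \<kappa>"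
      using \<kappa> \<rho> T by (intro powr_mono2) auto
    also have "\<dots> = m powr \<kappa> * exp (\<kappa> / m * ((norm x)\<^sup>2 / T))"
      using pos by (simp add: powr_mult exp_powr_real mult_ac)
    also have "\<dots> \<le> m powr \<kappa> * exp (1 / 4 * ((norm x)\<^sup>2 / T))"
    proof -
      have "\<kappa> / m \<le> 1 / 4" using pos(5) by (simp add: m_def field_simps)
      then have "\<kappa> / m * ((norm x)\<^sup>2 / T) \<le> 1 / 4 * ((norm x)\<^sup>2 / T)" using T by (intro mult_right_mono) auto
      then show ?thesis by (intro mult_left_mono) auto
    qed
    finally have "(\<rho> / T) powr \<kappa> \<le> m powr \<kappa> * exp ((norm x)\<^sup>2 / (4 * T))" by simp
    then have "T powr (- \<kappa>) * exp (- (norm x)\<^sup>2 / (4 * T)) \<le> m powr \<kappa> * \<rho> powr (- \<kappa>)"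
      using T \<rho> by (simp add: powr_divide powr_minus exp_minus field_simps)
    then have "D * (T powr (- \<kappa>) * exp (- (norm x)\<^sup>2 / (4 * T))) \<le> D * (m powr \<kappa> * \<rho> powr (- \<kappa>))"
      using pos by (intro mult_left_mono) auto
    moreover have "\<mu> * (T * \<rho> powr (- (\<kappa> + 1))) \<le> \<mu> * \<rho> powr (- \<kappa>)"
      using 1 pos by (intro mult_left_mono) auto
    ultimately show ?thesis by (simp add: v_def C_def T_def \<rho>_def algebra_simps)
  qed
  show ?thesis
  proof (rule that)
    show "C powr (- (1 + 1 / \<kappa>)) > 0" using pos(7) by (simp only: powr_gt_zero)
    have nz: "snd z + 1 \<noteq> 0" "4 * snd z + 4 \<noteq> 0" "snd z + 1 + (norm (fst z))\<^sup>2 \<noteq> 0" if "z \<in> UNIV \<times> {0..}" for z :: "'a \<times> real"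
    proof -
      have "snd z \<ge> 0" using that by auto
      moreover have "(norm (fst z))\<^sup>2 \<ge> 0" by simp
      ultimately show "snd z + 1 \<noteq> 0" "4 * snd z + 4 \<noteq> 0" "snd z + 1 + (norm (fst z))\<^sup>2 \<noteq> 0" by linarith+
    qed
    show "continuous_on (UNIV \<times> {0..}) (\<lambda>(x, t). v x t)"
      unfolding v_def case_prod_beta
      by (intro continuous_intros ballI) (simp_all add: nz del: mem_Times_iff)
    show "v x t \<le> C" if "t \<ge> 0" for x t
    proof -
      have "((t + 1) + (norm x)\<^sup>2) powr (- \<kappa>) \<le> 1"
        using powr_mono[of "-\<kappa>" 0 "(t + 1) + (norm x)\<^sup>2"] that \<kappa> by (simp split: if_splits)
      then have "C * ((t + 1) + (norm x)\<^sup>2) powr (- \<kappa>) \<le> C * 1" using pos by (intro mult_left_mono) auto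
      then show ?thesis using upper[OF that, of x] by simp
    qed
    show "v x 0 \<ge> (1 + (norm x)\<^sup>2) powr (- \<kappa>)" for x using lower[of 0 x] by simp
    show "\<exists>a p q. parabolic_jet v x t a p q \<and> a - (\<Sum>i\<in>Basis. q i) \<ge> C powr (- (1 + 1 / \<kappa>)) * v x t powr (1 + 1 / \<kappa>)"
      if t: "t \<ge> 0" for x t
    proof -
      define T \<rho> where "T = t + 1" and "\<rho> = T + (norm x)\<^sup>2"
      have T: "T > 0" and \<rho>: "\<rho> > 0" "T \<le> \<rho>" using t by (auto simp: T_def \<rho>_def intro: add_pos_nonneg)
      define R where "R = \<rho> powr (- \<kappa> - 1)"
      have R: "R > 0" using \<rho> by (simp add: R_def)
      define a1 q1 where "a1 = - \<kappa> * \<rho> powr (- \<kappa> - 1)"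
        and "q1 = (\<lambda>i. - \<kappa> * (- \<kappa> - 1) * \<rho> powr (- \<kappa> - 2) * (2 * (x \<bullet> i))\<^sup>2 + - \<kappa> * \<rho> powr (- \<kappa> - 1) * 2)"
      define a2 q2 where "a2 = - (\<kappa> + 1) * \<rho> powr (- (\<kappa> + 1) - 1)"
        and "q2 = (\<lambda>i. - (\<kappa> + 1) * (- (\<kappa> + 1) - 1) * \<rho> powr (- (\<kappa> + 1) - 2) * (2 * (x \<bullet> i))\<^sup>2
            + - (\<kappa> + 1) * \<rho> powr (- (\<kappa> + 1) - 1) * 2)"
      obtain a3 p3 q3 where g: "parabolic_jet (\<lambda>x t. (t + 1) powr (- \<kappa>) * exp (- (norm x)\<^sup>2 / (4 * (t + 1)))) x t a3 p3 q3"
        "a3 - (\<Sum>i\<in>Basis. q3 i) = \<delta>0 * T powr (- \<kappa> - 1) * exp (- (norm x)\<^sup>2 / (4 * T))"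
        using parabolic_jet_gauss[OF t, where x = x and s = \<kappa>] unfolding \<delta>0_def T_def by blast
      have dT: "((\<lambda>t. t + 1) has_real_derivative 1) (at t)" by (auto intro!: derivative_eq_intros)
      have par: "\<exists>P. parabolic_jet v x t (a1 + \<mu> * (1 * \<rho> powr (- (\<kappa> + 1)) + T * a2) + D * a3) P
          (\<lambda>i. q1 i + \<mu> * (T * q2 i) + D * q3 i)"
        unfolding v_def a1_def q1_def a2_def q2_def T_def \<rho>_def
        by (rule exI) (rule parabolic_jet_add[OF parabolic_jet_add[OF parabolic_jet_rho_powr[OF t, where x = x and s = "- \<kappa>"]
          parabolic_jet_cmult[OF parabolic_jet_time_mult[OF parabolic_jet_rho_powr[OF t, where x = x and s = "- (\<kappa> + 1)"] dT], of \<mu>]]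
          parabolic_jet_cmult[OF g(1), of D]])
      have "a1 - (\<Sum>i\<in>Basis. q1 i) \<ge> - 4 * \<kappa> * (\<kappa> + 1) * R"
        using heat_rho_powr_lower[OF t \<kappa>(1), of x] by (simp add: a1_def q1_def \<rho>_def T_def R_def)
      then have 1: "a1 - (\<Sum>i\<in>Basis. q1 i) \<ge> (2 - \<mu>) * R" by (simp add: \<mu>_def)
      have "a2 - (\<Sum>i\<in>Basis. q2 i) \<ge> - 4 * (\<kappa> + 1) * (\<kappa> + 1 + 1) * \<rho> powr (- (\<kappa> + 1) - 1)"
        using heat_rho_powr_lower[OF t, of "\<kappa> + 1" x] \<kappa> unfolding a2_def q2_def \<rho>_def T_def by simp
      then have "T * (a2 - (\<Sum>i\<in>Basis. q2 i)) \<ge> T * (- 4 * (\<kappa> + 1) * (\<kappa> + 1 + 1) * \<rho> powr (- (\<kappa> + 1) - 1))"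
        using T by (intro mult_left_mono) auto
      also have "\<rho> powr (- (\<kappa> + 1) - 1) = R / \<rho>"
      proof -
        have "- (\<kappa> + 1) - 1 = - \<kappa> - 1 - 1" by simp
        then show ?thesis using \<rho> by (metis R_def powr_diff powr_one less_imp_le)
      qed
      finally have "\<mu> * (R + T * (a2 - (\<Sum>i\<in>Basis. q2 i))) \<ge> \<mu> * (R + T * (- 4 * (\<kappa> + 1) * (\<kappa> + 1 + 1) * (R / \<rho>)))"
        using pos by (intro mult_left_mono) auto
      moreover have "\<mu> * (R + T * (- 4 * (\<kappa> + 1) * (\<kappa> + 1 + 1) * (R / \<rho>))) = \<mu> * R - M * (T / \<rho>) * R"
        by (simp add: M_def algebra_simps)
      ultimately have 2: "\<mu> * (R + T * (a2 - (\<Sum>i\<in>Basis. q2 i))) \<ge> \<mu> * R - M * (T / \<rho>) * R" by simp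
      have 3: "D * (a3 - (\<Sum>i\<in>Basis. q3 i)) \<ge> (M * (T / \<rho>) - 1) * R"
      \<comment> \<open>Far out the required lower bound is nonpositive. Otherwise
        \<open>(norm x)\<^sup>2 \<le> M * T\<close>, so the Gaussian factor is at least
        \<open>exp (- (M / 4))\<close>, which the size of \<open>D\<close> compensates.\<close>
      proof (cases "M * T \<le> \<rho>")
        case True
        then have "(M * (T / \<rho>) - 1) * R \<le> 0 * R" using \<rho> R by (intro mult_right_mono) (auto simp: field_simps)
        moreover have "D * (a3 - (\<Sum>i\<in>Basis. q3 i)) \<ge> 0" unfolding g(2) using pos by simp
        ultimately show ?thesis by simp
      next
        case False
        then have "(norm x)\<^sup>2 \<le> M * T" using T by (simp add: \<rho>_def)
        then have "(norm x)\<^sup>2 / (4 * T) \<le> M / 4" using T by (simp add: field_simps)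
        then have "exp (- (norm x)\<^sup>2 / (4 * T)) \<ge> exp (- (M / 4))" by simp
        moreover have "T powr (- \<kappa> - 1) \<ge> R" unfolding R_def using \<rho> T \<kappa> by (intro powr_mono2') auto
        ultimately have u1: "D * \<delta>0 * (T powr (- \<kappa> - 1) * exp (- (norm x)\<^sup>2 / (4 * T))) \<ge> D * \<delta>0 * (R * exp (- (M / 4)))"
          using pos R by (intro mult_left_mono mult_mono) auto
        have u2: "D * \<delta>0 * (R * exp (- (M / 4))) = M * R"
          using pos by (simp add: D_def exp_minus field_simps)
        have "(M * (T / \<rho>) - 1) * R \<le> M * R"
        proof (rule mult_right_mono)
          have "M * (T / \<rho>) \<le> M * 1" using pos T \<rho> by (intro mult_left_mono) (auto simp: divide_le_eq_1)
          then show "M * (T / \<rho>) - 1 \<le> M" by simp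
        qed (use R in auto)
        also have "\<dots> \<le> D * \<delta>0 * (T powr (- \<kappa> - 1) * exp (- (norm x)\<^sup>2 / (4 * T)))" using u1 unfolding u2 .
        finally show ?thesis unfolding g(2) by (simp only: mult.assoc)
      qed
      have "(\<Sum>i\<in>Basis. q1 i + \<mu> * (T * q2 i) + D * q3 i)
         = (\<Sum>i\<in>Basis. q1 i) + \<mu> * (T * (\<Sum>i\<in>Basis. q2 i)) + D * (\<Sum>i\<in>Basis. q3 i)"
        by (simp add: sum.distrib sum_distrib_left)
      moreover have "\<rho> powr (- (\<kappa> + 1)) = R" by (simp add: R_def)
      ultimately have tot: "(a1 + \<mu> * (1 * \<rho> powr (- (\<kappa> + 1)) + T * a2) + D * a3)
          - (\<Sum>i\<in>Basis. q1 i + \<mu> * (T * q2 i) + D * q3 i) \<ge> R"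
        using 1 2 3 by (simp add: algebra_simps)
      have "v x t powr (1 + 1 / \<kappa>) \<le> (C * \<rho> powr (- \<kappa>)) powr (1 + 1 / \<kappa>)"
        using upper[OF t, of x] vpos[OF t, of x] \<kappa> by (intro powr_mono2) (auto simp: \<rho>_def T_def)
      also have "\<dots> = C powr (1 + 1 / \<kappa>) * R"
      proof -
        have "- \<kappa> * (1 + 1 / \<kappa>) = - \<kappa> - 1" using \<kappa> by (simp add: field_simps)
        then show ?thesis using pos by (simp add: powr_mult powr_powr R_def del: minus_mult_left[symmetric] mult_minus_left)
      qed
      finally have "C powr (- (1 + 1 / \<kappa>)) * v x t powr (1 + 1 / \<kappa>) \<le> C powr (- (1 + 1 / \<kappa>)) * (C powr (1 + 1 / \<kappa>) * R)"
        by (intro mult_left_mono) auto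
      also have "\<dots> = R" using pos by (simp add: mult.assoc[symmetric] powr_add[symmetric])
      finally have "C powr (- (1 + 1 / \<kappa>)) * v x t powr (1 + 1 / \<kappa>) \<le> R" .
      from order_trans[OF this tot] show ?thesis using par by blast
    qed
  qed (use vpos in auto)
qed

section \<open>Gaussian averages\<close>

lemma lborel_integrable_affine_iff:
  fixes f :: "'a::euclidean_space \<Rightarrow> real"
  assumes "c \<noteq> 0" and [measurable]: "f \<in> borel_measurable borel"
  shows "integrable lborel (\<lambda>x. f (t + c *\<^sub>R x)) \<longleftrightarrow> integrable lborel f"
  using assms
  by (subst (2) lborel_affine[of c t]) (simp_all add: integrable_density integrable_distr_eq)

lemma lborel_integral_affine:
  fixes f :: "'a::euclidean_space \<Rightarrow> real"
  assumes "c \<noteq> 0" and [measurable]: "f \<in> borel_measurable borel"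
  shows "(\<integral>x. f x \<partial>lborel) = \<bar>c\<bar> ^ DIM('a) * (\<integral>x. f (t + c *\<^sub>R x) \<partial>lborel)"
  using assms
  by (subst lborel_affine[of c t]) (simp_all add: integral_density integral_distr)

lemma tendsto_integral_dominated:
  fixes h :: "'b::first_countable_topology \<Rightarrow> 'c \<Rightarrow> real"
  assumes meas: "\<And>z. z \<in> S \<Longrightarrow> h z \<in> borel_measurable M" "l \<in> borel_measurable M"
    and lim: "AE y in M. ((\<lambda>z. h z y) \<longlongrightarrow> l y) (at z0 within S)"
    and bound: "\<And>z. z \<in> S \<Longrightarrow> AE y in M. \<bar>h z y\<bar> \<le> w y"
    and w: "integrable M w"
  shows "((\<lambda>z. \<integral>y. h z y \<partial>M) \<longlongrightarrow> (\<integral>y. l y \<partial>M)) (at z0 within S)"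
  unfolding tendsto_at_iff_sequentially comp_def
proof (intro allI impI)
  fix X assume X: "\<forall>i. X i \<in> S - {z0}" "X \<longlonglongrightarrow> z0"
  show "(\<lambda>i. \<integral>y. h (X i) y \<partial>M) \<longlonglongrightarrow> (\<integral>y. l y \<partial>M)"
  proof (rule integral_dominated_convergence[OF meas(2) _ w])
    show "AE y in M. (\<lambda>i. h (X i) y) \<longlonglongrightarrow> l y"
      using lim by eventually_elim (use X in \<open>auto simp: tendsto_at_iff_sequentially comp_def\<close>)
  qed (use X meas bound in auto)
qed

text \<open>The mean value inequality makes \<open>w\<close> a majorant of every difference
  quotient, and dominated convergence applies to the quotients.\<close>

lemma has_real_derivative_integral_dominated:
  fixes \<phi> :: "real \<Rightarrow> 'c \<Rightarrow> real"
  assumes \<theta>0: "a < \<theta>0" "\<theta>0 < b"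
    and int: "\<And>\<theta>. a < \<theta> \<Longrightarrow> \<theta> < b \<Longrightarrow> integrable M (\<phi> \<theta>)"
    and meas: "\<phi>' \<theta>0 \<in> borel_measurable M"
    and deriv: "\<And>\<theta> y. a < \<theta> \<Longrightarrow> \<theta> < b \<Longrightarrow> y \<in> space M \<Longrightarrow> ((\<lambda>\<theta>. \<phi> \<theta> y) has_real_derivative \<phi>' \<theta> y) (at \<theta>)"
    and bound: "\<And>\<theta> y. a < \<theta> \<Longrightarrow> \<theta> < b \<Longrightarrow> y \<in> space M \<Longrightarrow> \<bar>\<phi>' \<theta> y\<bar> \<le> w y"
    and w: "integrable M w"
  shows "((\<lambda>\<theta>. \<integral>y. \<phi> \<theta> y \<partial>M) has_real_derivative (\<integral>y. \<phi>' \<theta>0 y \<partial>M)) (at \<theta>0)"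
proof -
  define S where "S = {a<..<b}"
  have S: "at \<theta>0 within S = at \<theta>0" using \<theta>0 by (intro at_within_open) (auto simp: S_def)
  have lip: "\<bar>\<phi> \<theta> y - \<phi> \<theta>0 y\<bar> \<le> w y * \<bar>\<theta> - \<theta>0\<bar>" if "\<theta> \<in> S" "y \<in> space M" for \<theta> y
  proof -
    have "((\<lambda>\<theta>. \<phi> \<theta> y) has_real_derivative \<phi>' z y) (at z within S)" if "z \<in> S" for z
      using deriv[of z y] that \<open>y \<in> space M\<close> by (auto simp: S_def intro: has_field_derivative_at_within)
    moreover have "convex S" by (simp add: S_def)
    ultimately show ?thesis
      using field_differentiable_bound[of S "\<lambda>\<theta>. \<phi> \<theta> y" "\<lambda>\<theta>. \<phi>' \<theta> y" "w y" \<theta> \<theta>0] that \<theta>0 bound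
      by (auto simp: S_def)
  qed
  have "((\<lambda>\<theta>. \<integral>y. (\<phi> \<theta> y - \<phi> \<theta>0 y) / (\<theta> - \<theta>0) \<partial>M) \<longlongrightarrow> (\<integral>y. \<phi>' \<theta>0 y \<partial>M)) (at \<theta>0 within S)"
  proof (rule tendsto_integral_dominated[OF _ meas _ _ w])
    show "(\<lambda>y. (\<phi> \<theta> y - \<phi> \<theta>0 y) / (\<theta> - \<theta>0)) \<in> borel_measurable M" if "\<theta> \<in> S" for \<theta>
      using int[of \<theta>] int[of \<theta>0] that \<theta>0 unfolding S_def by (intro borel_measurable_divide borel_measurable_diff) auto
    show "AE y in M. ((\<lambda>\<theta>. (\<phi> \<theta> y - \<phi> \<theta>0 y) / (\<theta> - \<theta>0)) \<longlongrightarrow> \<phi>' \<theta>0 y) (at \<theta>0 within S)"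
      unfolding S using deriv[OF \<theta>0] by (intro AE_I2) (simp add: has_field_derivative_iff)
    show "AE y in M. \<bar>(\<phi> \<theta> y - \<phi> \<theta>0 y) / (\<theta> - \<theta>0)\<bar> \<le> w y" if "\<theta> \<in> S" for \<theta>
    proof (rule AE_I2)
      fix y assume y: "y \<in> space M"
      then have "w y \<ge> 0" using bound[OF \<theta>0 y] by linarith
      then show "\<bar>(\<phi> \<theta> y - \<phi> \<theta>0 y) / (\<theta> - \<theta>0)\<bar> \<le> w y"
        using lip[OF that y] by (cases "\<theta> = \<theta>0") (auto simp: divide_le_eq)
    qed
  qed
  moreover have "\<forall>\<^sub>F \<theta> in at \<theta>0 within S. (\<integral>y. (\<phi> \<theta> y - \<phi> \<theta>0 y) / (\<theta> - \<theta>0) \<partial>M)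
      = ((\<integral>y. \<phi> \<theta> y \<partial>M) - (\<integral>y. \<phi> \<theta>0 y \<partial>M)) / (\<theta> - \<theta>0)"
    unfolding eventually_at_filter
    by (rule always_eventually) (use int \<theta>0 in \<open>auto simp: S_def\<close>)
  ultimately show ?thesis
    unfolding has_field_derivative_iff S by (rule Lim_transform_eventually)
qed

text \<open>The standard normal density. Averaging \<open>g (x + \<rho> *\<^sub>R y)\<close> against
  it with \<open>\<rho> = sqrt (2 * t)\<close> is convolution with the heat kernel at time
  \<open>t\<close>: the kernel stays fixed and time enters only as a scale.\<close>

definition gauss :: "'a::euclidean_space \<Rightarrow> real" where
  "gauss y = (1 / sqrt (2 * pi)) ^ DIM('a) * exp (- (norm y)\<^sup>2 / 2)"

text \<open>Up to the factors \<open>\<rho>\<^sup>-\<^sup>1\<close> and \<open>\<rho>\<^sup>-\<^sup>2\<close>, the kernels of the first and second derivatives of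
  \<open>x \<mapsto> \<integral> g (x + \<rho> y) gauss y dy\<close>.\<close>

definition gauss1 :: "'a::euclidean_space \<Rightarrow> 'a \<Rightarrow> real" where
  "gauss1 i y = (y \<bullet> i) * gauss y"

definition gauss2 :: "'a::euclidean_space \<Rightarrow> 'a \<Rightarrow> 'a \<Rightarrow> real" where
  "gauss2 i j y = ((y \<bullet> i) * (y \<bullet> j) - (i \<bullet> j)) * gauss y"

lemma gauss_pos: "gauss y > 0"
  by (simp add: gauss_def)

lemma gauss_measurable [measurable]:
  "gauss \<in> borel_measurable borel" "gauss1 i \<in> borel_measurable borel" "gauss2 i j \<in> borel_measurable borel"
  unfolding gauss_def[abs_def] gauss1_def[abs_def] gauss2_def[abs_def] by measurable

lemma gauss_prod: "gauss y = (\<Prod>b\<in>Basis. std_normal_density (y \<bullet> b))" for y :: "'a::euclidean_space"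
proof -
  have "- (norm y)\<^sup>2 / 2 = (\<Sum>b\<in>Basis. - (y \<bullet> b)\<^sup>2 / 2)"
    unfolding sum_inner_Basis_power2[symmetric] by (simp only: sum_divide_distrib sum_negf minus_divide_left[symmetric])
  then have "exp (- (norm y)\<^sup>2 / 2) = (\<Prod>b\<in>Basis. exp (- (y \<bullet> b)\<^sup>2 / 2))"
    by (simp only: exp_sum[OF finite_Basis])
  then show ?thesis
    by (simp only: gauss_def std_normal_density_def prod.distrib prod_constant)
qed

lemma has_bochner_integral_gauss: "has_bochner_integral lborel (gauss :: 'a::euclidean_space \<Rightarrow> real) 1"
proof -
  have "has_bochner_integral lborel std_normal_density 1"
    using std_normal_moment_even[of 0] by simp
  then have one: "(\<integral>\<^sup>+x. ennreal (std_normal_density x) \<partial>lborel) = 1"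
    using nn_integral_eq_integral[of lborel std_normal_density] by (simp add: has_bochner_integral_iff)
  have "(\<integral>\<^sup>+y. ennreal (gauss (y::'a)) \<partial>lborel) = (\<integral>\<^sup>+(y::'a). (\<Prod>b\<in>Basis. ennreal (std_normal_density (y \<bullet> b))) \<partial>lborel)"
    by (simp add: gauss_prod prod_ennreal)
  also have "\<dots> = (\<Prod>b\<in>(Basis::'a set). (\<integral>\<^sup>+x. ennreal (std_normal_density x) \<partial>lborel))"
    by (rule nn_integral_lborel_prod) auto
  also have "\<dots> = ennreal 1" by (simp add: one)
  finally show ?thesis
    by (intro has_bochner_integral_nn_integral) (auto intro: less_imp_le gauss_pos)
qed

lemma integrable_exp_norm2:
  assumes "c > 0" shows "integrable lborel (\<lambda>y::'a::euclidean_space. exp (- c * (norm y)\<^sup>2))"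
proof -
  have "integrable lborel (\<lambda>y::'a. gauss (0 + sqrt (2 * c) *\<^sub>R y))"
    using has_bochner_integral_gauss assms
    by (subst lborel_integrable_affine_iff) (auto simp: has_bochner_integral_iff)
  then have "integrable lborel (\<lambda>y::'a. (sqrt (2 * pi)) ^ DIM('a) * gauss (sqrt (2 * c) *\<^sub>R y))"
    by simp
  moreover have "(sqrt (2 * pi)) ^ DIM('a) * gauss (sqrt (2 * c) *\<^sub>R y) = exp (- c * (norm y)\<^sup>2)" for y :: 'a
    using assms by (simp add: gauss_def power_mult_distrib power_one_over field_simps)
  ultimately show ?thesis by simp
qed

text \<open>Half of the exponential absorbs the polynomial. Degree 4 covers a kernel of degree at
  most 3 times the first-moment weight.\<close>

lemma integrable_gauss_weight:
  assumes c: "c > 0" shows "integrable lborel (\<lambda>y::'a::euclidean_space. (1 + norm y) ^ 4 * exp (- c * (norm y)\<^sup>2))"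
proof -
  \<comment> \<open>From \<open>1 + r\<^sup>2 \<le> m * exp (r\<^sup>2 / m)\<close>, squaring
    doubles the rate to \<open>2 / m\<close>, which must not exceed \<open>c / 2\<close>.\<close>
  define m where "m = max 1 (4 / c)"
  have m: "m \<ge> 1" "2 / m \<le> c / 2" using c by (auto simp: m_def max_def field_simps)
  have bd: "(1 + r) ^ 4 * exp (- c * r\<^sup>2) \<le> 4 * m\<^sup>2 * exp (- (c / 2) * r\<^sup>2)" if r: "r \<ge> 0" for r :: real
  proof -
    have "(1 + r)\<^sup>2 \<le> 2 * (1 + r\<^sup>2)" using zero_le_power2[of "r - 1"] by (simp add: power2_eq_square algebra_simps)
    also have "1 + r\<^sup>2 \<le> m * exp (r\<^sup>2 / m)"
    proof -
      have "m * (1 + r\<^sup>2 / m) \<le> m * exp (r\<^sup>2 / m)" using m by (intro mult_left_mono) auto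
      moreover have "m * (1 + r\<^sup>2 / m) = m + r\<^sup>2" using m by (simp add: field_simps)
      ultimately show ?thesis using m by simp
    qed
    finally have "((1 + r)\<^sup>2)\<^sup>2 \<le> (2 * (m * exp (r\<^sup>2 / m)))\<^sup>2" by (intro power_mono) auto
    also have "\<dots> = 4 * m\<^sup>2 * exp (2 / m * r\<^sup>2)"
      by (simp add: power_mult_distrib exp_double[symmetric])
    also have "\<dots> \<le> 4 * m\<^sup>2 * exp (c / 2 * r\<^sup>2)"
    proof -
      have "2 / m * r\<^sup>2 \<le> c / 2 * r\<^sup>2" by (intro mult_right_mono m) auto
      then have "exp (2 / m * r\<^sup>2) \<le> exp (c / 2 * r\<^sup>2)" by (subst exp_le_cancel_iff)
      then show ?thesis by (intro mult_left_mono) auto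
    qed
    finally have "(1 + r) ^ 4 \<le> 4 * m\<^sup>2 * exp (c / 2 * r\<^sup>2)" by simp
    then have "(1 + r) ^ 4 * exp (- c * r\<^sup>2) \<le> 4 * m\<^sup>2 * exp (c / 2 * r\<^sup>2) * exp (- c * r\<^sup>2)"
      by (intro mult_right_mono) auto
    also have "\<dots> = 4 * m\<^sup>2 * exp (- (c / 2) * r\<^sup>2)" by (simp add: mult.assoc exp_add[symmetric])
    finally show ?thesis .
  qed
  have "integrable lborel (\<lambda>y::'a. 4 * m\<^sup>2 * exp (- (c / 2) * (norm y)\<^sup>2))"
    by (intro integrable_mult_right integrable_exp_norm2) (use c in simp)
  then show ?thesis
    by (rule Bochner_Integration.integrable_bound) (use bd in \<open>auto simp: abs_mult\<close>)
qed

text \<open>The first moment is included because it is what multiplies the Lipschitz constant of the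
  averaged function.\<close>

definition nice_kernel :: "('a::euclidean_space \<Rightarrow> real) \<Rightarrow> bool" where
  "nice_kernel Q \<longleftrightarrow> Q \<in> borel_measurable borel \<and> integrable lborel (\<lambda>y. (1 + norm y) * \<bar>Q y\<bar>)"

lemma nice_kernelI:
  fixes Q :: "'a::euclidean_space \<Rightarrow> real"
  assumes [measurable]: "Q \<in> borel_measurable borel"
    and b: "\<And>y. \<bar>Q y\<bar> \<le> C * ((1 + norm y) ^ 3 * exp (- c * (norm y)\<^sup>2))" and c: "c > 0"
  shows "nice_kernel Q"
  unfolding nice_kernel_def
proof
  have C: "C \<ge> 0" using b[of 0] by simp
  show "integrable lborel (\<lambda>y. (1 + norm y) * \<bar>Q y\<bar>)"
  proof (rule Bochner_Integration.integrable_bound)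
    show "integrable lborel (\<lambda>y::'a. C * ((1 + norm y) ^ 4 * exp (- c * (norm y)\<^sup>2)))"
      using integrable_gauss_weight[OF c] by (rule integrable_mult_right)
    show "AE y in lborel. norm ((1 + norm y) * \<bar>Q y\<bar>) \<le> norm (C * ((1 + norm y) ^ 4 * exp (- c * (norm y)\<^sup>2)))"
    proof (rule AE_I2)
      fix y :: 'a
      have "(1 + norm y) * \<bar>Q y\<bar> \<le> (1 + norm y) * (C * ((1 + norm y) ^ 3 * exp (- c * (norm y)\<^sup>2)))"
        using b by (intro mult_left_mono) auto
      also have "\<dots> = C * ((1 + norm y) ^ 4 * exp (- c * (norm y)\<^sup>2))"
        by (simp add: power_Suc[of "1 + norm y" 3, symmetric] mult_ac)
      finally show "norm ((1 + norm y) * \<bar>Q y\<bar>) \<le> norm (C * ((1 + norm y) ^ 4 * exp (- c * (norm y)\<^sup>2)))"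
        using C by (simp add: abs_mult)
    qed
  qed measurable
qed fact

lemma nice_kernel_integrable:
  assumes "nice_kernel Q" shows "integrable lborel Q" "integrable lborel (\<lambda>y. norm y * \<bar>Q y\<bar>)" "integrable lborel (\<lambda>y. \<bar>Q y\<bar>)"
proof -
  have [measurable]: "Q \<in> borel_measurable borel" and i: "integrable lborel (\<lambda>y. (1 + norm y) * \<bar>Q y\<bar>)"
    using assms by (auto simp: nice_kernel_def)
  have *: "\<bar>Q y\<bar> \<le> (1 + norm y) * \<bar>Q y\<bar>" "norm y * \<bar>Q y\<bar> \<le> (1 + norm y) * \<bar>Q y\<bar>" for y
    by (auto simp: algebra_simps)
  show "integrable lborel Q" "integrable lborel (\<lambda>y. norm y * \<bar>Q y\<bar>)" "integrable lborel (\<lambda>y. \<bar>Q y\<bar>)"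
    by (rule Bochner_Integration.integrable_bound[OF i]; use * in \<open>auto simp: abs_mult intro: order_trans[OF _ abs_ge_self]\<close>)+
qed

lemma abs_inner_Basis_le: "i \<in> Basis \<Longrightarrow> \<bar>y \<bullet> i\<bar> \<le> 1 + norm y"
  using Basis_le_norm[of i y] by simp

lemma abs_gauss2_factor:
  assumes "i \<in> Basis" "j \<in> Basis"
  shows "\<bar>(y \<bullet> i) * (y \<bullet> j) - (i \<bullet> j)\<bar> \<le> 2 * (1 + norm y) ^ 2"
proof -
  have "\<bar>(y \<bullet> i) * (y \<bullet> j)\<bar> \<le> (1 + norm y) * (1 + norm y)"
    unfolding abs_mult using abs_inner_Basis_le assms by (intro mult_mono) auto
  moreover have "\<bar>i \<bullet> j\<bar> \<le> 1" using assms by (auto simp: inner_Basis)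
  moreover have "1 \<le> (1 + norm y) * (1 + norm y)" by (simp add: algebra_simps)
  ultimately show ?thesis by (simp add: power2_eq_square)
qed

lemma
  fixes i j :: "'a::euclidean_space"
  shows nice_gauss: "nice_kernel (gauss :: 'a \<Rightarrow> real)"
  and nice_gauss1: "i \<in> Basis \<Longrightarrow> nice_kernel (gauss1 i)"
  and nice_gauss2: "i \<in> Basis \<Longrightarrow> j \<in> Basis \<Longrightarrow> nice_kernel (gauss2 i j)"
proof -
  define K where "K = (1 / sqrt (2 * pi)) ^ DIM('a)"
  have K: "K \<ge> 0" by (simp add: K_def)
  have g: "gauss y = K * exp (- (1/2) * (norm y)\<^sup>2)" for y :: 'a by (simp add: gauss_def K_def)
  have p1: "(1 + norm y) ^ n \<le> (1 + norm y) ^ 3" if "n \<le> 3" for y :: 'a and n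
    using that by (intro power_increasing) auto
  show "nice_kernel (gauss :: 'a \<Rightarrow> real)"
  proof (rule nice_kernelI)
    fix y :: 'a
    show "\<bar>gauss y\<bar> \<le> K * ((1 + norm y) ^ 3 * exp (- (1/2) * (norm y)\<^sup>2))"
      unfolding g using K p1[of 0 y] by (simp add: abs_mult mult_left_mono mult_le_cancel_right1)
  qed auto
  { assume i: "i \<in> Basis"
    show "nice_kernel (gauss1 i)"
    proof (rule nice_kernelI)
      fix y :: 'a
      have "\<bar>y \<bullet> i\<bar> \<le> (1 + norm y) ^ 3" using abs_inner_Basis_le[OF i, of y] p1[of 1 y] by simp
      then have "\<bar>y \<bullet> i\<bar> * (K * exp (- (1/2) * (norm y)\<^sup>2)) \<le> (1 + norm y) ^ 3 * (K * exp (- (1/2) * (norm y)\<^sup>2))"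
        using K by (intro mult_right_mono) auto
      then show "\<bar>gauss1 i y\<bar> \<le> K * ((1 + norm y) ^ 3 * exp (- (1/2) * (norm y)\<^sup>2))"
        using K by (simp add: gauss1_def g abs_mult mult_ac)
    qed auto
    assume j: "j \<in> Basis"
    show "nice_kernel (gauss2 i j)"
    proof (rule nice_kernelI)
      fix y :: 'a
      have "\<bar>(y \<bullet> i) * (y \<bullet> j) - (i \<bullet> j)\<bar> \<le> 2 * (1 + norm y) ^ 3"
        using abs_gauss2_factor[OF i j, of y] p1[of 2 y] by simp
      then have "\<bar>(y \<bullet> i) * (y \<bullet> j) - (i \<bullet> j)\<bar> * (K * exp (- (1/2) * (norm y)\<^sup>2))
          \<le> 2 * (1 + norm y) ^ 3 * (K * exp (- (1/2) * (norm y)\<^sup>2))"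
        using K by (intro mult_right_mono) auto
      then show "\<bar>gauss2 i j y\<bar> \<le> 2 * K * ((1 + norm y) ^ 3 * exp (- (1/2) * (norm y)\<^sup>2))"
        using K by (simp add: gauss2_def g abs_mult mult_ac)
    qed auto }
qed

section \<open>Averages against a fixed kernel at scale \<rho>, and their derivatives\<close>

definition kernel_average :: "('a::euclidean_space \<Rightarrow> real) \<Rightarrow> real \<Rightarrow> 'a \<Rightarrow> ('a \<Rightarrow> real) \<Rightarrow> real" where
  "kernel_average Q \<rho> x g = (\<integral>y. g (x + \<rho> *\<^sub>R y) * Q y \<partial>lborel)"

lemma kernel_average_integrable:
  fixes g :: "'a::euclidean_space \<Rightarrow> real"
  assumes Q: "integrable lborel Q" and [measurable]: "g \<in> borel_measurable borel" and B: "\<And>x. \<bar>g x\<bar> \<le> B"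
  shows "integrable lborel (\<lambda>y. g (x + \<rho> *\<^sub>R y) * Q y)"
proof (rule Bochner_Integration.integrable_bound)
  have [measurable]: "Q \<in> borel_measurable lborel" using Q by auto
  show "integrable lborel (\<lambda>y. B * \<bar>Q y\<bar>)" using Q by auto
  show "(\<lambda>y. g (x + \<rho> *\<^sub>R y) * Q y) \<in> borel_measurable lborel" by measurable
  have "B \<ge> 0" using B[of 0] by linarith
  then show "AE y in lborel. norm (g (x + \<rho> *\<^sub>R y) * Q y) \<le> norm (B * \<bar>Q y\<bar>)"
    using B by (intro AE_I2) (auto simp: abs_mult intro!: mult_right_mono)
qed

lemma kernel_average_bound:
  fixes g :: "'a::euclidean_space \<Rightarrow> real"
  assumes Q: "integrable lborel Q" and g: "g \<in> borel_measurable borel" and B: "\<And>x. \<bar>g x\<bar> \<le> B"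
  shows "\<bar>kernel_average Q \<rho> x g\<bar> \<le> B * (\<integral>y. \<bar>Q y\<bar> \<partial>lborel)"
proof -
  have "\<bar>kernel_average Q \<rho> x g\<bar> \<le> (\<integral>y. \<bar>g (x + \<rho> *\<^sub>R y) * Q y\<bar> \<partial>lborel)" unfolding kernel_average_def by (rule integral_abs_bound)
  also have "\<dots> \<le> (\<integral>y. B * \<bar>Q y\<bar> \<partial>lborel)"
    by (rule integral_mono[OF integrable_abs[OF kernel_average_integrable[OF assms]]])
      (use Q B in \<open>auto simp: abs_mult intro!: mult_right_mono\<close>)
  finally show ?thesis by simp
qed

text \<open>A kernel of mean zero sees only \<open>g (x + \<rho> *\<^sub>R y) - g x\<close>, which
  gains a factor \<rho>. For second derivatives this improves \<open>1 / \<rho>^2\<close> to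
  \<open>1 / \<rho>\<close>, integrable in time.\<close>

lemma kernel_average_bound_lipschitz:
  fixes g :: "'a::euclidean_space \<Rightarrow> real"
  assumes Q: "nice_kernel Q" "(\<integral>y. Q y \<partial>lborel) = 0"
    and g: "g \<in> borel_measurable borel" and B: "\<And>x. \<bar>g x\<bar> \<le> B"
    and L: "\<And>x y. \<bar>g x - g y\<bar> \<le> L * norm (x - y)" and \<rho>: "\<rho> \<ge> 0"
  shows "\<bar>kernel_average Q \<rho> x g\<bar> \<le> L * \<rho> * (\<integral>y. norm y * \<bar>Q y\<bar> \<partial>lborel)"
proof -
  note Qi = nice_kernel_integrable[OF Q(1)]
  have i: "integrable lborel (\<lambda>y. g (x + \<rho> *\<^sub>R y) * Q y)" using kernel_average_integrable[OF Qi(1) g B] .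
  have "kernel_average Q \<rho> x g = (\<integral>y. g (x + \<rho> *\<^sub>R y) * Q y - g x * Q y \<partial>lborel)"
    unfolding kernel_average_def using i Qi Q by simp
  also have "\<bar>\<dots>\<bar> \<le> (\<integral>y. \<bar>g (x + \<rho> *\<^sub>R y) * Q y - g x * Q y\<bar> \<partial>lborel)" by (rule integral_abs_bound)
  also have "\<dots> \<le> (\<integral>y. L * \<rho> * (norm y * \<bar>Q y\<bar>) \<partial>lborel)"
  proof (rule integral_mono)
    show "integrable lborel (\<lambda>y. \<bar>g (x + \<rho> *\<^sub>R y) * Q y - g x * Q y\<bar>)" using i Qi by auto
    show "\<bar>g (x + \<rho> *\<^sub>R y) * Q y - g x * Q y\<bar> \<le> L * \<rho> * (norm y * \<bar>Q y\<bar>)" for y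
    proof -
      have "\<bar>g (x + \<rho> *\<^sub>R y) - g x\<bar> * \<bar>Q y\<bar> \<le> (L * norm (\<rho> *\<^sub>R y)) * \<bar>Q y\<bar>"
        using L[of "x + \<rho> *\<^sub>R y" x] by (intro mult_right_mono) auto
      then show ?thesis using \<rho> by (simp add: abs_mult[symmetric] algebra_simps)
    qed
  qed (use Qi in auto)
  finally show ?thesis by simp
qed

text \<open>Since the scale sits in the argument of \<open>g\<close>, the majorant
  \<open>B * \<bar>Q y\<bar>\<close> is uniform in \<rho> and continuity holds also at
  \<open>\<rho> = 0\<close>, that is, down to the initial time.\<close>

lemma continuous_on_kernel_average:
  fixes g :: "real \<Rightarrow> 'a::euclidean_space \<Rightarrow> real"
  assumes Q: "integrable lborel Q" and g: "continuous_on UNIV (\<lambda>(s, x). g s x)" and B: "\<And>s x. \<bar>g s x\<bar> \<le> B"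
  shows "continuous_on UNIV (\<lambda>(\<rho>, x, s). kernel_average Q \<rho> x (g s))"
proof -
  have gm: "(\<lambda>y. g s (x + \<rho> *\<^sub>R y)) \<in> borel_measurable lborel" for x \<rho> s
  proof -
    have "continuous_on UNIV (\<lambda>y. (\<lambda>(s, x). g s x) (s, x + \<rho> *\<^sub>R y))"
      by (rule continuous_on_compose2[OF g]) (auto intro!: continuous_intros)
    from borel_measurable_continuous_onI[OF this] show ?thesis by simp
  qed
  have [measurable]: "Q \<in> borel_measurable lborel" using Q by auto
  have "((\<lambda>z. \<integral>y. (case z of (\<rho>, x, s) \<Rightarrow> g s (x + \<rho> *\<^sub>R y) * Q y) \<partial>lborel) \<longlongrightarrow>
      (\<integral>y. (case z0 of (\<rho>, x, s) \<Rightarrow> g s (x + \<rho> *\<^sub>R y) * Q y) \<partial>lborel)) (at z0 within UNIV)" for z0 :: "real \<times> 'a \<times> real"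
  proof (rule tendsto_integral_dominated[where w = "\<lambda>y. B * \<bar>Q y\<bar>"])
    show "AE y in lborel. ((\<lambda>z. case z of (\<rho>, x, s) \<Rightarrow> g s (x + \<rho> *\<^sub>R y) * Q y) \<longlongrightarrow>
        (case z0 of (\<rho>, x, s) \<Rightarrow> g s (x + \<rho> *\<^sub>R y) * Q y)) (at z0 within UNIV)"
    proof (rule AE_I2)
      fix y :: 'a
      have "continuous_on UNIV (\<lambda>z. (\<lambda>(s, x). g s x) (snd (snd z), fst (snd z) + fst z *\<^sub>R y) * Q y)"
        by (intro continuous_intros continuous_on_compose2[OF g]) auto
      from this[unfolded continuous_on_def, rule_format, of z0]
      show "((\<lambda>z. case z of (\<rho>, x, s) \<Rightarrow> g s (x + \<rho> *\<^sub>R y) * Q y) \<longlongrightarrow>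
        (case z0 of (\<rho>, x, s) \<Rightarrow> g s (x + \<rho> *\<^sub>R y) * Q y)) (at z0 within UNIV)"
        by (simp add: case_prod_beta)
    qed
    show "integrable lborel (\<lambda>y. B * \<bar>Q y\<bar>)" using Q by auto
  qed (use B gm in \<open>auto simp: abs_mult intro!: AE_I2 mult_right_mono borel_measurable_times\<close>)
  then show ?thesis unfolding continuous_on_def kernel_average_def case_prod_beta by blast
qed

text \<open>Translating the integration variable by \<open>h / \<rho>\<close> moves the increment
  from \<open>g\<close> to the kernel, so the kernel is differentiated and \<open>g\<close> need
  only be bounded and measurable.\<close>

lemma kernel_average_space_deriv:
  fixes g :: "'a::euclidean_space \<Rightarrow> real"
  assumes Q: "integrable lborel Q" "Q \<in> borel_measurable borel" and Q'm [measurable]: "Q' \<in> borel_measurable borel"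
    and d: "\<And>y e. \<bar>e\<bar> < 1 \<Longrightarrow> ((\<lambda>e. Q (y - e *\<^sub>R i)) has_real_derivative Q' (y - e *\<^sub>R i)) (at e)"
    and bd: "\<And>y e. \<bar>e\<bar> < 1 \<Longrightarrow> \<bar>Q' (y - e *\<^sub>R i)\<bar> \<le> w y" and w: "integrable lborel w"
    and gm [measurable]: "g \<in> borel_measurable borel" and B: "\<And>x. \<bar>g x\<bar> \<le> B" and \<rho>: "\<rho> > 0"
  shows "((\<lambda>h. kernel_average Q \<rho> (x + h *\<^sub>R i) g) has_real_derivative kernel_average Q' \<rho> x g / \<rho>) (at 0)"
proof -
  have [measurable]: "Q \<in> borel_measurable borel" by fact
  have shift: "kernel_average Q \<rho> (x + h *\<^sub>R i) g = (\<integral>y. g (x + \<rho> *\<^sub>R y) * Q (y - (h / \<rho>) *\<^sub>R i) \<partial>lborel)" for h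
  proof -
    have "(\<integral>y. g (x + \<rho> *\<^sub>R y) * Q (y - (h / \<rho>) *\<^sub>R i) \<partial>lborel)
       = \<bar>1\<bar> ^ DIM('a) * (\<integral>y. g (x + \<rho> *\<^sub>R ((h / \<rho>) *\<^sub>R i + 1 *\<^sub>R y)) * Q ((h / \<rho>) *\<^sub>R i + 1 *\<^sub>R y - (h / \<rho>) *\<^sub>R i) \<partial>lborel)"
      by (rule lborel_integral_affine) auto
    then show ?thesis using \<rho> by (simp add: kernel_average_def algebra_simps)
  qed
  have Qe: "integrable lborel (\<lambda>y. Q (y - e *\<^sub>R i))" for e
    using lborel_integrable_affine_iff[of 1 Q "- e *\<^sub>R i"] Q by simp
  have gQ: "integrable lborel (\<lambda>y. g (x + \<rho> *\<^sub>R y) * Q (y - e *\<^sub>R i))" for e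
    using kernel_average_integrable[OF Qe gm B] .
  have "B \<ge> 0" using B[of 0] by linarith
  have "((\<lambda>e. \<integral>y. g (x + \<rho> *\<^sub>R y) * Q (y - e *\<^sub>R i) \<partial>lborel) has_real_derivative
      (\<integral>y. g (x + \<rho> *\<^sub>R y) * Q' (y - 0 *\<^sub>R i) \<partial>lborel)) (at 0)"
  proof (rule has_real_derivative_integral_dominated[where a = "-1" and b = 1 and w = "\<lambda>y. B * w y"])
    fix e y assume e: "-1 < e" "e < (1::real)"
    show "((\<lambda>e. g (x + \<rho> *\<^sub>R y) * Q (y - e *\<^sub>R i)) has_real_derivative g (x + \<rho> *\<^sub>R y) * Q' (y - e *\<^sub>R i)) (at e)"
      using e by (intro DERIV_cmult d) auto
    show "\<bar>g (x + \<rho> *\<^sub>R y) * Q' (y - e *\<^sub>R i)\<bar> \<le> B * w y"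
      unfolding abs_mult using e B bd \<open>B \<ge> 0\<close> by (intro mult_mono) auto
  qed (use gQ w in auto)
  then have "((\<lambda>e. \<integral>y. g (x + \<rho> *\<^sub>R y) * Q (y - e *\<^sub>R i) \<partial>lborel) has_real_derivative kernel_average Q' \<rho> x g) (at (0 / \<rho>))"
    by (simp add: kernel_average_def)
  from DERIV_chain2[where g = "\<lambda>h. h / \<rho>" and x = 0 and s = UNIV, OF this, of "1 / \<rho>"] \<rho>
  have "((\<lambda>h. \<integral>y. g (x + \<rho> *\<^sub>R y) * Q (y - (h / \<rho>) *\<^sub>R i) \<partial>lborel) has_real_derivative kernel_average Q' \<rho> x g * (1 / \<rho>)) (at 0)"
    using DERIV_cdivide[OF DERIV_ident, of \<rho> 0 UNIV] by simp
  then show ?thesis unfolding shift by simp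
qed

lemma norm_diff_Basis_power2:
  "i \<in> Basis \<Longrightarrow> (norm (y - e *\<^sub>R i))\<^sup>2 = (norm y)\<^sup>2 - 2 * e * (y \<bullet> i) + e\<^sup>2"
  unfolding power2_norm_eq_inner
  by (simp add: inner_simps inner_commute power2_eq_square algebra_simps)

lemma gauss_shift_deriv:
  assumes i: "i \<in> Basis"
  shows "((\<lambda>e. gauss (y - e *\<^sub>R i)) has_real_derivative gauss1 i (y - e *\<^sub>R i)) (at e)"
  unfolding gauss1_def gauss_def norm_diff_Basis_power2[OF i]
  using i by (auto intro!: derivative_eq_intros simp: inner_simps field_simps)

lemma gauss1_shift_deriv:
  assumes i: "i \<in> Basis" and j: "j \<in> Basis"
  shows "((\<lambda>e. gauss1 j (y - e *\<^sub>R i)) has_real_derivative gauss2 j i (y - e *\<^sub>R i)) (at e)"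
proof -
  have "((\<lambda>e. (y - e *\<^sub>R i) \<bullet> j * gauss (y - e *\<^sub>R i)) has_real_derivative
     - (i \<bullet> j) * gauss (y - e *\<^sub>R i) + gauss1 i (y - e *\<^sub>R i) * ((y - e *\<^sub>R i) \<bullet> j)) (at e)"
    by (intro DERIV_mult gauss_shift_deriv i) (auto intro!: derivative_eq_intros simp: inner_simps)
  then show ?thesis
    by (simp add: gauss1_def[abs_def] gauss2_def algebra_simps inner_commute)
qed

text \<open>From \<open>(norm y)\<^sup>2 \<le> 2 * (norm (y - e *\<^sub>R i))\<^sup>2 + 2\<close>:
  halving the exponential rate gives a majorant uniform over all shifts with
  \<open>\<bar>e\<bar> < 1\<close>, as differentiation under the integral requires.\<close>

lemma gauss_shift_bound:
  assumes i: "i \<in> Basis" and e: "\<bar>e\<bar> < 1"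
  shows "gauss (y - e *\<^sub>R i) \<le> exp 1 * exp (- (1/4) * (norm y)\<^sup>2)" and "1 + norm (y - e *\<^sub>R i) \<le> 2 * (1 + norm y)"
proof -
  have n: "norm (e *\<^sub>R i) \<le> 1" using assms by simp
  have "norm y \<le> norm (y - e *\<^sub>R i) + norm (e *\<^sub>R i)" using norm_triangle_ineq[of "y - e *\<^sub>R i" "e *\<^sub>R i"] by simp
  then have "norm y \<le> norm (y - e *\<^sub>R i) + 1" using n by simp
  then have "(norm y)\<^sup>2 \<le> (norm (y - e *\<^sub>R i) + 1)\<^sup>2" by (intro power_mono) auto
  also have "\<dots> \<le> 2 * (norm (y - e *\<^sub>R i))\<^sup>2 + 2"
    using zero_le_power2[of "norm (y - e *\<^sub>R i) - 1"] by (simp add: power2_eq_square algebra_simps)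
  finally have "- (norm (y - e *\<^sub>R i))\<^sup>2 / 2 \<le> 1 + - (1/4) * (norm y)\<^sup>2" by simp
  then have "exp (- (norm (y - e *\<^sub>R i))\<^sup>2 / 2) \<le> exp 1 * exp (- (1/4) * (norm y)\<^sup>2)"
    by (simp only: exp_add[symmetric] exp_le_cancel_iff)
  moreover have "(1 / sqrt (2 * pi)) ^ DIM('a) \<le> (1::real)"
    using pi_gt3 by (intro power_le_one) (auto simp: real_le_rsqrt divide_le_eq_1)
  ultimately show "gauss (y - e *\<^sub>R i) \<le> exp 1 * exp (- (1/4) * (norm y)\<^sup>2)"
    unfolding gauss_def by (meson exp_ge_zero mult_left_le_one_le order_trans zero_le_power divide_nonneg_nonneg real_sqrt_ge_zero mult_nonneg_nonneg pi_ge_zero zero_le_numeral zero_le_one)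
  show "1 + norm (y - e *\<^sub>R i) \<le> 2 * (1 + norm y)"
  proof -
    have "norm (y - e *\<^sub>R i) \<le> norm y + norm (e *\<^sub>R i)" by (rule norm_triangle_ineq4)
    also have "\<dots> \<le> norm y + 1" using n by simp
    finally have "1 + norm (y - e *\<^sub>R i) \<le> (2 + norm y) + 0" by simp
    also have "\<dots> \<le> (2 + norm y) + norm y" by (intro add_left_mono) simp
    finally show ?thesis by simp
  qed
qed

lemma kernel_average_gauss_space_deriv:
  fixes g :: "'a::euclidean_space \<Rightarrow> real"
  assumes i: "i \<in> Basis" and g: "g \<in> borel_measurable borel" "\<And>x. \<bar>g x\<bar> \<le> B" "\<rho> > 0"
  shows "((\<lambda>h. kernel_average gauss \<rho> (x + h *\<^sub>R i) g) has_real_derivative kernel_average (gauss1 i) \<rho> x g / \<rho>) (at 0)"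
proof (rule kernel_average_space_deriv[OF _ _ _ gauss_shift_deriv[OF i] _ _ g])
  show "integrable lborel (gauss :: 'a \<Rightarrow> real)" using nice_kernel_integrable[OF nice_gauss] by simp
  show "integrable lborel (\<lambda>y::'a. 2 * exp 1 * ((1 + norm y) ^ 4 * exp (- (1/4) * (norm y)\<^sup>2)))"
    by (intro integrable_mult_right integrable_gauss_weight) simp
  fix y :: 'a and e :: real assume e: "\<bar>e\<bar> < 1"
  have "\<bar>(y - e *\<^sub>R i) \<bullet> i\<bar> * gauss (y - e *\<^sub>R i) \<le> (2 * (1 + norm y) ^ 4) * (exp 1 * exp (- (1/4) * (norm y)\<^sup>2))"
  proof (rule mult_mono)
    have "(1 + norm y) ^ 1 \<le> (1 + norm y) ^ 4" by (intro power_increasing) auto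
    then show "\<bar>(y - e *\<^sub>R i) \<bullet> i\<bar> \<le> 2 * (1 + norm y) ^ 4"
      using abs_inner_Basis_le[OF i, of "y - e *\<^sub>R i"] gauss_shift_bound(2)[OF i e, of y] by simp
  qed (use gauss_shift_bound(1)[OF i e, of y] gauss_pos[of "y - e *\<^sub>R i"] in auto)
  then show "\<bar>gauss1 i (y - e *\<^sub>R i)\<bar> \<le> 2 * exp 1 * ((1 + norm y) ^ 4 * exp (- (1/4) * (norm y)\<^sup>2))"
    using gauss_pos[of "y - e *\<^sub>R i"] by (simp add: gauss1_def abs_mult mult_ac)
qed auto

lemma kernel_average_gauss1_space_deriv:
  fixes g :: "'a::euclidean_space \<Rightarrow> real"
  assumes i: "i \<in> Basis" and j: "j \<in> Basis" and g: "g \<in> borel_measurable borel" "\<And>x. \<bar>g x\<bar> \<le> B" "\<rho> > 0"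
  shows "((\<lambda>h. kernel_average (gauss1 j) \<rho> (x + h *\<^sub>R i) g) has_real_derivative kernel_average (gauss2 j i) \<rho> x g / \<rho>) (at 0)"
proof (rule kernel_average_space_deriv[OF _ _ _ gauss1_shift_deriv[OF i j] _ _ g])
  show "integrable lborel (gauss1 j)" using nice_kernel_integrable[OF nice_gauss1[OF j]] by simp
  show "integrable lborel (\<lambda>y::'a. 8 * exp 1 * ((1 + norm y) ^ 4 * exp (- (1/4) * (norm y)\<^sup>2)))"
    by (intro integrable_mult_right integrable_gauss_weight) simp
  fix y :: 'a and e :: real assume e: "\<bar>e\<bar> < 1"
  define z where "z = y - e *\<^sub>R i"
  have "\<bar>(z \<bullet> j) * (z \<bullet> i) - (j \<bullet> i)\<bar> * gauss z \<le> (8 * (1 + norm y) ^ 4) * (exp 1 * exp (- (1/4) * (norm y)\<^sup>2))"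
  proof (rule mult_mono)
    have "(1 + norm z)\<^sup>2 \<le> (2 * (1 + norm y))\<^sup>2"
      using gauss_shift_bound(2)[OF i e, of y] by (intro power_mono) (auto simp: z_def)
    also have "\<dots> = 4 * (1 + norm y)\<^sup>2" by (simp add: power2_eq_square algebra_simps)
    also have "(1 + norm y)\<^sup>2 \<le> (1 + norm y) ^ 4" by (intro power_increasing) auto
    finally show "\<bar>(z \<bullet> j) * (z \<bullet> i) - (j \<bullet> i)\<bar> \<le> 8 * (1 + norm y) ^ 4"
      using abs_gauss2_factor[OF j i, of z] by simp
  qed (use gauss_shift_bound(1)[OF i e, of y] gauss_pos[of z] in \<open>auto simp: z_def\<close>)
  then show "\<bar>gauss2 j i (y - e *\<^sub>R i)\<bar> \<le> 8 * exp 1 * ((1 + norm y) ^ 4 * exp (- (1/4) * (norm y)\<^sup>2))"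
    using gauss_pos[of z] by (simp add: gauss2_def abs_mult mult_ac z_def)
qed auto

lemma kernel_average_const: "kernel_average Q \<rho> x (\<lambda>_. c) = c * (\<integral>y. Q y \<partial>lborel)"
  by (simp add: kernel_average_def)

lemma integral_gauss: "(\<integral>y. gauss y \<partial>lborel) = 1"
  using has_bochner_integral_gauss by (rule has_bochner_integral_integral_eq)

text \<open>The first two derivatives of a kernel average of the constant \<open>1\<close> vanish.\<close>

lemma integral_gauss1:
  fixes i :: "'a::euclidean_space"
  assumes "i \<in> Basis" shows "(\<integral>y. gauss1 i y \<partial>lborel) = 0"
proof -
  have "((\<lambda>h. kernel_average gauss 1 (0 + h *\<^sub>R i) (\<lambda>_. 1)) has_real_derivative kernel_average (gauss1 i) 1 0 (\<lambda>_. 1) / 1) (at 0)"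
    by (rule kernel_average_gauss_space_deriv[OF assms, where B = 1]) auto
  then show ?thesis unfolding kernel_average_const using DERIV_unique[OF _ DERIV_const] by fastforce
qed

lemma integral_gauss2:
  fixes i j :: "'a::euclidean_space"
  assumes "i \<in> Basis" "j \<in> Basis" shows "(\<integral>y. gauss2 i j y \<partial>lborel) = 0"
proof -
  have "((\<lambda>h. kernel_average (gauss1 i) 1 (0 + h *\<^sub>R j) (\<lambda>_. 1)) has_real_derivative kernel_average (gauss2 i j) 1 0 (\<lambda>_. 1) / 1) (at 0)"
    by (rule kernel_average_gauss1_space_deriv[OF assms(2,1), where B = 1]) auto
  then show ?thesis unfolding kernel_average_const using DERIV_unique[OF _ DERIV_const] by fastforce
qed

section \<open>Duhamel integrals\<close>

lemma integrable_one_plus_inverse_sqrt: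
  "integrable lborel (\<lambda>\<sigma>. indicator {0<..<T} \<sigma> * (1 + 1 / sqrt \<sigma>))"
proof (rule Bochner_Integration.integrable_bound)
  have "(\<lambda>t. t powr (- 1/2)) integrable_on {0..\<bar>T\<bar>}"
    by (rule integrable_on_powr_from_0) auto
  then have "(\<lambda>t. t powr (- 1/2)) absolutely_integrable_on {0..\<bar>T\<bar>}"
    by (subst absolutely_integrable_on_iff_nonneg) auto
  then have "integrable lborel (\<lambda>t. indicator {0..\<bar>T\<bar>} t *\<^sub>R t powr (- 1/2))"
    unfolding set_integrable_def by (subst (asm) integrable_completion) auto
  moreover have "integrable lborel (indicator {0..\<bar>T\<bar>} :: real \<Rightarrow> real)"
    by (intro integrable_real_indicator) auto
  ultimately show "integrable lborel (\<lambda>t. indicator {0..\<bar>T\<bar>} t + indicator {0..\<bar>T\<bar>} t *\<^sub>R t powr (- 1/2))"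
    by (intro Bochner_Integration.integrable_add) auto
  show "AE \<sigma> in lborel. norm (indicator {0<..<T} \<sigma> * (1 + 1 / sqrt \<sigma>))
      \<le> norm (indicator {0..\<bar>T\<bar>} \<sigma> + indicator {0..\<bar>T\<bar>} \<sigma> *\<^sub>R \<sigma> powr (- 1/2))"
    by (intro AE_I2) (auto simp: indicator_def powr_minus powr_half_sqrt inverse_eq_divide)
qed measurable

text \<open>\<sigma> is the time elapsed since emission and \<open>s\<close> the time of emission.
  The singularity allowed at \<open>\<sigma> = 0\<close> is the one left in the second derivatives
  of the heat flow of Lipschitz data.\<close>

definition admissible :: "(real \<Rightarrow> 'a::euclidean_space \<Rightarrow> real \<Rightarrow> real) \<Rightarrow> bool" where
  "admissible I \<longleftrightarrow> continuous_on ({0<..} \<times> UNIV \<times> UNIV) (\<lambda>(\<sigma>, x, s). I \<sigma> x s) \<and>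
     (\<forall>T. \<exists>C\<ge>0. \<forall>\<sigma> x s. 0 < \<sigma> \<longrightarrow> s \<le> T \<longrightarrow> \<bar>I \<sigma> x s\<bar> \<le> C * (1 + 1 / sqrt \<sigma>))"

text \<open>Integration runs over the elapsed time, so that the singularity stays at
  \<open>\<sigma> = 0\<close> while \<open>x\<close> and \<open>t\<close> vary and one majorant
  serves all of them.\<close>

definition duhamel :: "(real \<Rightarrow> 'a::euclidean_space \<Rightarrow> real \<Rightarrow> real) \<Rightarrow> 'a \<Rightarrow> real \<Rightarrow> real" where
  "duhamel I x t = (\<integral>\<sigma>. indicator {0<..<t} \<sigma> * I \<sigma> x (t - \<sigma>) \<partial>lborel)"

lemma admissible_bound:
  assumes "admissible I"
  obtains C where "C \<ge> 0" "\<forall>\<sigma> x s. 0 < \<sigma> \<longrightarrow> s \<le> T \<longrightarrow> \<bar>I \<sigma> x s\<bar> \<le> C * (1 + 1 / sqrt \<sigma>)"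
  using assms unfolding admissible_def by blast

lemma admissible_continuous:
  assumes "admissible I" "continuous_on S a" "continuous_on S b" "continuous_on S c" "\<And>z. z \<in> S \<Longrightarrow> a z > 0"
  shows "continuous_on S (\<lambda>z. I (a z) (b z) (c z))"
proof -
  have 1: "continuous_on S (\<lambda>z. (a z, b z, c z))" by (intro continuous_on_Pair assms)
  have 2: "continuous_on ({0<..} \<times> UNIV \<times> UNIV) (\<lambda>(\<sigma>, x, s). I \<sigma> x s)"
    using assms(1) unfolding admissible_def by (rule conjunct1)
  have "(\<lambda>z. (a z, b z, c z)) ` S \<subseteq> {0<..} \<times> UNIV \<times> UNIV" using assms(5) by auto
  from continuous_on_compose2[OF 2 1 this] show ?thesis by simp
qed

lemma duhamel_integrand_measurable:
  assumes "admissible I"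
  shows "(\<lambda>\<sigma>. indicator {0<..<t} \<sigma> * I \<sigma> x (t - \<sigma>)) \<in> borel_measurable lborel"
proof -
  have "continuous_on {0<..<t} (\<lambda>\<sigma>. I \<sigma> x (t - \<sigma>))"
    by (intro admissible_continuous[OF assms] continuous_intros) auto
  from borel_measurable_continuous_on_indicator[OF _ this] show ?thesis by simp
qed

lemma duhamel_integrand_bound:
  assumes "C \<ge> 0" "\<forall>\<sigma> x s. 0 < \<sigma> \<longrightarrow> s \<le> T \<longrightarrow> \<bar>I \<sigma> x s\<bar> \<le> C * (1 + 1 / sqrt \<sigma>)" "t \<le> T"
  shows "\<bar>indicator {0<..<t} \<sigma> * I \<sigma> x (t - \<sigma>)\<bar> \<le> C * (indicator {0<..<T} \<sigma> * (1 + 1 / sqrt \<sigma>))"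
  using assms by (auto simp: indicator_def)

lemma duhamel_integrable:
  assumes I: "admissible I"
  shows "integrable lborel (\<lambda>\<sigma>. indicator {0<..<t} \<sigma> * I \<sigma> x (t - \<sigma>))"
proof -
  obtain C where C: "C \<ge> 0" "\<forall>\<sigma> x s. 0 < \<sigma> \<longrightarrow> s \<le> t \<longrightarrow> \<bar>I \<sigma> x s\<bar> \<le> C * (1 + 1 / sqrt \<sigma>)"
    using admissible_bound[OF I] by metis
  show ?thesis
  proof (rule Bochner_Integration.integrable_bound)
    show "integrable lborel (\<lambda>\<sigma>. C * (indicator {0<..<t} \<sigma> * (1 + 1 / sqrt \<sigma>)))"
      by (intro integrable_mult_right integrable_one_plus_inverse_sqrt)
    show "AE \<sigma> in lborel. norm (indicator {0<..<t} \<sigma> * I \<sigma> x (t - \<sigma>)) \<le> norm (C * (indicator {0<..<t} \<sigma> * (1 + 1 / sqrt \<sigma>)))"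
      using duhamel_integrand_bound[OF C order_refl] by (intro AE_I2) (auto intro: order_trans[OF _ abs_ge_self])
  qed (rule duhamel_integrand_measurable[OF I])
qed

text \<open>Dominated convergence: the integrand converges at every \<sigma> except
  \<open>\<sigma> = t0\<close>, where the indicator jumps, and this is a null set.\<close>

lemma duhamel_continuous:
  assumes I: "admissible I"
  shows "continuous_on UNIV (\<lambda>(x, t). duhamel I x t)"
proof -
  have "((\<lambda>z. duhamel I (fst z) (snd z)) \<longlongrightarrow> duhamel I x0 t0) (at (x0, t0))" for x0 t0
  proof -
    define S where "S = (UNIV :: 'a set) \<times> {..<t0 + 1}"
    have S: "at (x0, t0) within S = at (x0, t0)"
      by (intro at_within_open) (auto simp: S_def open_Times)
    obtain C where C: "C \<ge> 0" "\<forall>\<sigma> x s. 0 < \<sigma> \<longrightarrow> s \<le> t0 + 1 \<longrightarrow> \<bar>I \<sigma> x s\<bar> \<le> C * (1 + 1 / sqrt \<sigma>)"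
      using admissible_bound[OF I] by metis
    define h where "h = (\<lambda>z \<sigma>. indicator {0<..<snd z} \<sigma> * I \<sigma> (fst z) (snd z - \<sigma>))"
    have "((\<lambda>z. \<integral>\<sigma>. h z \<sigma> \<partial>lborel) \<longlongrightarrow> (\<integral>\<sigma>. h (x0, t0) \<sigma> \<partial>lborel)) (at (x0, t0) within S)"
    proof (rule tendsto_integral_dominated)
      show "AE \<sigma> in lborel. ((\<lambda>z. h z \<sigma>) \<longlongrightarrow> h (x0, t0) \<sigma>) (at (x0, t0) within S)"
        using AE_lborel_singleton[of t0]
      proof eventually_elim
        fix \<sigma> assume \<sigma>: "\<sigma> \<noteq> t0"
        have fst_snd: "((\<lambda>z. fst z) \<longlongrightarrow> x0) (at (x0, t0))" "((\<lambda>z. snd z) \<longlongrightarrow> t0) (at (x0, t0))"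
          using tendsto_fst[OF tendsto_ident_at, of "(x0, t0)" UNIV] tendsto_snd[OF tendsto_ident_at, of "(x0, t0)" UNIV] by auto
        show "((\<lambda>z. h z \<sigma>) \<longlongrightarrow> h (x0, t0) \<sigma>) (at (x0, t0) within S)"
          unfolding S
        proof (cases "0 < \<sigma> \<and> \<sigma> < t0")
          case True
          have "\<forall>\<^sub>F z in at (x0, t0). snd z > \<sigma>"
            using order_tendstoD(1)[OF fst_snd(2)] True by blast
          then have ev: "\<forall>\<^sub>F z in at (x0, t0). I \<sigma> (fst z) (snd z - \<sigma>) = h z \<sigma>"
            by eventually_elim (use True in \<open>auto simp: h_def\<close>)
          have "continuous_on UNIV (\<lambda>z. I \<sigma> (fst z) (snd z - \<sigma>))"
            using True by (intro admissible_continuous[OF I] continuous_intros) auto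
          from this[unfolded continuous_on_def, rule_format, of "(x0, t0)"]
          have "((\<lambda>z. I \<sigma> (fst z) (snd z - \<sigma>)) \<longlongrightarrow> h (x0, t0) \<sigma>) (at (x0, t0))"
            using True by (simp add: h_def)
          then show "((\<lambda>z. h z \<sigma>) \<longlongrightarrow> h (x0, t0) \<sigma>) (at (x0, t0))"
            using ev by (rule Lim_transform_eventually)
        next
          case False
          have ev: "\<forall>\<^sub>F z in at (x0, t0). 0 = h z \<sigma>"
          proof (cases "\<sigma> \<le> 0")
            case True
            then show ?thesis by (intro always_eventually) (auto simp: h_def)
          next
            case f: False
            then have "\<forall>\<^sub>F z in at (x0, t0). snd z < \<sigma>"
              using order_tendstoD(2)[OF fst_snd(2)] False \<sigma> by force
            then show ?thesis by eventually_elim (auto simp: h_def)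
          qed
          have "h (x0, t0) \<sigma> = 0" using False by (auto simp: h_def)
          then show "((\<lambda>z. h z \<sigma>) \<longlongrightarrow> h (x0, t0) \<sigma>) (at (x0, t0))"
            using Lim_transform_eventually[OF tendsto_const ev] by simp
        qed
      qed
      show "AE \<sigma> in lborel. \<bar>h z \<sigma>\<bar> \<le> C * (indicator {0<..<t0 + 1} \<sigma> * (1 + 1 / sqrt \<sigma>))" if "z \<in> S" for z
        unfolding h_def using that duhamel_integrand_bound[OF C, of "snd z"] by (intro AE_I2) (auto simp: S_def)
      show "integrable lborel (\<lambda>\<sigma>. C * (indicator {0<..<t0 + 1} \<sigma> * (1 + 1 / sqrt \<sigma>)))"
        by (intro integrable_mult_right integrable_one_plus_inverse_sqrt)
    qed (auto simp: h_def intro: duhamel_integrand_measurable[OF I, simplified])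
    then show ?thesis unfolding S h_def duhamel_def by simp
  qed
  from this[of "fst z" "snd z" for z]
  show ?thesis unfolding continuous_on_def case_prod_beta by simp
qed

lemma duhamel_continuous_time:
  assumes "admissible I" shows "continuous_on UNIV (duhamel I x)"
proof -
  have "continuous_on UNIV (\<lambda>t. (\<lambda>(x, t). duhamel I x t) (x, t))"
    by (rule continuous_on_compose2[OF duhamel_continuous[OF assms]])
      (rule continuous_on_Pair[OF continuous_on_const continuous_on_id], simp)
  then show ?thesis by simp
qed

lemma DERIV_line_shift:
  fixes f f' :: "'a::real_vector \<Rightarrow> real"
  assumes "\<And>x. ((\<lambda>h. f (x + h *\<^sub>R i)) has_real_derivative f' x) (at 0)"
  shows "((\<lambda>h. f (x + h *\<^sub>R i)) has_real_derivative f' (x + e *\<^sub>R i)) (at e)"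
proof -
  have "((\<lambda>h. f ((x + e *\<^sub>R i) + h *\<^sub>R i)) has_real_derivative f' (x + e *\<^sub>R i)) (at (e + - e))"
    using assms[of "x + e *\<^sub>R i"] by simp
  from DERIV_shift[THEN iffD1, OF this]
  show ?thesis by (simp add: algebra_simps)
qed

lemma duhamel_space_deriv:
  assumes I: "admissible I" and I': "admissible I'"
    and d: "\<And>\<sigma> x s. \<sigma> > 0 \<Longrightarrow> ((\<lambda>h. I \<sigma> (x + h *\<^sub>R i) s) has_real_derivative I' \<sigma> x s) (at 0)"
  shows "((\<lambda>h. duhamel I (x + h *\<^sub>R i) t) has_real_derivative duhamel I' x t) (at 0)"
proof -
  obtain C where C: "C \<ge> 0" "\<forall>\<sigma> x s. 0 < \<sigma> \<longrightarrow> s \<le> t \<longrightarrow> \<bar>I' \<sigma> x s\<bar> \<le> C * (1 + 1 / sqrt \<sigma>)"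
    using admissible_bound[OF I'] by metis
  have "((\<lambda>h. \<integral>\<sigma>. indicator {0<..<t} \<sigma> * I \<sigma> (x + h *\<^sub>R i) (t - \<sigma>) \<partial>lborel) has_real_derivative
     (\<integral>\<sigma>. indicator {0<..<t} \<sigma> * I' \<sigma> (x + 0 *\<^sub>R i) (t - \<sigma>) \<partial>lborel)) (at 0)"
  proof (rule has_real_derivative_integral_dominated[where a = "-1" and b = 1 and
        \<phi> = "\<lambda>h \<sigma>. indicator {0<..<t} \<sigma> * I \<sigma> (x + h *\<^sub>R i) (t - \<sigma>)" and
        \<phi>' = "\<lambda>h \<sigma>. indicator {0<..<t} \<sigma> * I' \<sigma> (x + h *\<^sub>R i) (t - \<sigma>)"])
    show "integrable lborel (\<lambda>\<sigma>. C * (indicator {0<..<t} \<sigma> * (1 + 1 / sqrt \<sigma>)))"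
      by (intro integrable_mult_right integrable_one_plus_inverse_sqrt)
    fix e \<sigma> :: real
    show "\<bar>indicator {0<..<t} \<sigma> * I' \<sigma> (x + e *\<^sub>R i) (t - \<sigma>)\<bar> \<le> C * (indicator {0<..<t} \<sigma> * (1 + 1 / sqrt \<sigma>))"
      by (rule duhamel_integrand_bound[OF C order_refl])
    show "((\<lambda>h. indicator {0<..<t} \<sigma> * I \<sigma> (x + h *\<^sub>R i) (t - \<sigma>)) has_real_derivative
      indicator {0<..<t} \<sigma> * I' \<sigma> (x + e *\<^sub>R i) (t - \<sigma>)) (at e)"
    proof (cases "\<sigma> > 0")
      case True
      then show ?thesis
        by (intro DERIV_cmult DERIV_line_shift[where f = "\<lambda>x. I \<sigma> x (t - \<sigma>)" and f' = "\<lambda>x. I' \<sigma> x (t - \<sigma>)"] d)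
    qed simp
  qed (use duhamel_integrable[OF I] duhamel_integrand_measurable[OF I'] in auto)
  then show ?thesis by (simp add: duhamel_def)
qed

section \<open>Differentiation of Duhamel integrals in time\<close>

lemma integral_derivative_open_interval:
  fixes S D :: "real \<Rightarrow> real"
  assumes b: "b \<ge> 0" and S: "continuous_on {0..b} S"
    and d: "\<And>\<tau>. 0 < \<tau> \<Longrightarrow> \<tau> < b \<Longrightarrow> (S has_real_derivative D \<tau>) (at \<tau>)"
    and int: "integrable lborel (\<lambda>\<tau>. indicator {0<..<b} \<tau> * D \<tau>)"
  shows "(\<integral>\<tau>. indicator {0<..<b} \<tau> * D \<tau> \<partial>lborel) = S b - S 0"
proof -
  have "(D has_integral (S b - S 0)) {0..b}"
    by (rule fundamental_theorem_of_calculus_interior[OF b S])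
      (use d in \<open>auto simp: has_real_derivative_iff_has_vector_derivative\<close>)
  then have 1: "integral {0<..<b} D = S b - S 0"
    by (simp add: integral_open_interval_real[symmetric] integral_unique)
  have "set_integrable lborel {0<..<b} D"
    using int by (simp add: set_integrable_def)
  from set_borel_integral_eq_integral(2)[OF this] 1
  show ?thesis by (simp add: set_lebesgue_integral_def)
qed

lemma integral_open_interval_continuous:
  fixes k :: "real \<Rightarrow> real"
  assumes "continuous_on UNIV k"
  shows "(\<integral>a. indicator {0<..<t} a * k a \<partial>lborel) = integral {0..t} k"
    and "integrable lborel (\<lambda>a. indicator {0<..<t} a * k a)"
proof -
  have "set_integrable lborel {0..t} k"
    by (rule borel_integrable_atLeastAtMost') (use assms in \<open>auto intro: continuous_on_subset\<close>)
  then have s: "set_integrable lborel {0<..<t} k"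
    by (rule set_integrable_subset) auto
  then show "integrable lborel (\<lambda>a. indicator {0<..<t} a * k a)" by (simp add: set_integrable_def)
  show "(\<integral>a. indicator {0<..<t} a * k a \<partial>lborel) = integral {0..t} k"
    using set_borel_integral_eq_integral(2)[OF s]
    by (simp add: set_lebesgue_integral_def integral_open_interval_real)
qed

lemma lborel_integral_reflect: "(\<integral>s. f s \<partial>lborel) = (\<integral>\<sigma>. f (a - \<sigma>) \<partial>lborel)" for f :: "real \<Rightarrow> real" and a :: real
  using lborel_integral_real_affine[of "-1" f a] by simp

lemma lborel_integrable_reflect:
  "integrable lborel (\<lambda>\<sigma>. f (a - \<sigma>)) \<longleftrightarrow> integrable lborel f" for f :: "real \<Rightarrow> real" and a :: real
  using lborel_integrable_real_affine_iff[of "-1" f a] by simp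

text \<open>For fixed \<open>s\<close>, \<open>I (t - s) x s - g s\<close> is the integral of
  \<open>I' (a - s) x s\<close> over \<open>a\<close> from \<open>s\<close> to \<open>t\<close>.
  Integrating over \<open>s\<close> and exchanging the order on the triangle
  \<open>0 < s < a < t\<close>, the inner integral becomes \<open>duhamel I' x a\<close>.\<close>

lemma duhamel_time_integral:
  assumes I: "admissible I" and I': "admissible I'" and t: "t \<ge> 0"
    and d: "\<And>\<sigma> s. \<sigma> > 0 \<Longrightarrow> ((\<lambda>\<sigma>. I \<sigma> x s) has_real_derivative I' \<sigma> x s) (at \<sigma>)"
    and c: "\<And>s. continuous_on {0..} (\<lambda>\<sigma>. I \<sigma> x s)"
    and g: "continuous_on UNIV g" "\<And>s. I 0 x s = g s"
  shows "duhamel I x t = integral {0..t} (\<lambda>a. g a + duhamel I' x a)"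
proof -
  obtain C where C: "C \<ge> 0" "\<forall>\<sigma> x s. 0 < \<sigma> \<longrightarrow> s \<le> t \<longrightarrow> \<bar>I' \<sigma> x s\<bar> \<le> C * (1 + 1 / sqrt \<sigma>)"
    using admissible_bound[OF I'] by metis
  note W = duhamel_continuous_time[OF I', of x]
  define S where "S = {z::real \<times> real. 0 < snd z \<and> snd z < fst z \<and> fst z < t}"
  define D where "D = (\<lambda>a s. indicator S (a, s) * I' (a - s) x s)"
  have oS: "open S"
    unfolding S_def by (intro open_Collect_conj open_Collect_less continuous_intros)
  have Dm: "case_prod D \<in> borel_measurable (lborel \<Otimes>\<^sub>M lborel)"
  proof -
    have "continuous_on S (\<lambda>z. I' (fst z - snd z) x (snd z))"
      by (intro admissible_continuous[OF I'] continuous_intros) (auto simp: S_def)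
    then have "(\<lambda>z. indicator S z *\<^sub>R I' (fst z - snd z) x (snd z)) \<in> borel_measurable borel"
      using oS by (intro borel_measurable_continuous_on_indicator) auto
    moreover have "case_prod D = (\<lambda>z. indicator S z *\<^sub>R I' (fst z - snd z) x (snd z))"
      by (auto simp: D_def)
    ultimately show ?thesis by (simp add: lborel_prod)
  qed
  \<comment> \<open>The two slicings of the triangle: at fixed \<open>a\<close>, in terms of
    \<open>\<sigma> = a - s\<close>, one sees the integrand of \<open>duhamel I' x a\<close>; at
    fixed \<open>s\<close> the elapsed time \<open>a - s\<close> runs through
    \<open>(0, t - s)\<close>.\<close>
  have Da: "D a (a - \<sigma>) = indicator {0<..<t} a * (indicator {0<..<a} \<sigma> * I' \<sigma> x (a - \<sigma>))" for a \<sigma>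
    by (auto simp: D_def S_def indicator_def)
  have Ds: "D a s = indicator {0<..<t} s * (indicator {0<..<t - s} (a - s) * I' (a - s) x s)" for a s
    by (auto simp: D_def S_def indicator_def)
  have iDa: "integrable lborel (\<lambda>s. D a s)" for a
    unfolding lborel_integrable_reflect[of "D a" a, symmetric] Da
    by (intro integrable_mult_right duhamel_integrable I')
  have Dam: "(\<lambda>s. D a s) \<in> borel_measurable lborel" for a using iDa by auto
  define K where "K = (\<integral>\<sigma>. C * (indicator {0<..<t} \<sigma> * (1 + 1 / sqrt \<sigma>)) \<partial>lborel)"
  have iK: "integrable lborel (\<lambda>\<sigma>. C * (indicator {0<..<t} \<sigma> * (1 + 1 / sqrt \<sigma>)))"
    by (intro integrable_mult_right integrable_one_plus_inverse_sqrt)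
  \<comment> \<open>The singular majorant integrates to the same \<open>K\<close> on every slice,
    which supplies the absolute integrability that Fubini demands.\<close>
  have absD: "(\<integral>s. \<bar>D a s\<bar> \<partial>lborel) \<le> indicator {0<..<t} a * K" for a
  proof (cases "a \<in> {0<..<t}")
    case True
    have "(\<integral>s. \<bar>D a s\<bar> \<partial>lborel) = (\<integral>\<sigma>. \<bar>D a (a - \<sigma>)\<bar> \<partial>lborel)" by (rule lborel_integral_reflect)
    also have "\<dots> \<le> K" unfolding K_def
    proof (rule integral_mono[OF _ iK])
      show "integrable lborel (\<lambda>\<sigma>. \<bar>D a (a - \<sigma>)\<bar>)"
        using iDa[of a] lborel_integrable_reflect[of "D a" a] by auto
      show "\<bar>D a (a - \<sigma>)\<bar> \<le> C * (indicator {0<..<t} \<sigma> * (1 + 1 / sqrt \<sigma>))" for \<sigma>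
        using True duhamel_integrand_bound[OF C, of a] by (simp add: Da)
    qed
    finally show ?thesis using True by simp
  next
    case False
    then have "D a s = 0" for s by (auto simp: D_def S_def indicator_def)
    then show ?thesis using False by simp
  qed
  have iD: "integrable (lborel \<Otimes>\<^sub>M lborel) (case_prod D)"
  proof (rule lborel_pair.Fubini_integrable[OF Dm])
    show "integrable lborel (\<lambda>a. \<integral>s. norm (case (a, s) of (a, s) \<Rightarrow> D a s) \<partial>lborel)"
    proof (rule Bochner_Integration.integrable_bound)
      have "emeasure lborel {0<..<t} < \<infinity>" using t by simp
      then show "integrable lborel (\<lambda>a. indicator {0<..<t} a * K)" by (intro integrable_mult_left integrable_real_indicator) auto
      show "(\<lambda>a. \<integral>s. norm (case (a, s) of (a, s) \<Rightarrow> D a s) \<partial>lborel) \<in> borel_measurable lborel"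
        using Dm by measurable
      show "AE a in lborel. norm (\<integral>s. norm (case (a, s) of (a, s) \<Rightarrow> D a s) \<partial>lborel) \<le> norm (indicator {0<..<t} a * K)"
        using absD by (intro AE_I2) (auto intro: order_trans[OF _ abs_ge_self])
    qed
    show "AE a in lborel. integrable lborel (\<lambda>s. case (a, s) of (a, s) \<Rightarrow> D a s)" using iDa by simp
  qed
  have "(\<integral>a. (\<integral>s. D a s \<partial>lborel) \<partial>lborel) = (\<integral>a. indicator {0<..<t} a * duhamel I' x a \<partial>lborel)"
  proof (rule Bochner_Integration.integral_cong[OF refl])
    fix a :: real
    show "(\<integral>s. D a s \<partial>lborel) = indicator {0<..<t} a * duhamel I' x a"
      unfolding lborel_integral_reflect[of "D a" a] Da by (simp add: duhamel_def)
  qed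
  moreover have "(\<integral>s. (\<integral>a. D a s \<partial>lborel) \<partial>lborel) = (\<integral>s. indicator {0<..<t} s * (I (t - s) x s - g s) \<partial>lborel)"
  proof (rule Bochner_Integration.integral_cong[OF refl])
    fix s :: real
    show "(\<integral>a. D a s \<partial>lborel) = indicator {0<..<t} s * (I (t - s) x s - g s)"
    proof (cases "s \<in> {0<..<t}")
      case True
      have "(\<integral>a. D a s \<partial>lborel) = (\<integral>\<tau>. D (s + \<tau>) s \<partial>lborel)"
        using lborel_integral_real_affine[of 1 "\<lambda>a. D a s" s] by simp
      also have "\<dots> = (\<integral>\<tau>. indicator {0<..<t - s} \<tau> * I' \<tau> x s \<partial>lborel)"
        using True by (simp add: Ds)
      also have "\<dots> = I (t - s) x s - I 0 x s"
      proof (rule integral_derivative_open_interval[where S = "\<lambda>\<tau>. I \<tau> x s" and b = "t - s"])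
        show "continuous_on {0..t - s} (\<lambda>\<tau>. I \<tau> x s)" using c[of s] by (rule continuous_on_subset) auto
        show "integrable lborel (\<lambda>\<tau>. indicator {0<..<t - s} \<tau> * I' \<tau> x s)"
        proof (rule Bochner_Integration.integrable_bound[OF iK])
          have "continuous_on {0<..<t - s} (\<lambda>\<tau>. I' \<tau> x s)"
            by (intro admissible_continuous[OF I'] continuous_intros) auto
          from borel_measurable_continuous_on_indicator[OF _ this]
          show "(\<lambda>\<tau>. indicator {0<..<t - s} \<tau> * I' \<tau> x s) \<in> borel_measurable lborel" by simp
          have "\<bar>indicator {0<..<t - s} \<tau> * I' \<tau> x s\<bar> \<le> C * (indicator {0<..<t} \<tau> * (1 + 1 / sqrt \<tau>))" for \<tau>
            using C True by (auto simp: indicator_def)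
          then show "AE \<tau> in lborel. norm (indicator {0<..<t - s} \<tau> * I' \<tau> x s) \<le> norm (C * (indicator {0<..<t} \<tau> * (1 + 1 / sqrt \<tau>)))"
            by (intro AE_I2) (auto intro: order_trans[OF _ abs_ge_self])
        qed
      qed (use True d in auto)
      finally show ?thesis using True g by simp
    next
      case False
      then have "D a s = 0" for a by (simp add: Ds)
      then show ?thesis using False by simp
    qed
  qed
  ultimately have "(\<integral>a. indicator {0<..<t} a * duhamel I' x a \<partial>lborel)
      = (\<integral>s. indicator {0<..<t} s * (I (t - s) x s - g s) \<partial>lborel)"
    using lborel_pair.Fubini_integral[OF iD] by simp
  moreover have iI: "integrable lborel (\<lambda>s. indicator {0<..<t} s * I (t - s) x s)"
    and eI: "(\<integral>s. indicator {0<..<t} s * I (t - s) x s \<partial>lborel) = duhamel I x t"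
  proof -
    have *: "indicator {0<..<t} (t - \<sigma>) * I (t - (t - \<sigma>)) x (t - \<sigma>) = indicator {0<..<t} \<sigma> * I \<sigma> x (t - \<sigma>)" for \<sigma>
      by (auto simp: indicator_def)
    show "integrable lborel (\<lambda>s. indicator {0<..<t} s * I (t - s) x s)"
      using lborel_integrable_reflect[of "\<lambda>s. indicator {0<..<t} s * I (t - s) x s" t] duhamel_integrable[OF I, of t x] unfolding * by simp
    show "(\<integral>s. indicator {0<..<t} s * I (t - s) x s \<partial>lborel) = duhamel I x t"
      unfolding lborel_integral_reflect[of "\<lambda>s. indicator {0<..<t} s * I (t - s) x s" t] * duhamel_def ..
  qed
  moreover note ig = integral_open_interval_continuous(2)[OF g(1), of t]
  moreover note iW = integral_open_interval_continuous(2)[OF W, of t]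
  ultimately have "(\<integral>a. indicator {0<..<t} a * (g a + duhamel I' x a) \<partial>lborel) = duhamel I x t"
    by (simp add: distrib_left right_diff_distrib)
  moreover have "continuous_on UNIV (\<lambda>a. g a + duhamel I' x a)" using g W by (intro continuous_intros)
  ultimately show ?thesis using integral_open_interval_continuous(1) by metis
qed

text \<open>The preceding identity presents the Duhamel integral as a primitive of a continuous
  function; it holds for nonnegative times, so the derivative is transferred on the open
  half-line.\<close>

lemma duhamel_time_deriv:
  assumes I: "admissible I" and I': "admissible I'" and t: "t > 0"
    and d: "\<And>\<sigma> s. \<sigma> > 0 \<Longrightarrow> ((\<lambda>\<sigma>. I \<sigma> x s) has_real_derivative I' \<sigma> x s) (at \<sigma>)"
    and c: "\<And>s. continuous_on {0..} (\<lambda>\<sigma>. I \<sigma> x s)"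
    and g: "continuous_on UNIV g" "\<And>s. I 0 x s = g s"
  shows "((\<lambda>t. duhamel I x t) has_real_derivative g t + duhamel I' x t) (at t)"
proof -
  note W = duhamel_continuous_time[OF I', of x]
  have "continuous_on {0..t + 1} (\<lambda>a. g a + duhamel I' x a)"
    by (rule continuous_on_subset[of UNIV]) (use g W in \<open>auto intro!: continuous_intros\<close>)
  from integral_has_real_derivative[OF this, of t]
  have "((\<lambda>t. integral {0..t} (\<lambda>a. g a + duhamel I' x a)) has_real_derivative g t + duhamel I' x t) (at t within {0<..<t + 1})"
    using t by (auto intro: has_field_derivative_subset)
  then have "((\<lambda>t. integral {0..t} (\<lambda>a. g a + duhamel I' x a)) has_real_derivative g t + duhamel I' x t) (at t)"
    using at_within_open[of t "{0<..<t + 1}"] t by simp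
  then show ?thesis
    by (rule has_field_derivative_transform_within_open[of _ _ _ "{0<..}"])
      (use t duhamel_time_integral[OF I I' _ d c g] in auto)
qed

section \<open>The heat kernel and its derivatives\<close>

lemma gaussian_scale_deriv:
  fixes s :: real
  assumes s: "s > 0"
  shows "((\<lambda>s. s powr a * K * exp (- n / (2 * s))) has_real_derivative
     K * s powr a * exp (- n / (2 * s)) * (n / (2 * s\<^sup>2) + a / s)) (at s)"
proof -
  have d1: "((\<lambda>s. s powr a) has_real_derivative a * s powr (a - 1)) (at s)"
    using s by (auto intro!: derivative_eq_intros)
  have "((\<lambda>s. (- n / 2) * inverse s) has_real_derivative (- n / 2) * - (inverse s ^ Suc (Suc 0))) (at s)"
    using s by (intro DERIV_cmult DERIV_inverse) auto
  then have d2: "((\<lambda>s. - n / (2 * s)) has_real_derivative n / (2 * s\<^sup>2)) (at s)"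
    by (simp add: inverse_eq_divide power2_eq_square)
  have "((\<lambda>s. (s powr a * K) * exp (- n / (2 * s))) has_real_derivative
     (a * s powr (a - 1) * K) * exp (- n / (2 * s)) + (exp (- n / (2 * s)) * (n / (2 * s\<^sup>2))) * (s powr a * K)) (at s)"
    by (intro DERIV_mult DERIV_cmult_right d1 DERIV_chain2[OF DERIV_exp d2])
  moreover have "s powr (a - 1) = s powr a / s" using s by (simp add: powr_diff)
  then have "(a * s powr (a - 1) * K) * exp (- n / (2 * s)) + (exp (- n / (2 * s)) * (n / (2 * s\<^sup>2))) * (s powr a * K)
     = K * s powr a * exp (- n / (2 * s)) * (n / (2 * s\<^sup>2) + a / s)"
    by (simp add: distrib_left mult_ac)
  ultimately show ?thesis by simp
qed

text \<open>The substitution \<open>y / sqrt s\<close> moves the scale from the argument of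
  \<open>g\<close> into the kernel, where it can be differentiated although \<open>g\<close> is only
  measurable.\<close>

lemma kernel_average_gauss_scale:
  fixes g :: "'a::euclidean_space \<Rightarrow> real"
  assumes s: "s > 0" and [measurable]: "g \<in> borel_measurable borel"
  shows "kernel_average gauss (\<rho> * sqrt s) x g = (\<integral>y. g (x + \<rho> *\<^sub>R y) *
     (s powr (- real DIM('a) / 2) * (1 / sqrt (2 * pi)) ^ DIM('a) * exp (- (norm y)\<^sup>2 / (2 * s))) \<partial>lborel)"
proof -
  have "\<bar>1 / sqrt s\<bar> ^ DIM('a) = (s powr (- (1/2))) ^ DIM('a)"
    using s by (simp add: powr_minus powr_half_sqrt inverse_eq_divide)
  also have "\<dots> = s powr (- real DIM('a) / 2)"
    using s by (simp add: powr_power)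
  finally have c: "\<bar>1 / sqrt s\<bar> ^ DIM('a) = s powr (- real DIM('a) / 2)" .
  have "kernel_average gauss (\<rho> * sqrt s) x g = \<bar>1 / sqrt s\<bar> ^ DIM('a) *
     (\<integral>y. g (x + (\<rho> * sqrt s) *\<^sub>R (0 + (1 / sqrt s) *\<^sub>R y)) * gauss (0 + (1 / sqrt s) *\<^sub>R y) \<partial>lborel)"
    unfolding kernel_average_def using s by (intro lborel_integral_affine) auto
  also have "\<dots> = (\<integral>y. \<bar>1 / sqrt s\<bar> ^ DIM('a) * (g (x + (\<rho> * sqrt s) *\<^sub>R (0 + (1 / sqrt s) *\<^sub>R y)) * gauss (0 + (1 / sqrt s) *\<^sub>R y)) \<partial>lborel)"
    by simp
  also have "\<dots> = (\<integral>y. g (x + \<rho> *\<^sub>R y) *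
     (s powr (- real DIM('a) / 2) * (1 / sqrt (2 * pi)) ^ DIM('a) * exp (- (norm y)\<^sup>2 / (2 * s))) \<partial>lborel)"
  proof (rule Bochner_Integration.integral_cong[OF refl])
    fix y :: 'a
    have 1: "(\<rho> * sqrt s) *\<^sub>R (0 + (1 / sqrt s) *\<^sub>R y) = \<rho> *\<^sub>R y" using s by simp
    have "(norm (0 + (1 / sqrt s) *\<^sub>R y))\<^sup>2 / 2 = (norm y)\<^sup>2 / (2 * s)"
      using s by (simp add: power_divide)
    then have 2: "gauss (0 + (1 / sqrt s) *\<^sub>R y) = (1 / sqrt (2 * pi)) ^ DIM('a) * exp (- (norm y)\<^sup>2 / (2 * s))"
      unfolding gauss_def by (metis minus_divide_left)
    show "\<bar>1 / sqrt s\<bar> ^ DIM('a) * (g (x + (\<rho> * sqrt s) *\<^sub>R (0 + (1 / sqrt s) *\<^sub>R y)) * gauss (0 + (1 / sqrt s) *\<^sub>R y))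
       = g (x + \<rho> *\<^sub>R y) * (s powr (- real DIM('a) / 2) * (1 / sqrt (2 * pi)) ^ DIM('a) * exp (- (norm y)\<^sup>2 / (2 * s)))"
      unfolding c 1 2 by (simp only: mult_ac)
  qed
  finally show ?thesis .
qed

lemma sum_gauss2: "(\<Sum>i\<in>Basis. gauss2 i i y) = ((norm y)\<^sup>2 - real DIM('a)) * gauss y" for y :: "'a::euclidean_space"
proof -
  have "(norm y)\<^sup>2 = (\<Sum>i\<in>Basis. (y \<bullet> i) * (y \<bullet> i))"
    unfolding power2_norm_eq_inner by (rule euclidean_inner)
  moreover have "(\<Sum>i\<in>(Basis::'a set). i \<bullet> i) = real DIM('a)" by simp
  ultimately show ?thesis
    unfolding gauss2_def sum_distrib_right[symmetric] sum_subtractf by simp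
qed

text \<open>The scale is frozen at \<open>\<rho> = sqrt (2 * t)\<close> and the relative time
  \<open>s = t' / t\<close> is carried by the kernel; differentiating at \<open>s = 1\<close> needs
  a majorant only for \<open>1/2 < s < 2\<close>.\<close>

lemma kernel_average_gauss_time_deriv:
  fixes g :: "'a::euclidean_space \<Rightarrow> real"
  assumes t: "t > 0" and gm [measurable]: "g \<in> borel_measurable borel" and B: "\<And>x. \<bar>g x\<bar> \<le> B"
  shows "((\<lambda>t. kernel_average gauss (sqrt (2 * t)) x g) has_real_derivative
     (\<Sum>i\<in>Basis. kernel_average (gauss2 i i) (sqrt (2 * t)) x g) / (2 * t)) (at t)"
proof -
  define N where "N = real DIM('a)"
  define K where "K = (1 / sqrt (2 * pi)) ^ DIM('a)"
  define \<rho> where "\<rho> = sqrt (2 * t)"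
  define Q where "Q = (\<lambda>s (y::'a). s powr (- N / 2) * K * exp (- (norm y)\<^sup>2 / (2 * s)))"
  define Q' where "Q' = (\<lambda>s (y::'a). K * s powr (- N / 2) * exp (- (norm y)\<^sup>2 / (2 * s)) * ((norm y)\<^sup>2 / (2 * s\<^sup>2) + (- N / 2) / s))"
  define M where "M = (1/2) powr (- N / 2)"
  have K: "K \<ge> 0" by (simp add: K_def)
  have N: "N \<ge> 0" by (simp add: N_def)
  have B0: "B \<ge> 0" using B[of 0] by linarith
  have Qm [measurable]: "Q s \<in> borel_measurable borel" "Q' s \<in> borel_measurable borel" for s
    unfolding Q_def Q'_def by measurable
  have Qi: "integrable lborel (Q s)" if "s > 0" for s
  proof -
    have "integrable lborel (\<lambda>y::'a. (s powr (- N / 2) * K) * exp (- (1 / (2 * s)) * (norm y)\<^sup>2))"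
      by (intro integrable_mult_right integrable_exp_norm2) (use that in simp)
    then show ?thesis by (simp add: Q_def)
  qed
  have bound: "\<bar>Q' s y\<bar> \<le> K * M * (2 + N) * ((1 + norm y) ^ 4 * exp (- (1/4) * (norm y)\<^sup>2))"
    if s: "1/2 < s" "s < 2" for s y
  proof -
    have 1: "s powr (- N / 2) \<le> M" unfolding M_def using s N by (intro powr_mono2') auto
    have "1 / 4 * (norm y)\<^sup>2 \<le> 1 / (2 * s) * (norm y)\<^sup>2" using s by (intro mult_right_mono) (auto simp: field_simps)
    then have 2: "exp (- (norm y)\<^sup>2 / (2 * s)) \<le> exp (- (1/4) * (norm y)\<^sup>2)" by simp
    have "1/4 \<le> s\<^sup>2" using s power_mono[of "1/2" s 2] by (simp add: power2_eq_square)
    then have "(norm y)\<^sup>2 * 1 \<le> (norm y)\<^sup>2 * (4 * s\<^sup>2)" by (intro mult_left_mono) auto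
    then have "(norm y)\<^sup>2 / (2 * s\<^sup>2) \<le> 2 * (norm y)\<^sup>2" using s by (simp add: pos_divide_le_eq mult_ac)
    moreover have "N * 1 \<le> N * (2 * s)" using s N by (intro mult_left_mono) auto
    then have "(N / 2) / s \<le> N" using s by (simp add: pos_divide_le_eq mult_ac)
    moreover have "(norm y)\<^sup>2 / (2 * s\<^sup>2) \<ge> 0" "(N / 2) / s \<ge> 0" using s N by auto
    moreover have "(- N / 2) / s = - ((N / 2) / s)" by simp
    ultimately have "\<bar>(norm y)\<^sup>2 / (2 * s\<^sup>2) + (- N / 2) / s\<bar> \<le> 2 * (norm y)\<^sup>2 + N" using N by linarith
    also have "\<dots> \<le> (2 + N) * (1 + norm y) ^ 4"
    proof -
      have p: "(1 + norm y) ^ k \<le> (1 + norm y) ^ 4" if "k \<le> 4" for k using that by (intro power_increasing) auto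
      have "(norm y)\<^sup>2 \<le> (1 + norm y) ^ 4" by (rule order_trans[OF power_mono p]) auto
      moreover have "N * 1 \<le> N * (1 + norm y) ^ 4" using p[of 0] N by (intro mult_left_mono) auto
      ultimately show ?thesis by (simp add: distrib_right)
    qed
    finally have 3: "\<bar>(norm y)\<^sup>2 / (2 * s\<^sup>2) + (- N / 2) / s\<bar> \<le> (2 + N) * (1 + norm y) ^ 4" .
    have "\<bar>Q' s y\<bar> = K * s powr (- N / 2) * exp (- (norm y)\<^sup>2 / (2 * s)) * \<bar>(norm y)\<^sup>2 / (2 * s\<^sup>2) + (- N / 2) / s\<bar>"
      unfolding Q'_def abs_mult using K by simp
    also have "\<dots> \<le> K * M * exp (- (1/4) * (norm y)\<^sup>2) * ((2 + N) * (1 + norm y) ^ 4)"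
      using K 1 2 3 by (intro mult_mono mult_nonneg_nonneg order_refl) (auto simp: M_def)
    finally show ?thesis by (simp only: mult_ac)
  qed
  have D1: "((\<lambda>s. \<integral>y. g (x + \<rho> *\<^sub>R y) * Q s y \<partial>lborel) has_real_derivative (\<integral>y. g (x + \<rho> *\<^sub>R y) * Q' 1 y \<partial>lborel)) (at 1)"
  proof (rule has_real_derivative_integral_dominated[where a = "1/2" and b = 2 and
      \<phi> = "\<lambda>s y. g (x + \<rho> *\<^sub>R y) * Q s y" and \<phi>' = "\<lambda>s y. g (x + \<rho> *\<^sub>R y) * Q' s y"])
    show "integrable lborel (\<lambda>y::'a. B * (K * M * (2 + N) * ((1 + norm y) ^ 4 * exp (- (1/4) * (norm y)\<^sup>2))))"
      by (intro integrable_mult_right integrable_gauss_weight) simp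
    fix s :: real assume s: "1/2 < s" "s < 2"
    show "integrable lborel (\<lambda>y. g (x + \<rho> *\<^sub>R y) * Q s y)"
      using s by (intro kernel_average_integrable[OF Qi gm B]) auto
    fix y :: 'a
    show "((\<lambda>s. g (x + \<rho> *\<^sub>R y) * Q s y) has_real_derivative g (x + \<rho> *\<^sub>R y) * Q' s y) (at s)"
      unfolding Q_def Q'_def using s by (intro DERIV_cmult gaussian_scale_deriv) auto
    show "\<bar>g (x + \<rho> *\<^sub>R y) * Q' s y\<bar> \<le> B * (K * M * (2 + N) * ((1 + norm y) ^ 4 * exp (- (1/4) * (norm y)\<^sup>2)))"
      unfolding abs_mult using B B0 bound[OF s] by (intro mult_mono) auto
  qed auto
  \<comment> \<open>The heat equation for the Gaussian: its derivative in the scale is half the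
    trace of the second-derivative kernels.\<close>
  have Q1: "Q' 1 y = (\<Sum>i\<in>Basis. gauss2 i i y) / 2" for y
    unfolding sum_gauss2 Q'_def gauss_def K_def N_def by (simp add: field_simps)
  have "(\<integral>y. g (x + \<rho> *\<^sub>R y) * Q' 1 y \<partial>lborel) = (\<integral>y. (\<Sum>i\<in>Basis. g (x + \<rho> *\<^sub>R y) * gauss2 i i y) / 2 \<partial>lborel)"
    unfolding Q1 by (simp add: sum_distrib_left)
  also have "\<dots> = (\<Sum>i\<in>Basis. kernel_average (gauss2 i i) \<rho> x g) / 2"
    unfolding kernel_average_def integral_divide_zero
    by (subst Bochner_Integration.integral_sum)
      (rule kernel_average_integrable[OF nice_kernel_integrable(1)[OF nice_gauss2] gm B], assumption+, rule refl)
  finally have eq: "(\<integral>y. g (x + \<rho> *\<^sub>R y) * Q' 1 y \<partial>lborel) = (\<Sum>i\<in>Basis. kernel_average (gauss2 i i) \<rho> x g) / 2" .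
  have D2: "((\<lambda>s. \<integral>y. g (x + \<rho> *\<^sub>R y) * Q s y \<partial>lborel) has_real_derivative (\<Sum>i\<in>Basis. kernel_average (gauss2 i i) \<rho> x g) / 2) (at (t / t))"
    using D1 t unfolding eq by simp
  have "((\<lambda>t'. t' / t) has_real_derivative 1 / t) (at t)" using DERIV_cdivide[OF DERIV_ident] .
  from DERIV_chain2[where f = "\<lambda>s. \<integral>y. g (x + \<rho> *\<^sub>R y) * Q s y \<partial>lborel" and g = "\<lambda>t'. t' / t", OF D2 this]
  have "((\<lambda>t'. \<integral>y. g (x + \<rho> *\<^sub>R y) * Q (t' / t) y \<partial>lborel) has_real_derivative (\<Sum>i\<in>Basis. kernel_average (gauss2 i i) \<rho> x g) / 2 * (1 / t)) (at t)" .
  then have "((\<lambda>t'. kernel_average gauss (sqrt (2 * t')) x g) has_real_derivative (\<Sum>i\<in>Basis. kernel_average (gauss2 i i) \<rho> x g) / 2 * (1 / t)) (at t)"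
  proof (rule has_field_derivative_transform_within_open[of _ _ _ "{0<..}"])
    fix t' :: real assume "t' \<in> {0<..}"
    then have "t' / t > 0" using t by simp
    from kernel_average_gauss_scale[OF this gm, of \<rho> x]
    have "(\<integral>y. g (x + \<rho> *\<^sub>R y) * Q (t' / t) y \<partial>lborel) = kernel_average gauss (\<rho> * sqrt (t' / t)) x g"
      unfolding Q_def K_def N_def by simp
    also have "\<rho> * sqrt (t' / t) = sqrt (2 * t')"
      unfolding \<rho>_def real_sqrt_mult[symmetric] using t by simp
    finally show "(\<integral>y. g (x + \<rho> *\<^sub>R y) * Q (t' / t) y \<partial>lborel) = kernel_average gauss (sqrt (2 * t')) x g" .
  qed (use t in auto)
  then show ?thesis by (simp add: \<rho>_def mult.commute)
qed

section \<open>The heat flow of a family of data and its derivatives\<close>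

definition heat0 :: "(real \<Rightarrow> 'a::euclidean_space \<Rightarrow> real) \<Rightarrow> real \<Rightarrow> 'a \<Rightarrow> real \<Rightarrow> real" where
  "heat0 g \<sigma> x s = kernel_average gauss (sqrt (2 * \<sigma>)) x (g s)"

definition heat1 :: "(real \<Rightarrow> 'a::euclidean_space \<Rightarrow> real) \<Rightarrow> 'a \<Rightarrow> real \<Rightarrow> 'a \<Rightarrow> real \<Rightarrow> real" where
  "heat1 g i \<sigma> x s = kernel_average (gauss1 i) (sqrt (2 * \<sigma>)) x (g s) / sqrt (2 * \<sigma>)"

definition heat2 :: "(real \<Rightarrow> 'a::euclidean_space \<Rightarrow> real) \<Rightarrow> 'a \<Rightarrow> 'a \<Rightarrow> real \<Rightarrow> 'a \<Rightarrow> real \<Rightarrow> real" where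
  "heat2 g i j \<sigma> x s = kernel_average (gauss2 i j) (sqrt (2 * \<sigma>)) x (g s) / (2 * \<sigma>)"

locale bounded_continuous_family =
  fixes g :: "real \<Rightarrow> 'a::euclidean_space \<Rightarrow> real" and B :: real
  assumes g_cont: "continuous_on UNIV (\<lambda>(s, x). g s x)" and g_bound: "\<And>s x. \<bar>g s x\<bar> \<le> B"
begin

lemma g_cont_space: "continuous_on UNIV (g s)"
proof -
  have "continuous_on UNIV (\<lambda>x. (\<lambda>(s, x). g s x) (s, x))"
    by (rule continuous_on_compose2[OF g_cont])
      (rule continuous_on_Pair[OF continuous_on_const continuous_on_id], simp)
  then show ?thesis by simp
qed

lemma g_cont_time: "continuous_on UNIV (\<lambda>s. g s x)"
proof -
  have "continuous_on UNIV (\<lambda>s. (\<lambda>(s, x). g s x) (s, x))"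
    by (rule continuous_on_compose2[OF g_cont])
      (rule continuous_on_Pair[OF continuous_on_id continuous_on_const], simp)
  then show ?thesis by simp
qed

lemma g_measurable: "g s \<in> borel_measurable borel"
  using g_cont_space by (rule borel_measurable_continuous_onI)

lemma kernel_average_sqrt_continuous:
  assumes "nice_kernel Q" "continuous_on S a" "continuous_on S b" "continuous_on S c"
  shows "continuous_on S (\<lambda>z. kernel_average Q (sqrt (2 * a z)) (b z) (g (c z)))"
proof -
  have 1: "continuous_on S (\<lambda>z. (sqrt (2 * a z), b z, c z))"
    by (intro continuous_on_Pair continuous_intros assms)
  from continuous_on_compose2[OF continuous_on_kernel_average[OF nice_kernel_integrable(1)[OF assms(1)] g_cont g_bound] 1]
  show ?thesis by simp
qed

lemma heat_space_deriv:
  assumes "i \<in> Basis" "\<sigma> > 0"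
  shows "((\<lambda>h. heat0 g \<sigma> (x + h *\<^sub>R i) s) has_real_derivative heat1 g i \<sigma> x s) (at 0)"
  unfolding heat0_def heat1_def
  using kernel_average_gauss_space_deriv[OF assms(1) g_measurable[of s] g_bound[of s], of "sqrt (2 * \<sigma>)" x] assms(2) by simp

lemma heat_space_deriv2:
  assumes "i \<in> Basis" "j \<in> Basis" "\<sigma> > 0"
  shows "((\<lambda>h. heat1 g i \<sigma> (x + h *\<^sub>R j) s) has_real_derivative heat2 g i j \<sigma> x s) (at 0)"
proof -
  have "((\<lambda>h. kernel_average (gauss1 i) (sqrt (2 * \<sigma>)) (x + h *\<^sub>R j) (g s) / sqrt (2 * \<sigma>)) has_real_derivative
      kernel_average (gauss2 i j) (sqrt (2 * \<sigma>)) x (g s) / sqrt (2 * \<sigma>) / sqrt (2 * \<sigma>)) (at 0)"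
    using assms(3) by (intro DERIV_cdivide kernel_average_gauss1_space_deriv[OF assms(2,1) g_measurable g_bound]) auto
  moreover have "sqrt (2 * \<sigma>) * sqrt (2 * \<sigma>) = 2 * \<sigma>" using assms(3) by simp
  ultimately show ?thesis unfolding heat1_def heat2_def divide_divide_eq_left by simp
qed

lemma heat_time_deriv:
  assumes "\<sigma> > 0"
  shows "((\<lambda>\<sigma>. heat0 g \<sigma> x s) has_real_derivative (\<Sum>i\<in>Basis. heat2 g i i \<sigma> x s)) (at \<sigma>)"
  using kernel_average_gauss_time_deriv[OF assms g_measurable[of s] g_bound[of s], of x]
  by (simp add: heat0_def heat2_def sum_divide_distrib)

lemma heat0_zero: "heat0 g 0 x s = g s x"
  using kernel_average_const[of gauss 0 0 "g s x"] by (simp add: heat0_def kernel_average_def integral_gauss)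

lemma heat0_continuous_time: "continuous_on S (\<lambda>\<sigma>. heat0 g \<sigma> x s)"
  unfolding heat0_def by (intro kernel_average_sqrt_continuous nice_gauss continuous_intros)

lemma heat0_bound: "\<bar>heat0 g \<sigma> x s\<bar> \<le> B"
proof -
  have "\<bar>heat0 g \<sigma> x s\<bar> \<le> B * (\<integral>y. \<bar>gauss y\<bar> \<partial>(lborel::'a measure))"
    unfolding heat0_def by (rule kernel_average_bound[OF nice_kernel_integrable(1)[OF nice_gauss] g_measurable g_bound])
  moreover have "(\<lambda>y::'a. \<bar>gauss y\<bar>) = gauss" by (auto simp: gauss_pos less_imp_le)
  ultimately show ?thesis using integral_gauss[where 'a='a] by simp
qed

lemma heat_continuous:
  assumes "continuous_on S a" "continuous_on S b" "continuous_on S c" "\<And>z. z \<in> S \<Longrightarrow> a z > 0"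
  shows "continuous_on S (\<lambda>z. heat0 g (a z) (b z) (c z))"
    and "i \<in> Basis \<Longrightarrow> continuous_on S (\<lambda>z. heat1 g i (a z) (b z) (c z))"
    and "i \<in> Basis \<Longrightarrow> j \<in> Basis \<Longrightarrow> continuous_on S (\<lambda>z. heat2 g i j (a z) (b z) (c z))"
proof -
  have nz: "sqrt (2 * a z) \<noteq> 0" "2 * a z \<noteq> 0" if "z \<in> S" for z using assms(4)[OF that] by auto
  show "continuous_on S (\<lambda>z. heat0 g (a z) (b z) (c z))"
    unfolding heat0_def by (intro kernel_average_sqrt_continuous nice_gauss assms)
  show "i \<in> Basis \<Longrightarrow> continuous_on S (\<lambda>z. heat1 g i (a z) (b z) (c z))"
    unfolding heat1_def using nz by (intro continuous_on_divide kernel_average_sqrt_continuous nice_gauss1 assms continuous_on_real_sqrt continuous_on_mult continuous_on_const ballI) auto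
  show "i \<in> Basis \<Longrightarrow> j \<in> Basis \<Longrightarrow> continuous_on S (\<lambda>z. heat2 g i j (a z) (b z) (c z))"
    unfolding heat2_def using nz by (intro continuous_on_divide kernel_average_sqrt_continuous nice_gauss2 assms continuous_on_mult continuous_on_const ballI) auto
qed

end

lemma admissible_sum:
  assumes "finite A" "\<And>i. i \<in> A \<Longrightarrow> admissible (I i)"
  shows "admissible (\<lambda>\<sigma> x s. \<Sum>i\<in>A. I i \<sigma> x s)"
  unfolding admissible_def
proof (intro conjI allI)
  show "continuous_on ({0<..} \<times> UNIV \<times> UNIV) (\<lambda>(\<sigma>, x, s). \<Sum>i\<in>A. I i \<sigma> x s)"
    unfolding case_prod_beta
    using assms(2) by (intro continuous_on_sum) (simp add: admissible_def case_prod_beta)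
  fix T :: real
  have "\<forall>i\<in>A. \<exists>C\<ge>0. \<forall>\<sigma> x s. 0 < \<sigma> \<longrightarrow> s \<le> T \<longrightarrow> \<bar>I i \<sigma> x s\<bar> \<le> C * (1 + 1 / sqrt \<sigma>)"
    using assms(2) by (simp add: admissible_def)
  then obtain C where C: "\<And>i. i \<in> A \<Longrightarrow> C i \<ge> 0"
    "\<And>i \<sigma> x s. i \<in> A \<Longrightarrow> 0 < \<sigma> \<Longrightarrow> s \<le> T \<Longrightarrow> \<bar>I i \<sigma> x s\<bar> \<le> C i * (1 + 1 / sqrt \<sigma>)"
    by metis
  have "\<bar>\<Sum>i\<in>A. I i \<sigma> x s\<bar> \<le> (\<Sum>i\<in>A. C i) * (1 + 1 / sqrt \<sigma>)" if "0 < \<sigma>" "s \<le> T" for \<sigma> x s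
    unfolding sum_distrib_right using C(2) that by (intro order_trans[OF sum_abs] sum_mono) auto
  then show "\<exists>C\<ge>0. \<forall>\<sigma> x s. 0 < \<sigma> \<longrightarrow> s \<le> T \<longrightarrow> \<bar>\<Sum>i\<in>A. I i \<sigma> x s\<bar> \<le> C * (1 + 1 / sqrt \<sigma>)"
    using C(1) by (intro exI[of _ "\<Sum>i\<in>A. C i"]) (auto intro: sum_nonneg)
qed

lemma duhamel_sum:
  assumes "\<And>i. i \<in> A \<Longrightarrow> admissible (I i)"
  shows "duhamel (\<lambda>\<sigma> x s. \<Sum>i\<in>A. I i \<sigma> x s) x t = (\<Sum>i\<in>A. duhamel (I i) x t)"
  unfolding duhamel_def sum_distrib_left
  by (rule Bochner_Integration.integral_sum) (intro duhamel_integrable assms)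

text \<open>The Lipschitz constant may depend on \<open>T\<close>: for the source of the fixed point
  it grows with the exponential weight.\<close>

locale lipschitz_family = bounded_continuous_family +
  assumes g_lipschitz: "\<And>T. \<exists>L\<ge>0. \<forall>s\<le>T. \<forall>x y. \<bar>g s x - g s y\<bar> \<le> L * norm (x - y)"
begin

lemma B_nonneg: "B \<ge> 0"
  using g_bound[of 0 0] by linarith

lemma heat_admissibleI:
  assumes c: "continuous_on ({0<..} \<times> UNIV \<times> UNIV) (\<lambda>z. I (fst z) (fst (snd z)) (snd (snd z)))"
    and b: "\<And>T. \<exists>C\<ge>0. \<forall>\<sigma> x s. 0 < \<sigma> \<longrightarrow> s \<le> T \<longrightarrow> \<bar>I \<sigma> x s\<bar> \<le> C * (1 + 1 / sqrt \<sigma>)"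
  shows "admissible I"
  unfolding admissible_def using c b by (simp add: case_prod_beta)

lemma heat0_admissible: "admissible (heat0 g)"
proof (rule heat_admissibleI)
  show "continuous_on ({0<..} \<times> UNIV \<times> UNIV) (\<lambda>z. heat0 g (fst z) (fst (snd z)) (snd (snd z)))"
    by (intro heat_continuous continuous_intros) auto
  have "\<bar>heat0 g \<sigma> x s\<bar> \<le> B * (1 + 1 / sqrt \<sigma>)" if "\<sigma> > 0" for \<sigma> x s
  proof -
    have "B * 1 \<le> B * (1 + 1 / sqrt \<sigma>)" using that B_nonneg by (intro mult_left_mono) auto
    with heat0_bound[of \<sigma> x s] show ?thesis by simp
  qed
  then show "\<exists>C\<ge>0. \<forall>\<sigma> x s. 0 < \<sigma> \<longrightarrow> s \<le> T \<longrightarrow> \<bar>heat0 g \<sigma> x s\<bar> \<le> C * (1 + 1 / sqrt \<sigma>)" for T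
    using B_nonneg by blast
qed

lemma heat1_admissible:
  assumes i: "i \<in> Basis" shows "admissible (heat1 g i)"
proof (rule heat_admissibleI)
  show "continuous_on ({0<..} \<times> UNIV \<times> UNIV) (\<lambda>z. heat1 g i (fst z) (fst (snd z)) (snd (snd z)))"
    by (intro heat_continuous i continuous_intros) auto
  fix T
  define C where "C = (\<integral>y. norm y * \<bar>gauss1 i y\<bar> \<partial>lborel)"
  have C: "C \<ge> 0" by (simp add: C_def)
  obtain L where L: "L \<ge> 0" "\<And>s x y. s \<le> T \<Longrightarrow> \<bar>g s x - g s y\<bar> \<le> L * norm (x - y)"
    using g_lipschitz[of T] by blast
  have "\<bar>heat1 g i \<sigma> x s\<bar> \<le> (L * C) * (1 + 1 / sqrt \<sigma>)" if \<sigma>: "\<sigma> > 0" and s: "s \<le> T" for \<sigma> x s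
  proof -
    have "\<bar>kernel_average (gauss1 i) (sqrt (2 * \<sigma>)) x (g s)\<bar> \<le> L * sqrt (2 * \<sigma>) * C"
      unfolding C_def by (rule kernel_average_bound_lipschitz[OF nice_gauss1[OF i] integral_gauss1[OF i] g_measurable g_bound L(2)[OF s]]) (use \<sigma> in simp)
    then have "\<bar>heat1 g i \<sigma> x s\<bar> \<le> L * C * 1" using \<sigma> by (simp add: heat1_def field_simps)
    also have "\<dots> \<le> L * C * (1 + 1 / sqrt \<sigma>)" using L C \<sigma> by (intro mult_left_mono) auto
    finally show ?thesis .
  qed
  then show "\<exists>C\<ge>0. \<forall>\<sigma> x s. 0 < \<sigma> \<longrightarrow> s \<le> T \<longrightarrow> \<bar>heat1 g i \<sigma> x s\<bar> \<le> C * (1 + 1 / sqrt \<sigma>)"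
    using L C by (intro exI[of _ "L * C"]) auto
qed

text \<open>\<open>gauss2\<close> has mean zero, so Lipschitz data gain
  \<open>sqrt (2 * \<sigma>)\<close> against the denominator \<open>2 * \<sigma>\<close>. This is
  the only derivative used whose bound is singular at \<open>\<sigma> = 0\<close>.\<close>

lemma heat2_admissible:
  assumes i: "i \<in> Basis" and j: "j \<in> Basis" shows "admissible (heat2 g i j)"
proof (rule heat_admissibleI)
  show "continuous_on ({0<..} \<times> UNIV \<times> UNIV) (\<lambda>z. heat2 g i j (fst z) (fst (snd z)) (snd (snd z)))"
    by (intro heat_continuous i j continuous_intros) auto
  fix T
  define C where "C = (\<integral>y. norm y * \<bar>gauss2 i j y\<bar> \<partial>lborel)"
  have C: "C \<ge> 0" by (simp add: C_def)
  obtain L where L: "L \<ge> 0" "\<And>s x y. s \<le> T \<Longrightarrow> \<bar>g s x - g s y\<bar> \<le> L * norm (x - y)"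
    using g_lipschitz[of T] by blast
  have "\<bar>heat2 g i j \<sigma> x s\<bar> \<le> (L * C) * (1 + 1 / sqrt \<sigma>)" if \<sigma>: "\<sigma> > 0" and s: "s \<le> T" for \<sigma> x s
  proof -
    define q where "q = sqrt (2 * \<sigma>)"
    have q: "q > 0" "2 * \<sigma> = q * q" "sqrt \<sigma> \<le> q" using \<sigma> by (auto simp: q_def)
    have "\<bar>kernel_average (gauss2 i j) q x (g s)\<bar> \<le> L * q * C"
      unfolding C_def by (rule kernel_average_bound_lipschitz[OF nice_gauss2[OF i j] integral_gauss2[OF i j] g_measurable g_bound L(2)[OF s]]) (use q in simp)
    then have "\<bar>kernel_average (gauss2 i j) q x (g s)\<bar> / (q * q) \<le> L * q * C / (q * q)"
      by (rule divide_right_mono) simp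
    moreover have "\<bar>heat2 g i j \<sigma> x s\<bar> = \<bar>kernel_average (gauss2 i j) q x (g s)\<bar> / (q * q)"
      unfolding heat2_def q_def[symmetric] q(2) using q(1) by (simp add: abs_mult)
    ultimately have "\<bar>heat2 g i j \<sigma> x s\<bar> \<le> L * q * C / (q * q)" by simp
    also have "\<dots> = L * C * (1 / q)" using q(1) by simp
    also have "\<dots> \<le> L * C * (1 + 1 / sqrt \<sigma>)"
    proof (rule mult_left_mono)
      have "1 / q \<le> 1 / sqrt \<sigma>" using q \<sigma> by (intro divide_left_mono) auto
      then show "1 / q \<le> 1 + 1 / sqrt \<sigma>" by simp
    qed (use L C in auto)
    finally show ?thesis .
  qed
  then show "\<exists>C\<ge>0. \<forall>\<sigma> x s. 0 < \<sigma> \<longrightarrow> s \<le> T \<longrightarrow> \<bar>heat2 g i j \<sigma> x s\<bar> \<le> C * (1 + 1 / sqrt \<sigma>)"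
    using L C by (intro exI[of _ "L * C"]) auto
qed

lemma duhamel_heat_time_deriv:
  assumes "t > 0"
  shows "((\<lambda>t. duhamel (heat0 g) x t) has_real_derivative g t x + (\<Sum>i\<in>Basis. duhamel (heat2 g i i) x t)) (at t)"
proof -
  have "admissible (\<lambda>\<sigma> x s. \<Sum>i\<in>Basis. heat2 g i i \<sigma> x s)"
    by (intro admissible_sum heat2_admissible) auto
  from duhamel_time_deriv[OF heat0_admissible this assms heat_time_deriv heat0_continuous_time g_cont_time heat0_zero]
  show ?thesis by (simp add: duhamel_sum heat2_admissible)
qed

end

lemma C21I:
  fixes u :: "'a::euclidean_space \<Rightarrow> real \<Rightarrow> real"
  assumes u: "continuous_on (UNIV \<times> {0<..}) (\<lambda>(x, t). u x t)"
    and ut: "\<And>x t. t > 0 \<Longrightarrow> (u x has_real_derivative ut x t) (at t)" "continuous_on (UNIV \<times> {0<..}) (\<lambda>(x, t). ut x t)"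
    and ui: "\<And>i x t. i \<in> Basis \<Longrightarrow> t > 0 \<Longrightarrow> ((\<lambda>h. u (x + h *\<^sub>R i) t) has_real_derivative ui i x t) (at 0)"
      "\<And>i. i \<in> Basis \<Longrightarrow> continuous_on (UNIV \<times> {0<..}) (\<lambda>(x, t). ui i x t)"
    and uij: "\<And>i j x t. i \<in> Basis \<Longrightarrow> j \<in> Basis \<Longrightarrow> t > 0 \<Longrightarrow> ((\<lambda>h. ui i (x + h *\<^sub>R j) t) has_real_derivative uij i j x t) (at 0)"
      "\<And>i j. i \<in> Basis \<Longrightarrow> j \<in> Basis \<Longrightarrow> continuous_on (UNIV \<times> {0<..}) (\<lambda>(x, t). uij i j x t)"
  shows "C21 u" and "t > 0 \<Longrightarrow> time_deriv u x t = ut x t" and "t > 0 \<Longrightarrow> laplacian u x t = (\<Sum>i\<in>Basis. uij i i x t)"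
proof -
  have t: "time_deriv u x t = ut x t" if "t > 0" for x t
    unfolding time_deriv_def using DERIV_imp_deriv[OF ut(1)[OF that]] .
  have s1: "space_deriv i u x t = ui i x t" if "i \<in> Basis" "t > 0" for i x t
    unfolding space_deriv_def using DERIV_imp_deriv[OF ui(1)[OF that]] .
  have s2: "space_deriv j (space_deriv i u) x t = uij i j x t" if "i \<in> Basis" "j \<in> Basis" "t > 0" for i j x t
    unfolding space_deriv_def[of j] s1[OF that(1,3)] using DERIV_imp_deriv[OF uij(1)[OF that]] .
  show "t > 0 \<Longrightarrow> time_deriv u x t = ut x t" by (rule t)
  show "t > 0 \<Longrightarrow> laplacian u x t = (\<Sum>i\<in>Basis. uij i i x t)" by (simp add: laplacian_def s2)
  have c: "continuous_on (UNIV \<times> {0<..}) (\<lambda>(x, t). w x t) \<longleftrightarrow> continuous_on (UNIV \<times> {0<..}) (\<lambda>(x, t). w' x t)"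
    if "\<And>x t. t > 0 \<Longrightarrow> w x t = w' x t" for w w' :: "'a \<Rightarrow> real \<Rightarrow> real"
    by (rule continuous_on_cong) (use that in auto)
  show "C21 u"
    unfolding C21_def
  proof (intro conjI ballI allI impI)
    show "continuous_on (UNIV \<times> {0<..}) (\<lambda>(x, t). u x t)" by (rule u)
    show "continuous_on (UNIV \<times> {0<..}) (\<lambda>(x, t). time_deriv u x t)" using c[of "time_deriv u" ut] t ut by blast
  next
    fix x t assume "t > (0::real)"
    show "u x field_differentiable at t" using ut(1)[OF \<open>t > 0\<close>] by (auto simp: field_differentiable_def)
  next
    fix i :: 'a assume i: "i \<in> Basis"
    show "continuous_on (UNIV \<times> {0<..}) (\<lambda>(x, t). space_deriv i u x t)"
      using c[of "space_deriv i u" "ui i"] s1[OF i] ui(2)[OF i] by blast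
    fix x t assume "t > (0::real)"
    show "(\<lambda>h. u (x + h *\<^sub>R i) t) field_differentiable at 0" using ui(1)[OF i \<open>t > 0\<close>] by (auto simp: field_differentiable_def)
  next
    fix i j :: 'a assume i: "i \<in> Basis" and j: "j \<in> Basis"
    show "continuous_on (UNIV \<times> {0<..}) (\<lambda>(x, t). space_deriv j (space_deriv i u) x t)"
      using c[of "space_deriv j (space_deriv i u)" "uij i j"] s2[OF i j] uij(2)[OF i j] by blast
    fix x t assume "t > (0::real)"
    show "(\<lambda>h. space_deriv i u (x + h *\<^sub>R j) t) field_differentiable at 0"
      using uij(1)[OF i j \<open>t > 0\<close>] s1[OF i \<open>t > 0\<close>] by (auto simp: field_differentiable_def)
  qed
qed

section \<open>The semilinear heat equation with a bounded Lipschitz nonlinearity\<close>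

lemma continuous_on_lipschitz_real:
  fixes F :: "'a::real_normed_vector \<Rightarrow> real"
  assumes "\<And>a b. \<bar>F a - F b\<bar> \<le> K * norm (a - b)"
  shows "continuous_on S F"
proof -
  have "\<bar>F a - F b\<bar> \<le> max K 0 * norm (a - b)" for a b
    by (rule order_trans[OF assms mult_right_mono]) auto
  then have "(max K 0)-lipschitz_on S F"
    by (intro lipschitz_onI) (auto simp: dist_norm)
  then show ?thesis by (rule lipschitz_on_continuous_on)
qed

lemma admissible_zero: "admissible (\<lambda>_ (_::'a::euclidean_space) _. 0)"
  unfolding admissible_def
proof (intro conjI allI)
  show "\<exists>C\<ge>0. \<forall>\<sigma> (x::'a) s. 0 < \<sigma> \<longrightarrow> s \<le> T \<longrightarrow> \<bar>0\<bar> \<le> C * (1 + 1 / sqrt \<sigma>)" for T :: real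
    by (intro exI[of _ 0]) simp
qed (simp add: case_prod_beta)

text \<open>The weight integrates to at most \<open>exp (l * t) / l\<close>; the gain
  \<open>1 / l\<close>, taken with \<open>l = 2 * K\<close>, is what yields a contraction on all
  times at once.\<close>

lemma duhamel_diff_exp_bound:
  assumes I: "admissible I" and J: "admissible J" and t: "t \<ge> 0" and l: "l > 0"
    and b: "\<And>\<sigma>. 0 < \<sigma> \<Longrightarrow> \<sigma> < t \<Longrightarrow> \<bar>I \<sigma> x (t - \<sigma>) - J \<sigma> y (t - \<sigma>)\<bar> \<le> c * exp (l * (t - \<sigma>))" and c: "c \<ge> 0"
  shows "\<bar>duhamel I x t - duhamel J y t\<bar> \<le> c / l * exp (l * t)"
proof -
  note iI = duhamel_integrable[OF I, of t x] and iJ = duhamel_integrable[OF J, of t y]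
  have ce: "continuous_on UNIV (\<lambda>\<tau>. exp (l * (t - \<tau>)))" by (intro continuous_intros)
  note ie = integral_open_interval_continuous(2)[OF ce, of t]
  have "(\<integral>\<tau>. indicator {0<..<t} \<tau> * exp (l * (t - \<tau>)) \<partial>lborel) = - exp (l * (t - t)) / l - (- exp (l * (t - 0)) / l)"
  proof (rule integral_derivative_open_interval[where S = "\<lambda>\<tau>. - exp (l * (t - \<tau>)) / l" and b = t, OF t _ _ ie])
    show "continuous_on {0..t} (\<lambda>\<tau>. - exp (l * (t - \<tau>)) / l)" by (intro continuous_intros) (use l in auto)
    show "((\<lambda>\<tau>. - exp (l * (t - \<tau>)) / l) has_real_derivative exp (l * (t - \<tau>))) (at \<tau>)" for \<tau>
    proof -
      have "((\<lambda>\<tau>. exp (l * (t - \<tau>))) has_real_derivative exp (l * (t - \<tau>)) * (l * (0 - 1))) (at \<tau>)"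
        by (intro DERIV_chain2[OF DERIV_exp] DERIV_cmult DERIV_diff DERIV_const DERIV_ident)
      from DERIV_cdivide[OF DERIV_minus[OF this], of l] show ?thesis using l by simp
    qed
  qed
  also have "\<dots> = (exp (l * t) - 1) / l" unfolding divide_inverse by (simp add: algebra_simps)
  also have "\<dots> \<le> exp (l * t) / l" using l by (intro divide_right_mono) auto
  finally have e: "(\<integral>\<tau>. indicator {0<..<t} \<tau> * exp (l * (t - \<tau>)) \<partial>lborel) \<le> exp (l * t) / l" .
  have eq: "duhamel I x t - duhamel J y t = (\<integral>\<sigma>. indicator {0<..<t} \<sigma> * I \<sigma> x (t - \<sigma>) - indicator {0<..<t} \<sigma> * J \<sigma> y (t - \<sigma>) \<partial>lborel)"
    unfolding duhamel_def by (rule Bochner_Integration.integral_diff[symmetric, OF iI iJ])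
  have "\<bar>duhamel I x t - duhamel J y t\<bar> \<le> (\<integral>\<sigma>. \<bar>indicator {0<..<t} \<sigma> * I \<sigma> x (t - \<sigma>) - indicator {0<..<t} \<sigma> * J \<sigma> y (t - \<sigma>)\<bar> \<partial>lborel)"
    unfolding eq by (rule integral_abs_bound)
  also have "\<dots> \<le> (\<integral>\<sigma>. c * (indicator {0<..<t} \<sigma> * exp (l * (t - \<sigma>))) \<partial>lborel)"
  proof (rule integral_mono)
    show "integrable lborel (\<lambda>\<sigma>. \<bar>indicator {0<..<t} \<sigma> * I \<sigma> x (t - \<sigma>) - indicator {0<..<t} \<sigma> * J \<sigma> y (t - \<sigma>)\<bar>)"
      by (rule integrable_abs[OF Bochner_Integration.integrable_diff[OF iI iJ]])
    show "integrable lborel (\<lambda>\<sigma>. c * (indicator {0<..<t} \<sigma> * exp (l * (t - \<sigma>))))" by (rule integrable_mult_right[OF ie])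
    show "\<bar>indicator {0<..<t} \<sigma> * I \<sigma> x (t - \<sigma>) - indicator {0<..<t} \<sigma> * J \<sigma> y (t - \<sigma>)\<bar> \<le> c * (indicator {0<..<t} \<sigma> * exp (l * (t - \<sigma>)))" for \<sigma>
          proof (cases "\<sigma> \<in> {0<..<t}")
      case True
      then have "indicator {0<..<t} \<sigma> = (1::real)" by (rule indicator_simps(1))
      then show ?thesis using b[of \<sigma>] True by (simp only: mult_1_left greaterThanLessThan_iff)
    next
      case False
      then have "indicator {0<..<t} \<sigma> = (0::real)" by (rule indicator_simps(2))
      then show ?thesis by (simp only: mult_zero_left mult_zero_right diff_self abs_zero order_refl)
    qed
  qed
  also have "\<dots> \<le> c * (exp (l * t) / l)" unfolding integral_mult_right_zero by (rule mult_left_mono[OF e c])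
  finally show ?thesis by (simp only: times_divide_eq_left times_divide_eq_right)
qed

text \<open>Two functions and two base points are treated together: equal base points serve the
  contraction estimate, equal functions the Lipschitz estimate in \<open>x\<close>.\<close>

lemma kernel_average_gauss_diff:
  fixes g g' :: "'a::euclidean_space \<Rightarrow> real"
  assumes m [measurable]: "g \<in> borel_measurable borel" "g' \<in> borel_measurable borel"
    and B: "\<And>x. \<bar>g x\<bar> \<le> B" "\<And>x. \<bar>g' x\<bar> \<le> B'" and c: "\<And>z. \<bar>g (x + z) - g' (y + z)\<bar> \<le> c"
  shows "\<bar>kernel_average gauss \<rho> x g - kernel_average gauss \<rho> y g'\<bar> \<le> c"
proof -
  have ig: "integrable lborel (gauss :: 'a \<Rightarrow> real)" by (rule nice_kernel_integrable(1)[OF nice_gauss])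
  have "kernel_average gauss \<rho> x g - kernel_average gauss \<rho> y g' = (\<integral>z. g (x + \<rho> *\<^sub>R z) * gauss z - g' (y + \<rho> *\<^sub>R z) * gauss z \<partial>lborel)"
    unfolding kernel_average_def
    by (rule Bochner_Integration.integral_diff[symmetric, OF kernel_average_integrable[OF ig m(1) B(1)] kernel_average_integrable[OF ig m(2) B(2)]])
  also have "\<dots> = kernel_average gauss \<rho> 0 (\<lambda>z. g (x + z) - g' (y + z))"
    unfolding kernel_average_def by (rule Bochner_Integration.integral_cong[OF refl]) (simp only: left_diff_distrib add_0)
  finally have eq: "kernel_average gauss \<rho> x g - kernel_average gauss \<rho> y g' = kernel_average gauss \<rho> 0 (\<lambda>z. g (x + z) - g' (y + z))" .
  have "\<bar>kernel_average gauss \<rho> 0 (\<lambda>z. g (x + z) - g' (y + z))\<bar> \<le> c * (\<integral>y. \<bar>gauss y\<bar> \<partial>(lborel::'a measure))"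
    by (rule kernel_average_bound[OF ig _ c]) measurable
  moreover have "(\<lambda>y::'a. \<bar>gauss y\<bar>) = gauss" by (auto simp: gauss_pos less_imp_le)
  ultimately show ?thesis unfolding eq by (simp add: integral_gauss)
qed

lemma kernel_average_gauss_nonneg: "(\<And>x. g x \<ge> 0) \<Longrightarrow> kernel_average gauss \<rho> x g \<ge> 0"
  unfolding kernel_average_def by (rule Bochner_Integration.integral_nonneg) (simp add: gauss_pos less_imp_le)

locale semilinear_heat =
  fixes F :: "real \<Rightarrow> real" and u0 :: "'a::euclidean_space \<Rightarrow> real" and K B L M :: real
  assumes K: "K > 0" "\<And>a b. \<bar>F a - F b\<bar> \<le> K * \<bar>a - b\<bar>" and FB: "\<And>a. \<bar>F a\<bar> \<le> B"
    and u0_lipschitz: "\<And>x y. \<bar>u0 x - u0 y\<bar> \<le> L * norm (x - y)" and L: "L \<ge> 0" and u0_bound: "\<And>x. \<bar>u0 x\<bar> \<le> M"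
begin

lemma F_cont: "continuous_on S F"
  by (rule continuous_on_lipschitz_real[of F K]) (unfold real_norm_def, rule K(2))

lemma u0_cont: "continuous_on S u0"
  by (rule continuous_on_lipschitz_real[OF u0_lipschitz])

lemma u0_measurable: "u0 \<in> borel_measurable borel"
  using u0_cont by (rule borel_measurable_continuous_onI)

sublocale u0: bounded_continuous_family "\<lambda>_. u0" M
proof
  show "continuous_on UNIV (\<lambda>(s::real, x). u0 x)"
    unfolding case_prod_beta by (rule continuous_on_compose2[OF u0_cont[of UNIV] continuous_on_snd[OF continuous_on_id]]) simp
qed (rule u0_bound)

text \<open>The fixed point is sought among the functions \<open>e\<^sup>-\<^sup>2\<^sup>K\<^sup>t u\<close>: the exponential weight makes the
  Duhamel map a contraction globally in time, and it preserves the \<open>x\<close>-Lipschitz constant \<open>2L\<close>.\<close>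

definition unweight :: "(('a \<times> real) \<Rightarrow>\<^sub>C real) \<Rightarrow> 'a \<Rightarrow> real \<Rightarrow> real" where
  "unweight w x t = exp (2 * K * max t 0) * apply_bcontfun w (x, max t 0)"

definition source :: "(('a \<times> real) \<Rightarrow>\<^sub>C real) \<Rightarrow> real \<Rightarrow> 'a \<Rightarrow> real" where
  "source w s x = F (unweight w x s)"

text \<open>The Lipschitz bound is built into the space of the iteration, so the fixed point has a
  Lipschitz source at once and the second derivatives of its Duhamel term are admissible.\<close>

definition lip_set :: "(('a \<times> real) \<Rightarrow>\<^sub>C real) set" where
  "lip_set = {w. \<forall>x y t. \<bar>apply_bcontfun w (x, t) - apply_bcontfun w (y, t)\<bar> \<le> 2 * L * norm (x - y)}"

text \<open>Times below 0 are clamped to 0, so that the map lives on bounded continuous functions on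
  all of space-time.\<close>

definition picard_fun :: "(('a \<times> real) \<Rightarrow>\<^sub>C real) \<Rightarrow> 'a \<times> real \<Rightarrow> real" where
  "picard_fun w z = exp (- (2 * K * max (snd z) 0)) *
     (kernel_average gauss (sqrt (2 * max (snd z) 0)) (fst z) u0 + duhamel (heat0 (source w)) (fst z) (max (snd z) 0))"

lemma unweight_continuous:
  assumes "continuous_on S a" "continuous_on S b"
  shows "continuous_on S (\<lambda>z. unweight w (a z) (b z))"
proof -
  have "continuous_on S (\<lambda>z. apply_bcontfun w (a z, max (b z) 0))"
    by (rule continuous_on_compose2[OF continuous_on_apply_bcontfun[of UNIV w]
          continuous_on_Pair[OF assms(1) continuous_on_max[OF assms(2) continuous_on_const]]]) simp
  then show ?thesis
    unfolding unweight_def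
    by (intro continuous_on_mult continuous_on_exp continuous_on_max continuous_on_const assms)
qed

lemma source_bounded_continuous: "bounded_continuous_family (source w) B"
proof
  show "continuous_on UNIV (\<lambda>(s, x). source w s x)"
    unfolding source_def case_prod_beta
    by (rule continuous_on_compose2[OF F_cont[of UNIV]
          unweight_continuous[OF continuous_on_snd[OF continuous_on_id] continuous_on_fst[OF continuous_on_id]]]) simp
  show "\<bar>source w s x\<bar> \<le> B" for s x unfolding source_def by (rule FB)
qed

lemma unweight_diff: "unweight w x t - unweight w' y t =
    exp (2 * K * max t 0) * (apply_bcontfun w (x, max t 0) - apply_bcontfun w' (y, max t 0))"
  by (simp add: unweight_def right_diff_distrib)

lemma source_diff:
  assumes "\<bar>apply_bcontfun w (x, max s 0) - apply_bcontfun w' (y, max s 0)\<bar> \<le> c"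
  shows "\<bar>source w s x - source w' s y\<bar> \<le> K * c * exp (2 * K * max s 0)"
proof -
  have "\<bar>source w s x - source w' s y\<bar> \<le> K * (exp (2 * K * max s 0) * \<bar>apply_bcontfun w (x, max s 0) - apply_bcontfun w' (y, max s 0)\<bar>)"
    using K(2)[of "unweight w x s" "unweight w' y s"] by (simp add: source_def unweight_diff abs_mult)
  also have "\<dots> \<le> K * (exp (2 * K * max s 0) * c)" using assms K by (intro mult_left_mono) auto
  finally show ?thesis by (simp only: mult_ac)
qed

lemma source_lipschitz:
  assumes w: "w \<in> lip_set" shows "lipschitz_family (source w) B"
proof -
  interpret bounded_continuous_family "source w" B by (rule source_bounded_continuous)
  show ?thesis
  proof
    fix T :: real
    have "\<bar>source w s x - source w s y\<bar> \<le> (K * (2 * L) * exp (2 * K * max T 0)) * norm (x - y)" if "s \<le> T" for s x y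
    proof -
      have "\<bar>source w s x - source w s y\<bar> \<le> K * (2 * L * norm (x - y)) * exp (2 * K * max s 0)"
        using w by (intro source_diff) (simp add: lip_set_def)
      also have "\<dots> \<le> K * (2 * L * norm (x - y)) * exp (2 * K * max T 0)"
        using that K L by (intro mult_left_mono) auto
      finally show ?thesis by (simp only: mult_ac)
    qed
    then show "\<exists>L\<ge>0. \<forall>s\<le>T. \<forall>x y. \<bar>source w s x - source w s y\<bar> \<le> L * norm (x - y)"
      using K L by (intro exI[of _ "K * (2 * L) * exp (2 * K * max T 0)"]) auto
  qed
qed

lemma heat0_source_admissible: "w \<in> lip_set \<Longrightarrow> admissible (heat0 (source w))"
  using source_lipschitz by (rule lipschitz_family.heat0_admissible)

lemma heat0_source_diff:
  assumes "\<And>z. \<bar>apply_bcontfun w (x + z, max s 0) - apply_bcontfun w' (y + z, max s 0)\<bar> \<le> c"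
  shows "\<bar>heat0 (source w) \<sigma> x s - heat0 (source w') \<sigma> y s\<bar> \<le> K * c * exp (2 * K * max s 0)"
proof -
  interpret 1: bounded_continuous_family "source w" B by (rule source_bounded_continuous)
  interpret 2: bounded_continuous_family "source w'" B by (rule source_bounded_continuous)
  show ?thesis
    unfolding heat0_def
    by (rule kernel_average_gauss_diff[OF "1.g_measurable" "2.g_measurable" "1.g_bound" "2.g_bound"]) (intro source_diff assms)
qed

lemma picard_in_bcontfun:
  assumes w: "w \<in> lip_set" shows "picard_fun w \<in> bcontfun"
proof (rule bcontfun_normI)
  note adm = heat0_source_admissible[OF w]
  interpret bounded_continuous_family "source w" B by (rule source_bounded_continuous)
  have m: "continuous_on UNIV (\<lambda>z::'a \<times> real. max (snd z) 0)"
    by (intro continuous_on_max continuous_on_snd continuous_on_id continuous_on_const)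
  have f: "continuous_on UNIV (\<lambda>z::'a \<times> real. fst z)" by (intro continuous_on_fst continuous_on_id)
  have "continuous_on UNIV (\<lambda>z::'a \<times> real. (\<lambda>(x, t). duhamel (heat0 (source w)) x t) (fst z, max (snd z) 0))"
    by (rule continuous_on_compose2[OF duhamel_continuous[OF adm] continuous_on_Pair[OF f m]]) simp
  then have d: "continuous_on UNIV (\<lambda>z::'a \<times> real. duhamel (heat0 (source w)) (fst z) (max (snd z) 0))" by simp
  show "continuous_on UNIV (picard_fun w)"
    unfolding picard_fun_def[abs_def]
    by (intro continuous_on_mult continuous_on_add continuous_on_exp continuous_on_minus d m f continuous_on_const
        u0.kernel_average_sqrt_continuous[where c = "\<lambda>_. 0"] nice_gauss)
  fix z :: "'a \<times> real"
  define t where "t = max (snd z) 0"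
  have t: "t \<ge> 0" by (simp add: t_def)
  have B: "B \<ge> 0" using FB[of 0] by linarith
  have M: "M \<ge> 0" using u0_bound[of 0] by linarith
  have "\<bar>duhamel (heat0 (source w)) (fst z) t - duhamel (\<lambda>_ _ _. 0) (fst z) t\<bar> \<le> B / (2 * K) * exp (2 * K * t)"
  proof (rule duhamel_diff_exp_bound[OF adm admissible_zero t _ _ B])
    fix \<sigma> assume "0 < \<sigma>" "\<sigma> < t"
    have "B * 1 \<le> B * exp (2 * K * (t - \<sigma>))" using B K \<open>\<sigma> < t\<close> by (intro mult_left_mono) auto
    then show "\<bar>heat0 (source w) \<sigma> (fst z) (t - \<sigma>) - 0\<bar> \<le> B * exp (2 * K * (t - \<sigma>))"
      using heat0_bound[of \<sigma> "fst z" "t - \<sigma>"] by simp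
  qed (use K in simp)
  then have 1: "\<bar>duhamel (heat0 (source w)) (fst z) t\<bar> \<le> B / (2 * K) * exp (2 * K * t)"
    by (simp add: duhamel_def[of "\<lambda>_ _ _. 0"])
  have 2: "\<bar>kernel_average gauss (sqrt (2 * t)) (fst z) u0\<bar> \<le> M * exp (2 * K * t)"
  proof -
    have "M * 1 \<le> M * exp (2 * K * t)" using M K t by (intro mult_left_mono) auto
    then show ?thesis using u0.heat0_bound[of t "fst z" 0] by (simp add: heat0_def)
  qed
  have "norm (picard_fun w z) = exp (- (2 * K * t)) * \<bar>kernel_average gauss (sqrt (2 * t)) (fst z) u0 + duhamel (heat0 (source w)) (fst z) t\<bar>"
    by (simp add: picard_fun_def t_def abs_mult)
  also have "\<dots> \<le> exp (- (2 * K * t)) * ((M + B / (2 * K)) * exp (2 * K * t))"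
    using 1 2 by (intro mult_left_mono) (auto simp: distrib_right)
  also have "\<dots> = M + B / (2 * K)" by (simp add: exp_minus)
  finally show "norm (picard_fun w z) \<le> M + B / (2 * K)" .
qed

definition picard :: "(('a \<times> real) \<Rightarrow>\<^sub>C real) \<Rightarrow> (('a \<times> real) \<Rightarrow>\<^sub>C real)" where
  "picard w = Bcontfun (picard_fun w)"

lemma apply_picard: "w \<in> lip_set \<Longrightarrow> apply_bcontfun (picard w) z = picard_fun w z"
  unfolding picard_def by (simp add: Bcontfun_inverse picard_in_bcontfun)

text \<open>Used twice. With \<open>x = y\<close> and \<open>b = 0\<close> it is the contraction
  with factor 1/2; with \<open>w = w'\<close>, \<open>b = L * norm (x - y)\<close> and
  \<open>c = 2 * L * norm (x - y)\<close> it returns \<open>2 * L * norm (x - y)\<close>, so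
  \<open>lip_set\<close> is preserved.\<close>

lemma picard_fun_diff:
  assumes w: "w \<in> lip_set" "w' \<in> lip_set"
    and d: "\<And>z s. \<bar>apply_bcontfun w (x + z, s) - apply_bcontfun w' (y + z, s)\<bar> \<le> c"
    and k: "\<And>\<rho>. \<bar>kernel_average gauss \<rho> x u0 - kernel_average gauss \<rho> y u0\<bar> \<le> b"
  shows "\<bar>picard_fun w (x, t) - picard_fun w' (y, t)\<bar> \<le> b + c / 2"
proof -
  define t' where "t' = max t 0"
  have t': "t' \<ge> 0" by (simp add: t'_def)
  have c: "c \<ge> 0" using d[of 0 0] by linarith
  have b: "b \<ge> 0" using k[of 0] by linarith
  have "\<bar>duhamel (heat0 (source w)) x t' - duhamel (heat0 (source w')) y t'\<bar> \<le> K * c / (2 * K) * exp (2 * K * t')"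
  proof (rule duhamel_diff_exp_bound[OF heat0_source_admissible[OF w(1)] heat0_source_admissible[OF w(2)] t'])
    fix \<sigma> assume "0 < \<sigma>" "\<sigma> < t'"
    then show "\<bar>heat0 (source w) \<sigma> x (t' - \<sigma>) - heat0 (source w') \<sigma> y (t' - \<sigma>)\<bar> \<le> K * c * exp (2 * K * (t' - \<sigma>))"
      using heat0_source_diff[of w x "t' - \<sigma>" w' y c \<sigma>] d by simp
  qed (use K c in auto)
  then have 1: "\<bar>duhamel (heat0 (source w)) x t' - duhamel (heat0 (source w')) y t'\<bar> \<le> c / 2 * exp (2 * K * t')"
    using K by simp
  have "b * 1 \<le> b * exp (2 * K * t')" using b K t' by (intro mult_left_mono) auto
  then have 2: "\<bar>kernel_average gauss (sqrt (2 * t')) x u0 - kernel_average gauss (sqrt (2 * t')) y u0\<bar> \<le> b * exp (2 * K * t')"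
    using k[of "sqrt (2 * t')"] by simp
  have eq: "picard_fun w (x, t) - picard_fun w' (y, t) = exp (- (2 * K * t')) *
     ((kernel_average gauss (sqrt (2 * t')) x u0 - kernel_average gauss (sqrt (2 * t')) y u0) + (duhamel (heat0 (source w)) x t' - duhamel (heat0 (source w')) y t'))"
    by (simp add: picard_fun_def t'_def algebra_simps)
  have "\<bar>picard_fun w (x, t) - picard_fun w' (y, t)\<bar> \<le> exp (- (2 * K * t')) * (b * exp (2 * K * t') + c / 2 * exp (2 * K * t'))"
  proof -
    have "\<bar>(kernel_average gauss (sqrt (2 * t')) x u0 - kernel_average gauss (sqrt (2 * t')) y u0) + (duhamel (heat0 (source w)) x t' - duhamel (heat0 (source w')) y t')\<bar>
        \<le> b * exp (2 * K * t') + c / 2 * exp (2 * K * t')" using 1 2 by linarith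
    then show ?thesis unfolding eq abs_mult abs_exp_cancel by (rule mult_left_mono) simp
  qed
  also have "\<dots> = b + c / 2" by (simp add: exp_minus field_simps)
  finally show ?thesis .
qed

lemma picard_lip_set: assumes w: "w \<in> lip_set" shows "picard w \<in> lip_set"
proof -
  have "\<bar>picard_fun w (x, t) - picard_fun w (y, t)\<bar> \<le> 2 * L * norm (x - y)" for x y t
  proof -
    have "\<bar>picard_fun w (x, t) - picard_fun w (y, t)\<bar> \<le> L * norm (x - y) + (2 * L * norm (x - y)) / 2"
    proof (rule picard_fun_diff[OF w w])
      fix z s \<rho>
      have "\<bar>apply_bcontfun w (x + z, s) - apply_bcontfun w (y + z, s)\<bar> \<le> 2 * L * norm ((x + z) - (y + z))"
        using w unfolding lip_set_def by blast
      then show "\<bar>apply_bcontfun w (x + z, s) - apply_bcontfun w (y + z, s)\<bar> \<le> 2 * L * norm (x - y)" by simp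
      have "\<bar>u0 (x + z) - u0 (y + z)\<bar> \<le> L * norm (x - y)" for z
        using u0_lipschitz[of "x + z" "y + z"] by simp
      then show "\<bar>kernel_average gauss \<rho> x u0 - kernel_average gauss \<rho> y u0\<bar> \<le> L * norm (x - y)"
        by (intro kernel_average_gauss_diff[OF u0_measurable u0_measurable u0_bound u0_bound])
    qed
    then show ?thesis by simp
  qed
  then show ?thesis unfolding lip_set_def by (simp add: apply_picard[OF w])
qed

lemma picard_contraction:
  assumes w: "w \<in> lip_set" "w' \<in> lip_set"
  shows "dist (picard w) (picard w') \<le> 1 / 2 * dist w w'"
proof (rule dist_bound)
  fix z :: "'a \<times> real"
  obtain x t where z: "z = (x, t)" by (cases z)
  have "\<bar>picard_fun w (x, t) - picard_fun w' (x, t)\<bar> \<le> 0 + dist w w' / 2"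
    by (rule picard_fun_diff[OF w]) (use dist_bounded[of w _ w'] in \<open>auto simp: dist_real_def\<close>)
  then show "dist (apply_bcontfun (picard w) z) (apply_bcontfun (picard w') z) \<le> 1 / 2 * dist w w'"
    by (simp add: apply_picard w z dist_real_def)
qed

lemma lip_set_closed: "closed lip_set"
proof -
  have ev: "continuous_on UNIV (\<lambda>w::('a \<times> real) \<Rightarrow>\<^sub>C real. apply_bcontfun w z)" for z
    unfolding continuous_on_iff using dist_bounded by (metis le_less_trans)
  have "lip_set = (\<Inter>x. \<Inter>y. \<Inter>t. {w. \<bar>apply_bcontfun w (x, t) - apply_bcontfun w (y, t)\<bar> \<le> 2 * L * norm (x - y)})"
    by (auto simp: lip_set_def)
  moreover have cl: "closed {w. \<bar>apply_bcontfun w (x, t) - apply_bcontfun w (y, t)\<bar> \<le> 2 * L * norm (x - y)}" for x y :: 'a and t :: real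
    by (intro closed_Collect_le continuous_on_rabs continuous_on_diff ev continuous_on_const)
  ultimately show ?thesis by (simp only:) (intro closed_INT ballI cl)
qed

lemma ex_fixed_point: "\<exists>w\<in>lip_set. picard w = w"
proof -
  have "\<exists>!w\<in>lip_set. picard w = w"
  proof (rule Banach_fix[where c = "1/2"])
    show "complete lip_set" using lip_set_closed by (simp add: complete_eq_closed)
    have "0 \<in> lip_set" using L by (simp add: lip_set_def)
    then show "lip_set \<noteq> {}" by blast
  qed (use picard_lip_set picard_contraction in auto)
  then show ?thesis by blast
qed

text \<open>The fixed point is the heat flow of \<open>u0\<close>, seen as a family constant in
  time, plus the Duhamel integral of its own source. The source is Lipschitz in \<open>x\<close>, so
  both terms are differentiated through the kernels; nonnegativity comes from positivity of the
  Gaussian.\<close>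

theorem ex_solution:
  "\<exists>u :: 'a \<Rightarrow> real \<Rightarrow> real. C21 u \<and> continuous_on (UNIV \<times> {0..}) (\<lambda>(x, t). u x t) \<and>
     (\<forall>T. bounded ((\<lambda>(x, t). u x t) ` (UNIV \<times> {0..T}))) \<and>
     (\<forall>x. \<forall>t>0. time_deriv u x t = laplacian u x t + F (u x t)) \<and>
     (\<forall>x. u x 0 = u0 x) \<and>
     ((\<forall>a. F a \<ge> 0) \<longrightarrow> (\<forall>x. u0 x \<ge> 0) \<longrightarrow> (\<forall>x. \<forall>t\<ge>0. u x t \<ge> 0))"
proof -
  obtain w where w: "w \<in> lip_set" "picard w = w" using ex_fixed_point by blast
  interpret lipschitz_family "source w" B by (rule source_lipschitz[OF w(1)])
  define u where "u = unweight w"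
  let ?S = "UNIV \<times> {0<..} :: ('a \<times> real) set"
  have cu: "continuous_on S (\<lambda>(x, t). u x t)" for S
    unfolding u_def case_prod_beta by (intro unweight_continuous continuous_on_fst continuous_on_snd continuous_on_id)
  \<comment> \<open>The exponential weight of \<open>unweight\<close> cancels that of
    \<open>picard_fun\<close>, leaving the unweighted Duhamel formula.\<close>
  have rep: "u x t = heat0 (\<lambda>_. u0) t x 0 + duhamel (heat0 (source w)) x t" if "t \<ge> 0" for x t
  proof -
    have "apply_bcontfun w (x, t) = picard_fun w (x, t)" using apply_picard[OF w(1)] w(2) by metis
    then show ?thesis using that
      by (simp add: u_def unweight_def picard_fun_def heat0_def mult.assoc[symmetric] exp_add[symmetric])
  qed
  define ut where "ut = (\<lambda>x t. (\<Sum>i\<in>Basis. heat2 (\<lambda>_. u0) i i t x 0) + (source w t x + (\<Sum>i\<in>Basis. duhamel (heat2 (source w) i i) x t)))"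
  define ui where "ui = (\<lambda>i x t. heat1 (\<lambda>_. u0) i t x 0 + duhamel (heat1 (source w) i) x t)"
  define uij where "uij = (\<lambda>i j x t. heat2 (\<lambda>_. u0) i j t x 0 + duhamel (heat2 (source w) i j) x t)"
  have fs: "continuous_on ?S snd" "continuous_on ?S fst" "\<And>z. z \<in> ?S \<Longrightarrow> snd z > 0"
    by (auto intro: continuous_on_fst continuous_on_snd continuous_on_id)
  have cd: "continuous_on ?S (\<lambda>z. duhamel I (fst z) (snd z))" if "admissible I" for I :: "real \<Rightarrow> 'a \<Rightarrow> real \<Rightarrow> real"
    using duhamel_continuous[OF that] by (auto simp: case_prod_beta intro: continuous_on_subset)
  have src: "continuous_on ?S (\<lambda>z. source w (snd z) (fst z))"
    unfolding source_def
    by (rule continuous_on_compose2[OF F_cont[of UNIV] unweight_continuous[OF fs(2,1)]]) simp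
  have c1: "continuous_on ?S (\<lambda>(x, t). ut x t)"
    unfolding ut_def case_prod_beta
    by (intro continuous_on_add continuous_on_sum u0.heat_continuous fs continuous_on_const cd heat2_admissible src)
  have c2: "i \<in> Basis \<Longrightarrow> continuous_on ?S (\<lambda>(x, t). ui i x t)" for i
    unfolding ui_def case_prod_beta
    by (intro continuous_on_add u0.heat_continuous fs continuous_on_const cd heat1_admissible)
  have c3: "i \<in> Basis \<Longrightarrow> j \<in> Basis \<Longrightarrow> continuous_on ?S (\<lambda>(x, t). uij i j x t)" for i j
    unfolding uij_def case_prod_beta
    by (intro continuous_on_add u0.heat_continuous fs continuous_on_const cd heat2_admissible)
  have d1: "(u x has_real_derivative ut x t) (at t)" if t: "t > 0" for x t
  proof -
    have "((\<lambda>t. heat0 (\<lambda>_. u0) t x 0 + duhamel (heat0 (source w)) x t) has_real_derivative ut x t) (at t)"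
      unfolding ut_def using t by (intro DERIV_add u0.heat_time_deriv duhamel_heat_time_deriv)
    then show ?thesis
      by (rule has_field_derivative_transform_within_open[of _ _ _ "{0<..}"]) (use t rep in auto)
  qed
  have d2: "((\<lambda>h. u (x + h *\<^sub>R i) t) has_real_derivative ui i x t) (at 0)" if "i \<in> Basis" "t > 0" for i x t
    unfolding rep[OF less_imp_le[OF that(2)]] ui_def
    by (intro DERIV_add u0.heat_space_deriv that duhamel_space_deriv heat0_admissible heat1_admissible heat_space_deriv)
  have d3: "((\<lambda>h. ui i (x + h *\<^sub>R j) t) has_real_derivative uij i j x t) (at 0)" if "i \<in> Basis" "j \<in> Basis" "t > 0" for i j x t
    unfolding ui_def uij_def
    by (intro DERIV_add u0.heat_space_deriv2 that duhamel_space_deriv heat1_admissible heat2_admissible heat_space_deriv2)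
  have C1: "C21 u"
    by (rule C21I(1)[of u ut ui uij, OF cu d1 c1 d2 c2 d3 c3])
  have C2: "time_deriv u x t = ut x t" if "t > 0" for x t
    by (rule C21I(2)[of u ut ui uij, OF cu d1 c1 d2 c2 d3 c3 that])
  have C3: "laplacian u x t = (\<Sum>i\<in>Basis. uij i i x t)" if "t > 0" for x t
    by (rule C21I(3)[of u ut ui uij, OF cu d1 c1 d2 c2 d3 c3 that])
  show ?thesis
  proof (intro exI[of _ u] conjI allI impI)
    show "C21 u" by (rule C1)
    show "continuous_on (UNIV \<times> {0..}) (\<lambda>(x, t). u x t)" by (rule cu)
    show "time_deriv u x t = laplacian u x t + F (u x t)" if "t > 0" for x t
      unfolding C2[OF that] C3[OF that] ut_def uij_def sum.distrib by (simp add: source_def u_def)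
    show "bounded ((\<lambda>(x, t). u x t) ` (UNIV \<times> {0..T}))" for T
    proof -
      have "\<bar>u x t\<bar> \<le> exp (2 * K * max T 0) * norm w" if "t \<le> T" for x t
      proof -
        have "\<bar>apply_bcontfun w (x, max t 0)\<bar> \<le> norm w" using norm_bounded[of w "(x, max t 0)"] by simp
        then show ?thesis unfolding u_def unweight_def abs_mult
          using that K by (intro mult_mono) auto
      qed
      then show ?thesis unfolding bounded_iff by (intro exI[of _ "exp (2 * K * max T 0) * norm w"]) auto
    qed
    show "u x 0 = u0 x" for x
      using rep[of 0 x] u0.heat0_zero[of x 0] by (simp add: duhamel_def)
    show "u x t \<ge> 0" if nn: "\<forall>a. F a \<ge> 0" "\<forall>x. u0 x \<ge> 0" and t: "0 \<le> t" for x t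
    proof -
      have "kernel_average gauss \<rho> y u0 \<ge> 0" for \<rho> y using nn by (intro kernel_average_gauss_nonneg) simp
      moreover have "kernel_average gauss \<rho> y (source w s) \<ge> 0" for \<rho> y s using nn by (intro kernel_average_gauss_nonneg) (simp add: source_def)
      then have "duhamel (heat0 (source w)) x t \<ge> 0"
        unfolding duhamel_def heat0_def by (intro Bochner_Integration.integral_nonneg) simp
      ultimately show ?thesis unfolding rep[OF t] heat0_def by (intro add_nonneg_nonneg)
    qed
  qed
qed

end

section \<open>The threshold\<close>

lemma C21_parabolic_jet:
  fixes u :: "'a::euclidean_space \<Rightarrow> real \<Rightarrow> real"
  assumes u: "C21 u" and t: "t > 0"
  shows "parabolic_jet u x t (time_deriv u x t) (\<lambda>i. space_deriv i u x t) (\<lambda>i. space_deriv i (space_deriv i u) x t)"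
  unfolding parabolic_jet_def
proof (intro conjI ballI)
  have "u x field_differentiable at t" using u t by (simp add: C21_def)
  then show "(u x has_real_derivative time_deriv u x t) (at t)"
    unfolding time_deriv_def by (simp add: field_differentiable_derivI)
  fix i :: 'a assume i: "i \<in> Basis"
  have 1: "((\<lambda>h. u (y + h *\<^sub>R i) t) has_real_derivative space_deriv i u y t) (at 0)" for y
    using u t i unfolding C21_def space_deriv_def by (simp add: field_differentiable_derivI)
  have "(\<lambda>h. space_deriv i u (x + h *\<^sub>R i) t) field_differentiable at 0"
    using u t i unfolding C21_def by blast
  then have 2: "((\<lambda>h. space_deriv i u (x + h *\<^sub>R i) t) has_real_derivative space_deriv i (space_deriv i u) x t) (at 0)"
    unfolding space_deriv_def[of i "space_deriv i u"] by (simp add: field_differentiable_derivI)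
  show "\<exists>g. (\<forall>\<^sub>F h in nhds 0. ((\<lambda>h. u (x + h *\<^sub>R i) t) has_real_derivative g h) (at h)) \<and>
      g 0 = space_deriv i u x t \<and> (g has_real_derivative space_deriv i (space_deriv i u) x t) (at 0)"
  proof (intro exI[of _ "\<lambda>h. space_deriv i u (x + h *\<^sub>R i) t"] conjI always_eventually allI)
    show "((\<lambda>h. u (x + h *\<^sub>R i) t) has_real_derivative space_deriv i u (x + h *\<^sub>R i) t) (at h)" for h
      using DERIV_line_shift[where f = "\<lambda>y. u y t" and f' = "\<lambda>y. space_deriv i u y t", OF 1] .
  qed (use 2 in auto)
qed

text \<open>The datum is a radial profile \<psi> of \<open>norm x\<close>. Its derivative is the
  decaying weight, bounded by \<open>D\<close>, times a factor bounded on the half-line, and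
  \<open>norm\<close> is itself 1-Lipschitz.\<close>

lemma initial_datum_bounded_lipschitz:
  assumes p: "p > 1" and r: "r > 0" and c: "c > 0"
  obtains L M where "L \<ge> 0" "\<And>x :: 'a::euclidean_space. \<bar>initial_datum p r c x\<bar> \<le> M"
    "\<And>x y :: 'a. \<bar>initial_datum p r c x - initial_datum p r c y\<bar> \<le> L * norm (x - y)"
proof -
  define k where "k = 1 / (p - 1)"
  have k: "k > 0" using p by (simp add: k_def)
  obtain D where D: "D > 0" "\<And>y::real. y \<ge> 0 \<Longrightarrow> ln (y + exp 1) powr (r * k) \<le> D * (y + 1) powr k"
    using ln_powr_le_powr[OF r k] by metis
  define \<psi> where "\<psi> s = c * (s + 1) powr (- (2 * k)) * ln (s + exp 1) powr (r * k)" for s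
  define \<psi>' where "\<psi>' s = (s + 1) powr (- (2 * k)) * ln (s + exp 1) powr (r * k) *
     (c * (- (2 * k) / (s + 1) + r * k / (ln (s + exp 1) * (s + exp 1))))" for s
  have datum: "initial_datum p r c x = \<psi> (norm x)" for x :: 'a
    by (simp add: initial_datum_def \<psi>_def k_def)
  have W: "0 \<le> (s + 1) powr (- (2 * k)) * ln (s + exp 1) powr (r * k)"
    "(s + 1) powr (- (2 * k)) * ln (s + exp 1) powr (r * k) \<le> D" if s: "s \<ge> 0" for s
  proof -
    have "(s + 1) powr (- (2 * k)) * ln (s + exp 1) powr (r * k) \<le> (s + 1) powr (- (2 * k)) * (D * (s + 1) powr k)"
      using D(2)[OF s] by (intro mult_left_mono) auto
    also have "\<dots> = D * (s + 1) powr (- k)" by (simp add: powr_add[symmetric])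
    also have "\<dots> \<le> D * (s + 1) powr 0" using D s k by (intro mult_left_mono powr_mono) auto
    finally show "(s + 1) powr (- (2 * k)) * ln (s + exp 1) powr (r * k) \<le> D" using s by simp
  qed simp
  have deriv: "(\<psi> has_real_derivative \<psi>' s) (at s)" if s: "s \<ge> 0" for s
  proof -
    have l: "ln (s + exp 1) \<ge> 1" using ln_add_bounds(1)[OF s] .
    have pos: "s + 1 > 0" "s + exp 1 > 0" "ln (s + exp 1) > 0" using s l by (auto intro: add_nonneg_pos)
    have d1: "((\<lambda>s. (s + 1) powr (- (2 * k))) has_real_derivative - (2 * k) * (s + 1) powr (- (2 * k) - 1)) (at s)"
      using pos by (auto intro!: derivative_eq_intros)
    have d2: "((\<lambda>s. ln (s + exp 1)) has_real_derivative 1 / (s + exp 1)) (at s)"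
      using pos by (auto intro!: derivative_eq_intros)
    have "((\<lambda>y. y powr (r * k)) has_real_derivative r * k * ln (s + exp 1) powr (r * k - 1)) (at (ln (s + exp 1)))"
      using pos by (auto intro!: derivative_eq_intros)
    note d3 = DERIV_chain2[OF this d2]
    have "((\<lambda>s. c * ((s + 1) powr (- (2 * k)) * ln (s + exp 1) powr (r * k))) has_real_derivative
      c * ((- (2 * k) * (s + 1) powr (- (2 * k) - 1)) * ln (s + exp 1) powr (r * k) +
        (r * k * ln (s + exp 1) powr (r * k - 1) * (1 / (s + exp 1))) * (s + 1) powr (- (2 * k)))) (at s)"
      by (intro DERIV_cmult DERIV_mult d1 d3)
    moreover have "(s + 1) powr (- (2 * k) - 1) = (s + 1) powr (- (2 * k)) / (s + 1)"
      using pos(1) by (subst powr_diff) simp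
    moreover have "ln (s + exp 1) powr (r * k - 1) = ln (s + exp 1) powr (r * k) / ln (s + exp 1)"
      using pos(3) by (subst powr_diff) simp
    moreover have "c * ((- (2 * k) * (P / X)) * Q + (r * k * (Q / Y) * (1 / Z)) * P) = P * Q * (c * (- (2 * k) / X + r * k / (Y * Z)))"
      for P Q X Y Z :: real by (simp add: distrib_left right_diff_distrib mult_ac)
    ultimately show ?thesis unfolding \<psi>_def[abs_def] \<psi>'_def by (simp only: mult.assoc)
  qed
  define L where "L = D * (c * (2 * k + r * k))"
  have L: "L \<ge> 0" using D c k r by (simp add: L_def)
  have bound: "\<bar>\<psi>' s\<bar> \<le> L" if s: "s \<ge> 0" for s
  proof -
    have l: "ln (s + exp 1) \<ge> 1" using ln_add_bounds(1)[OF s] .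
    have "s + exp 1 \<ge> 1" using s one_le_exp_iff[of "1::real"] by linarith
    then have "1 * 1 \<le> ln (s + exp 1) * (s + exp 1)" using l by (intro mult_mono) auto
    then have 1: "r * k / (ln (s + exp 1) * (s + exp 1)) \<le> r * k / 1"
      using r k by (intro divide_left_mono) auto
    have 2: "2 * k / (s + 1) \<le> 2 * k / 1" using k s by (intro divide_left_mono) auto
    have "\<bar>- (2 * k) / (s + 1) + r * k / (ln (s + exp 1) * (s + exp 1))\<bar> \<le> \<bar>- (2 * k) / (s + 1)\<bar> + \<bar>r * k / (ln (s + exp 1) * (s + exp 1))\<bar>"
      by (rule abs_triangle_ineq)
    moreover have "\<bar>- (2 * k) / (s + 1)\<bar> = 2 * k / (s + 1)" using k s by simp
    moreover have "\<bar>r * k / (ln (s + exp 1) * (s + exp 1))\<bar> = r * k / (ln (s + exp 1) * (s + exp 1))"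
      using r k s l by (intro abs_of_nonneg divide_nonneg_nonneg mult_nonneg_nonneg) auto
    ultimately have "\<bar>- (2 * k) / (s + 1) + r * k / (ln (s + exp 1) * (s + exp 1))\<bar> \<le> 2 * k + r * k"
      using 1 2 by simp
    then have "c * \<bar>- (2 * k) / (s + 1) + r * k / (ln (s + exp 1) * (s + exp 1))\<bar> \<le> c * (2 * k + r * k)"
      using c by (intro mult_left_mono) auto
    then have "\<bar>c * (- (2 * k) / (s + 1) + r * k / (ln (s + exp 1) * (s + exp 1)))\<bar> \<le> c * (2 * k + r * k)"
      using c by (simp only: abs_mult abs_of_pos)
    moreover have "\<bar>(s + 1) powr (- (2 * k)) * ln (s + exp 1) powr (r * k)\<bar> \<le> D"
      using W[OF s] by linarith
    ultimately show ?thesis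
      unfolding \<psi>'_def L_def abs_mult[of "(s + 1) powr (- (2 * k)) * ln (s + exp 1) powr (r * k)"]
      using D by (intro mult_mono) auto
  qed
  have lip: "\<bar>\<psi> s - \<psi> s'\<bar> \<le> L * \<bar>s - s'\<bar>" if "s \<ge> 0" "s' \<ge> 0" for s s'
    using field_differentiable_bound[of "{0..}" \<psi> \<psi>' L s' s] deriv bound that
    by (auto intro: has_field_derivative_at_within simp: abs_minus_commute)
  show ?thesis
  proof (rule that[of L "c * D"])
    fix x y :: 'a
    have "c * ((norm x + 1) powr (- (2 * k)) * ln (norm x + exp 1) powr (r * k)) \<le> c * D"
      using W(2)[of "norm x"] c by (intro mult_left_mono) auto
    moreover have "c * ((norm x + 1) powr (- (2 * k)) * ln (norm x + exp 1) powr (r * k)) \<ge> 0"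
      using W(1)[of "norm x"] c by (intro mult_nonneg_nonneg) auto
    ultimately show "\<bar>initial_datum p r c x\<bar> \<le> c * D" unfolding datum \<psi>_def by (simp only: mult.assoc abs_of_nonneg)
    have "\<bar>\<psi> (norm x) - \<psi> (norm y)\<bar> \<le> L * \<bar>norm x - norm y\<bar>" by (intro lip) auto
    also have "\<dots> \<le> L * norm (x - y)" using L norm_triangle_ineq3[of x y] by (intro mult_left_mono) auto
    finally show "\<bar>initial_datum p r c x - initial_datum p r c y\<bar> \<le> L * norm (x - y)" unfolding datum .
  qed (rule L)
qed

context fujita_nonlinearity
begin

lemma continuous_on_Phi: "m > 0 \<Longrightarrow> continuous_on {..G m} Phi"
proof (intro continuous_at_imp_continuous_on ballI)
  fix z assume "m > 0" "z \<in> {..G m}"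
  then obtain u where "u > 0" "G u = z" using G_surj[of m z] by auto
  then show "isCont Phi z" using Phi_deriv[of u] DERIV_isCont by blast
qed

lemma parabolic_jet_Phi:
  assumes v: "parabolic_jet \<zeta> x t a p' q" and z: "\<zeta> x t \<le> G m" "m > 0"
  shows "parabolic_jet (\<lambda>x t. Phi (\<zeta> x t)) x t (f (Phi (\<zeta> x t)) * a) (\<lambda>i. f (Phi (\<zeta> x t)) * p' i)
    (\<lambda>i. f' (Phi (\<zeta> x t)) * f (Phi (\<zeta> x t)) * (p' i)\<^sup>2 + f (Phi (\<zeta> x t)) * q i)"
proof -
  define u where "u = Phi (\<zeta> x t)"
  have u: "u > 0" "G u = \<zeta> x t" using Phi_props[OF z(2,1)] by (auto simp: u_def)
  show ?thesis
    using parabolic_jet_compose[OF v, of Phi "\<lambda>z. f (Phi z)" "f' u * f u"] Phi_deriv_eventually[OF u(1)] f_Phi_deriv[OF u(1)]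
    by (simp add: u(2) u_def[symmetric])
qed

text \<open>For the subsolution \<open>\<Phi>(z)\<close> with \<open>z = -a(1 + |x|\<^sup>2) + t/2\<close> one has
  \<open>z\<^sub>t = \<Delta>z + 1\<close>, and the term \<open>f'(\<Phi>) f(\<Phi>) |\<nabla>z|\<^sup>2\<close> in \<open>\<Delta>\<Phi>(z)\<close> has the favourable sign.\<close>

theorem no_global_solution_large:
  obtains c1 where "c1 \<ge> 1"
    "\<And>c. c > c1 \<Longrightarrow> \<not> (\<exists>u :: 'a::euclidean_space \<Rightarrow> real \<Rightarrow> real. global_solution f (initial_datum p r c) u)"
proof -
  define N where "N = real DIM('a)"
  have N: "N > 0" by (simp add: N_def)
  define a where "a = 1 / (4 * N)"
  have a: "a > 0" "2 * a * N = 1 / 2" using N by (auto simp: a_def)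
  obtain c1 where c1: "c1 \<ge> 1"
    "\<And>c (x::'a). c > c1 \<Longrightarrow> - a * (1 + (norm x)\<^sup>2) \<le> G (initial_datum p r c x)"
    using initial_datum_large[OF a(1)] by metis
  obtain C where C: "\<And>u. u > 0 \<Longrightarrow> G u < C" using G_bounded_above by metis
  have "False" if c: "c > c1" and u: "global_solution f (initial_datum p r c) u" for c and u :: "'a \<Rightarrow> real \<Rightarrow> real"
  proof -
    have u0: "u x t \<ge> 0" if "t \<ge> 0" for x t using u that by (simp add: global_solution_def)
    have u1: "C21 u" and u2: "continuous_on (UNIV \<times> {0..}) (\<lambda>(x, t). u x t)"
      and u3: "\<And>T. bounded ((\<lambda>(x, t). u x t) ` (UNIV \<times> {0..T}))"
      and u4: "\<And>x t. t > 0 \<Longrightarrow> time_deriv u x t = laplacian u x t + f (u x t)"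
      and u5: "\<And>x. u x 0 = initial_datum p r c x"
      using u unfolding global_solution_def by auto
    \<comment> \<open>The horizon \<open>2 * (C + a)\<close> depends only on the supremum bound of
      \<open>G\<close>, so \<open>B\<close> is available before the barrier height
      \<open>m > B\<close> is chosen.\<close>
    obtain B where B: "\<And>x t. 0 \<le> t \<Longrightarrow> t \<le> 2 * (C + a) \<Longrightarrow> \<bar>u x t\<bar> \<le> B"
      using u3[of "2 * (C + a)"] unfolding bounded_iff by fastforce
    define m where "m = max B 0 + 1"
    have m: "m \<ge> 1" "m > B" by (auto simp: m_def)
    \<comment> \<open>The time at which \<open>z 0 T = G m\<close>, so that \<open>w\<close> reaches
      \<open>m\<close> at the origin. Up to then \<open>z\<close> does not exceed
      \<open>G m\<close>, and \<open>Phi\<close> is evaluated only where it inverts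
      \<open>G\<close>.\<close>
    define T where "T = 2 * (G m + a)"
    have Gm: "G m \<ge> 0" "G m < C" using G_le_iff[of 1 m] m C[of m] by auto
    have T: "T > 0" "T \<le> 2 * (C + a)" using Gm a by (auto simp: T_def)
    define z where "z = (\<lambda>(x::'a) t::real. - a * (1 + (norm x)\<^sup>2) + t / 2)"
    have zm: "z x t \<le> G m" if "t \<le> T" for x t
    proof -
      have "a * 1 \<le> a * (1 + (norm x)\<^sup>2)" using a by (intro mult_left_mono) auto
      then show ?thesis using that by (simp add: z_def T_def)
    qed
    have m0: "m > 0" using m by simp
    define w where "w = (\<lambda>x t. Phi (z x t))"
    have w: "w x t > 0" "w x t \<le> m" "G (w x t) = z x t" if "t \<le> T" for x t
      using Phi_props[OF m0 zm[OF that]] by (auto simp: w_def)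
    obtain K where K: "K > 0" "\<And>u v. 0 \<le> u \<Longrightarrow> u \<le> m \<Longrightarrow> 0 \<le> v \<Longrightarrow> v \<le> m \<Longrightarrow> \<bar>f u - f v\<bar> \<le> K * \<bar>u - v\<bar>"
      using f_lipschitz[of m] by metis
    have "w 0 T - u 0 T \<le> 0"
    proof (rule parabolic_maximum_principle[where d = "\<lambda>x t. w x t - u x t" and T = T and B = m and K = K])
      have zc: "continuous_on (UNIV \<times> {0..T}) (\<lambda>y. z (fst y) (snd y))"
        unfolding z_def by (intro continuous_intros) auto
      have "continuous_on (UNIV \<times> {0..T}) (\<lambda>y. w (fst y) (snd y))"
        unfolding w_def by (rule continuous_on_compose2[OF continuous_on_Phi[OF m0] zc]) (use zm in auto)
      moreover have "continuous_on (UNIV \<times> {0..T}) (\<lambda>y. u (fst y) (snd y))"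
        by (rule continuous_on_subset[of "UNIV \<times> {0..}"]) (use u2 in \<open>auto simp: case_prod_beta\<close>)
      ultimately show "continuous_on (UNIV \<times> {0..T}) (\<lambda>(x, t). w x t - u x t)"
        unfolding case_prod_beta by (rule continuous_on_diff)
      show "w x t - u x t \<le> m" if "0 \<le> t" "t \<le> T" for x t
        using w(2)[OF that(2), of x] u0[OF that(1), of x] by linarith
      show "w x 0 - u x 0 \<le> 0" for x
      proof -
        have cp: "c > 0" using c c1(1) by simp
        have "G (w x 0) \<le> G (initial_datum p r c x)"
          using w(3)[of 0 x] T c1(2)[OF c, of x] by (simp add: z_def)
        then show ?thesis
          using G_le_iff[OF w(1)[of 0 x] initial_datum_pos[OF cp, of p r x]] T u5[of x] by simp
      qed
      show "\<exists>a p q. parabolic_jet (\<lambda>x t. w x t - u x t) x t a p q \<and> a \<le> (\<Sum>i\<in>Basis. q i) + K * (w x t - u x t)"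
        if t: "0 < t" "t \<le> T" and pos: "w x t - u x t > 0" for x t
      proof -
        have "((\<lambda>t. t / 2) has_real_derivative 1 / 2) (at t)" using DERIV_cdivide[OF DERIV_ident] .
        from parabolic_jet_add[OF parabolic_jet_cmult[OF parabolic_jet_add[OF parabolic_jet_time[OF DERIV_const[of 1 "at t"], where x = x] parabolic_jet_norm2], of "- a"] parabolic_jet_time[OF this]]
        have pz: "parabolic_jet z x t (1 / 2) (\<lambda>i. - a * (2 * (x \<bullet> i))) (\<lambda>i. - a * 2)"
          unfolding z_def by simp
        define P where "P = w x t"
        have pw: "parabolic_jet w x t (f P * (1 / 2)) (\<lambda>i. f P * (- a * (2 * (x \<bullet> i))))
          (\<lambda>i. f' P * f P * (- a * (2 * (x \<bullet> i)))\<^sup>2 + f P * (- a * 2))"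
          using parabolic_jet_Phi[OF pz zm[OF t(2)] m0] by (simp add: w_def P_def)
        note pu = C21_parabolic_jet[OF u1 t(1), of x]
        have P: "P > 0" "P \<le> m" using w[OF t(2), of x] by (auto simp: P_def)
        have Pf: "f P > 0" "f' P > 0" using f_pos f'_pos P by auto
        have s1: "(\<Sum>i\<in>(Basis::'a set). f P * (- a * 2)) \<le> (\<Sum>i\<in>Basis. f' P * f P * (- a * (2 * (x \<bullet> i)))\<^sup>2 + f P * (- a * 2))"
          using Pf by (intro sum_mono) auto
        have s2: "(\<Sum>i\<in>(Basis::'a set). f P * (- a * 2)) = - (f P * (2 * a * N))" by (simp add: N_def)
        have 1: "f P * (1 / 2) \<le> (\<Sum>i\<in>Basis. f' P * f P * (- a * (2 * (x \<bullet> i)))\<^sup>2 + f P * (- a * 2)) + f P"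
          using s1 unfolding s2 a(2) by linarith
        have "f P - f (u x t) \<le> K * (P - u x t)"
          using K(2)[of P "u x t"] P u0[of t x] pos t by (simp add: P_def)
        then have "f P * (1 / 2) - time_deriv u x t \<le>
          (\<Sum>i\<in>Basis. (f' P * f P * (- a * (2 * (x \<bullet> i)))\<^sup>2 + f P * (- a * 2)) - space_deriv i (space_deriv i u) x t) + K * (w x t - u x t)"
          unfolding sum_subtractf u4[OF t(1)] laplacian_def using 1 by (simp add: P_def)
        then show ?thesis using parabolic_jet_diff[OF pw pu] by blast
      qed
    qed (use K T in auto)
    moreover have "z 0 T = G m" by (simp add: z_def T_def add_divide_distrib)
    then have "w 0 T = m" using Phi_G[OF m0] by (simp add: w_def)
    \<comment> \<open>Comparison puts \<open>u 0 T\<close> at or above \<open>m\<close>, beyond the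
      bound of \<open>u\<close> on the horizon.\<close>
    moreover have "u 0 T \<le> B" using B[of T 0] T by simp
    ultimately show False using m by simp
  qed
  with c1(1) show ?thesis using that by blast
qed

text \<open>If \<open>v\<close> is a positive supersolution of \<open>v\<^sub>t = \<Delta>v + \<delta> v\<^sup>1\<^sup>+\<^sup>1\<^sup>/\<^sup>\<kappa>\<close>, then
  \<open>\<Phi>(-A v\<^sup>-\<^sup>1\<^sup>/\<^sup>\<kappa>)\<close> is a supersolution for \<open>f\<close>, because it is a concave function of \<open>v\<close>.\<close>

lemma parabolic_jet_supersolution:
  fixes v :: "'a::euclidean_space \<Rightarrow> real \<Rightarrow> real"
  assumes v: "parabolic_jet v x t a p' q" "a - (\<Sum>i\<in>Basis. q i) \<ge> \<delta> * v x t powr (1 + 1 / \<kappa>)" "v x t > 0"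
    and \<kappa>: "\<kappa> > 0" and \<delta>: "\<delta> > 0" and A: "A > 0" "A \<ge> \<kappa> / \<delta>"
    and m: "m > 0" "\<And>u. 0 < u \<Longrightarrow> u \<le> m \<Longrightarrow> f' u * (- G u) \<le> \<kappa> + 1"
    and le: "- A * v x t powr (- (1 / \<kappa>)) \<le> G m"
  shows "\<exists>a p q. parabolic_jet (\<lambda>x t. Phi (- A * v x t powr (- (1 / \<kappa>)))) x t a p q \<and>
     a - (\<Sum>i\<in>Basis. q i) \<ge> f (Phi (- A * v x t powr (- (1 / \<kappa>))))"
proof -
  define b where "b = 1 / \<kappa>"
  have b: "b > 0" "b * \<kappa> = 1" using \<kappa> by (auto simp: b_def)
  define y where "y = v x t"
  have y: "y > 0" using v(3) by (simp add: y_def)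
  define U where "U = Phi (- A * y powr (- b))"
  have U: "U > 0" "U \<le> m" "G U = - A * y powr (- b)"
    using Phi_props[OF m(1) le] by (auto simp: U_def y_def b_def)
  have fU: "f U > 0" using U f_pos by simp
  define e1 where "e1 = A * b * y powr (- b - 1)"
  define e2 where "e2 = - A * b * (b + 1) * y powr (- b - 2)"
  have ev: "\<forall>\<^sub>F s in nhds y. ((\<lambda>s. - A * s powr (- b)) has_real_derivative A * b * s powr (- b - 1)) (at s)"
  proof -
    have "\<forall>\<^sub>F s in nhds y. s \<in> {0<..}" using y by (intro eventually_nhds_in_open) auto
    then show ?thesis by eventually_elim (auto intro!: derivative_eq_intros)
  qed
  have d: "((\<lambda>s. s powr (- b - 1)) has_real_derivative (- b - 1) * y powr (- b - 1 - 1)) (at y)"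
    using y by (auto intro!: derivative_eq_intros)
  have e2: "((\<lambda>s. A * b * s powr (- b - 1)) has_real_derivative e2) (at y)"
  proof -
    have "A * b * ((- b - 1) * y powr (- b - 1 - 1)) = e2" by (simp add: e2_def algebra_simps)
    then show ?thesis using DERIV_cmult[OF d, of "A * b"] by (simp only:)
  qed
  have pz: "parabolic_jet (\<lambda>x t. - A * v x t powr (- b)) x t (e1 * a) (\<lambda>i. e1 * p' i) (\<lambda>i. e2 * (p' i)\<^sup>2 + e1 * q i)"
    using parabolic_jet_compose[OF v(1) ev[unfolded y_def] e2[unfolded y_def]] by (simp add: e1_def y_def)
  have pU: "parabolic_jet (\<lambda>x t. Phi (- A * v x t powr (- b))) x t (f U * (e1 * a)) (\<lambda>i. f U * (e1 * p' i))
     (\<lambda>i. f' U * f U * (e1 * p' i)\<^sup>2 + f U * (e2 * (p' i)\<^sup>2 + e1 * q i))"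
    using parabolic_jet_Phi[OF pz le[folded b_def] m(1)] by (simp add: U_def y_def)
  \<comment> \<open>This times \<open>f U\<close> is the second derivative in \<open>v\<close> of
    the composed function. Since \<open>A * y powr (- b) = - G U\<close>, its sign is that of
    \<open>b * f' U * (- G U) - (b + 1)\<close>, and
    \<open>b * (\<kappa> + 1) = b + 1\<close>.\<close>
  have concave: "f' U * e1\<^sup>2 + e2 \<le> 0"
  proof -
    have "f' U * (A * y powr (- b)) \<le> \<kappa> + 1" using m(2)[OF U(1,2)] unfolding U(3) by simp
    then have "b * (f' U * (A * y powr (- b))) \<le> b * (\<kappa> + 1)" using b by (intro mult_left_mono) auto
    then have "b * (f' U * (A * y powr (- b))) - (b + 1) \<le> 0" using b by (simp add: distrib_left)
    then have neg: "(A * b * y powr (- b - 2)) * (b * (f' U * (A * y powr (- b))) - (b + 1)) \<le> 0"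
      using A b by (intro mult_nonneg_nonpos) auto
    have "y powr (- b - 1) * y powr (- b - 1) = y powr (- b - 2) * y powr (- b)"
      by (simp add: powr_add[symmetric])
    then have eq: "f' U * e1\<^sup>2 = (A * b * y powr (- b - 2)) * (b * (f' U * (A * y powr (- b))))"
      unfolding e1_def power2_eq_square by (simp add: mult_ac)
    have "f' U * e1\<^sup>2 + e2 = (A * b * y powr (- b - 2)) * (b * (f' U * (A * y powr (- b))) - (b + 1))"
      unfolding eq e2_def by (simp add: algebra_simps)
    then show ?thesis using neg by (simp only:)
  qed
  have "(\<Sum>i\<in>Basis. f' U * f U * (e1 * p' i)\<^sup>2 + f U * (e2 * (p' i)\<^sup>2 + e1 * q i))
     = (\<Sum>i\<in>Basis. f U * (f' U * e1\<^sup>2 + e2) * (p' i)\<^sup>2 + f U * e1 * q i)"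
    by (intro sum.cong refl) (simp add: power_mult_distrib algebra_simps)
  also have "\<dots> \<le> (\<Sum>i\<in>Basis. f U * e1 * q i)"
  proof (rule sum_mono)
    fix i :: 'a
    have "f U * (f' U * e1\<^sup>2 + e2) * (p' i)\<^sup>2 \<le> 0"
      using concave fU by (intro mult_nonpos_nonneg mult_nonneg_nonpos) auto
    then show "f U * (f' U * e1\<^sup>2 + e2) * (p' i)\<^sup>2 + f U * e1 * q i \<le> f U * e1 * q i" by simp
  qed
  also have "\<dots> = f U * e1 * (\<Sum>i\<in>Basis. q i)" by (simp add: sum_distrib_left)
  finally have 1: "f U * (e1 * a) - (\<Sum>i\<in>Basis. f' U * f U * (e1 * p' i)\<^sup>2 + f U * (e2 * (p' i)\<^sup>2 + e1 * q i))
     \<ge> f U * e1 * (a - (\<Sum>i\<in>Basis. q i))" by (simp add: right_diff_distrib)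
  have e1: "e1 > 0" using A b y by (simp add: e1_def)
  \<comment> \<open>The powers of \<open>y\<close> in \<open>e1\<close> and in
    \<open>\<delta> * y powr (1 + b)\<close> cancel, leaving the constant
    \<open>A * b * \<delta>\<close>; the requirement \<open>A \<ge> \<kappa> / \<delta>\<close>
    makes it at least 1.\<close>
  have "f U * 1 \<le> f U * (A * b * \<delta>)"
  proof (rule mult_left_mono)
    have "\<kappa> / \<delta> * (b * \<delta>) \<le> A * (b * \<delta>)" using A b \<delta> by (intro mult_right_mono) auto
    moreover have "\<kappa> / \<delta> * (b * \<delta>) = 1" using b(2) \<delta> by (simp add: mult.commute)
    ultimately show "1 \<le> A * b * \<delta>" by (simp only: mult.assoc)
  qed (use fU in simp)
  also have "f U * (A * b * \<delta>) = f U * e1 * (\<delta> * y powr (1 + b))"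
  proof -
    have "y powr (- b - 1) * y powr (1 + b) = 1" using y by (simp add: powr_add[symmetric])
    then show ?thesis unfolding e1_def by (simp add: mult_ac)
  qed
  also have "\<dots> \<le> f U * e1 * (a - (\<Sum>i\<in>Basis. q i))"
    using v(2) fU e1 by (intro mult_left_mono) (auto simp: y_def b_def)
  finally have "f U \<le> f U * (e1 * a) - (\<Sum>i\<in>Basis. f' U * f U * (e1 * p' i)\<^sup>2 + f U * (e2 * (p' i)\<^sup>2 + e1 * q i))"
    using 1 by simp
  with pU show ?thesis unfolding U_def y_def b_def by blast
qed

theorem global_solution_small:
  assumes fujita: "p > 1 + 2 / real DIM('a::euclidean_space)"
  obtains c0 where "c0 > 0" "c0 \<le> 1"
    "\<And>c. 0 < c \<Longrightarrow> c < c0 \<Longrightarrow> \<exists>u :: 'a::euclidean_space \<Rightarrow> real \<Rightarrow> real. global_solution f (initial_datum p r c) u"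
proof -
  define N where "N = real DIM('a)"
  have N: "N > 0" by (simp add: N_def)
  \<comment> \<open>The only place where the supercritical exponent enters.\<close>
  have "1 / (p - 1) < N / 2"
    using fujita N p unfolding N_def[symmetric] by (simp add: field_simps)
  then obtain \<kappa> where \<kappa>: "1 / (p - 1) < \<kappa>" "\<kappa> < N / 2" using dense by blast
  have \<kappa>0: "\<kappa> > 0" using \<kappa>(1) p by (meson diff_gt_0_iff_gt divide_pos_pos less_trans zero_less_one)
  obtain m0 where m0: "0 < m0" "m0 < 1" "\<And>u. 0 < u \<Longrightarrow> u \<le> m0 \<Longrightarrow> f' u * (- G u) \<le> \<kappa> + 1"
    using f'_minus_G_small[OF \<kappa>(1)] by metis
  obtain v :: "'a \<Rightarrow> real \<Rightarrow> real" and \<delta> B where v: "\<delta> > 0"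
    "continuous_on (UNIV \<times> {0..}) (\<lambda>(x, t). v x t)"
    "\<And>x t. t \<ge> 0 \<Longrightarrow> 0 < v x t" "\<And>x t. t \<ge> 0 \<Longrightarrow> v x t \<le> B"
    "\<And>x. v x 0 \<ge> (1 + (norm x)\<^sup>2) powr (- \<kappa>)"
    "\<And>x t. t \<ge> 0 \<Longrightarrow> \<exists>a p q. parabolic_jet v x t a p q \<and> a - (\<Sum>i\<in>Basis. q i) \<ge> \<delta> * v x t powr (1 + 1 / \<kappa>)"
    by (rule power_supersolution[OF \<kappa>0 \<kappa>(2)[unfolded N_def]]) (rule that)
  define b where "b = 1 / \<kappa>"
  have b: "b > 0" "\<kappa> * b = 1" using \<kappa>0 by (auto simp: b_def)
  have B: "B > 0" using v(3,4)[of 0 0] by simp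
  \<comment> \<open>The first entry makes the composed function a supersolution; the second, with
    \<open>v \<le> B\<close>, keeps it below \<open>m0\<close>, where concavity is known.\<close>
  define A where "A = max (\<kappa> / \<delta>) (- G m0 * B powr b)"
  have A: "A > 0" "A \<ge> \<kappa> / \<delta>" "A \<ge> - G m0 * B powr b"
    using \<kappa>0 v(1) by (auto simp: A_def less_max_iff_disj)
  define \<zeta> where "\<zeta> = (\<lambda>x t. - A * v x t powr (- b))"
  have \<zeta>: "\<zeta> x t \<le> G m0" if "t \<ge> 0" for x t
  proof -
    have "B powr (- b) \<le> v x t powr (- b)" using v(3,4)[OF that, of x] b by (intro powr_mono2') auto
    then have "A * B powr (- b) \<le> A * v x t powr (- b)" using A by (intro mult_left_mono) auto
    moreover have "- G m0 * B powr b * B powr (- b) \<le> A * B powr (- b)" using A by (intro mult_right_mono) auto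
    moreover have "B powr b * B powr (- b) = 1" using B by (simp add: powr_add[symmetric])
    ultimately show ?thesis unfolding \<zeta>_def by (simp add: mult.assoc)
  qed
  define U where "U = (\<lambda>x t. Phi (\<zeta> x t))"
  have U: "U x t > 0" "U x t \<le> m0" "G (U x t) = \<zeta> x t" if "t \<ge> 0" for x t
    using Phi_props[OF m0(1) \<zeta>[OF that]] by (auto simp: U_def)
  have Usup: "\<exists>a p q. parabolic_jet U x t a p q \<and> a - (\<Sum>i\<in>Basis. q i) \<ge> f (U x t)" if t: "t \<ge> 0" for x t
  proof -
    obtain a p' q where vv: "parabolic_jet v x t a p' q" "a - (\<Sum>i\<in>Basis. q i) \<ge> \<delta> * v x t powr (1 + 1 / \<kappa>)"
      using v(6)[OF t] by blast
    show ?thesis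
      using parabolic_jet_supersolution[OF vv v(3)[OF t] \<kappa>0 v(1) A(1,2) m0(1,3) \<zeta>[OF t, unfolded \<zeta>_def b_def]]
      unfolding U_def \<zeta>_def b_def .
  qed
  have Uc: "continuous_on (UNIV \<times> {0..}) (\<lambda>(x, t). U x t)"
  proof -
    have "continuous_on (UNIV \<times> {0..}) (\<lambda>z. v (fst z) (snd z))" using v(2) by (simp add: case_prod_beta)
    moreover have "v (fst z) (snd z) \<noteq> 0" if "z \<in> UNIV \<times> {0..}" for z
      using v(3)[of "snd z" "fst z"] that by auto
    ultimately have "continuous_on (UNIV \<times> {0..}) (\<lambda>z. \<zeta> (fst z) (snd z))"
      unfolding \<zeta>_def by (intro continuous_on_mult continuous_on_powr continuous_on_const ballI)
    from continuous_on_compose2[OF continuous_on_Phi[OF m0(1)] this]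
    show ?thesis using \<zeta> unfolding U_def case_prod_beta by force
  qed
  obtain c0 where c0: "c0 > 0" "c0 \<le> 1"
    "\<And>c (x::'a). 0 < c \<Longrightarrow> c < c0 \<Longrightarrow> G (initial_datum p r c x) \<le> - A * (1 + (norm x)\<^sup>2)"
    using initial_datum_small[OF A(1)] by metis
  obtain K where K: "K > 0" "\<And>u v. 0 \<le> u \<Longrightarrow> u \<le> m0 \<Longrightarrow> 0 \<le> v \<Longrightarrow> v \<le> m0 \<Longrightarrow> \<bar>f u - f v\<bar> \<le> K * \<bar>u - v\<bar>"
    using f_lipschitz[of m0] by metis
  \<comment> \<open>Clamping the argument to \<open>[0, m0]\<close> makes the nonlinearity bounded
    and globally Lipschitz, and leaves it unchanged on the range of the supersolution.\<close>
  define F where "F s = f (max 0 (min s m0))" for s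
  have F_eq: "F s = f s" if "0 \<le> s" "s \<le> m0" for s using that by (simp add: F_def)
  have F_lip: "\<bar>F s - F s'\<bar> \<le> K * \<bar>s - s'\<bar>" for s s'
  proof -
    have "\<bar>F s - F s'\<bar> \<le> K * \<bar>max 0 (min s m0) - max 0 (min s' m0)\<bar>"
      unfolding F_def using m0 by (intro K(2)) auto
    also have "\<dots> \<le> K * \<bar>s - s'\<bar>" using K by (intro mult_left_mono) (auto simp: max_def min_def)
    finally show ?thesis .
  qed
  have F_nonneg: "F s \<ge> 0" for s unfolding F_def by (rule f_nonneg) simp
  have F_bound: "\<bar>F s\<bar> \<le> K * m0" for s
  proof -
    have "\<bar>F s - f 0\<bar> \<le> K * \<bar>max 0 (min s m0) - 0\<bar>" unfolding F_def using m0 by (intro K(2)) auto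
    also have "\<dots> \<le> K * m0" using K m0 by (intro mult_left_mono) auto
    finally show ?thesis by (simp add: f_zero)
  qed
  have "\<exists>u :: 'a \<Rightarrow> real \<Rightarrow> real. global_solution f (initial_datum p r c) u" if c: "0 < c" "c < c0" for c
  proof -
    define u0 :: "'a \<Rightarrow> real" where "u0 = initial_datum p r c"
    have u0_pos: "u0 x > 0" for x using initial_datum_pos[OF c(1)] by (simp add: u0_def)
    \<comment> \<open>Compared through \<open>G\<close>: the initial lower bound on \<open>v\<close>
      gives \<open>\<zeta> x 0 \<ge> - A * (1 + (norm x)\<^sup>2)\<close>, and small
      \<open>c\<close> places \<open>G (u0 x)\<close> below that paraboloid.\<close>
    have u0U: "u0 x \<le> U x 0" for x
    proof -
      have "v x 0 powr (- b) \<le> ((1 + (norm x)\<^sup>2) powr (- \<kappa>)) powr (- b)"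
        using v(5)[of x] b by (intro powr_mono2') (auto simp: add_nonneg_eq_0_iff)
      also have "\<dots> = 1 + (norm x)\<^sup>2" using b by (simp add: powr_powr add_nonneg_eq_0_iff)
      finally have "A * v x 0 powr (- b) \<le> A * (1 + (norm x)\<^sup>2)" using A by (intro mult_left_mono) auto
      then have "G (u0 x) \<le> G (U x 0)"
        using c0(3)[OF c, of x] U(3)[of 0 x] by (simp add: u0_def \<zeta>_def)
      then show ?thesis using G_le_iff[OF u0_pos[of x] U(1)[of 0 x]] by simp
    qed
    obtain L M where LM: "L \<ge> 0" "\<And>x :: 'a. \<bar>u0 x\<bar> \<le> M" "\<And>x y :: 'a. \<bar>u0 x - u0 y\<bar> \<le> L * norm (x - y)"
      using initial_datum_bounded_lipschitz[OF p r c(1), where 'a = 'a] unfolding u0_def by metis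
    interpret semilinear_heat F u0 K "K * m0" L M
      by standard (use K F_lip F_bound LM in auto)
    obtain u :: "'a \<Rightarrow> real \<Rightarrow> real" where u: "C21 u" "continuous_on (UNIV \<times> {0..}) (\<lambda>(x, t). u x t)"
      "\<forall>T. bounded ((\<lambda>(x, t). u x t) ` (UNIV \<times> {0..T}))"
      "\<forall>x. \<forall>t>0. time_deriv u x t = laplacian u x t + F (u x t)"
      "\<forall>x. u x 0 = u0 x"
      "(\<forall>a. F a \<ge> 0) \<longrightarrow> (\<forall>x. u0 x \<ge> 0) \<longrightarrow> (\<forall>x. \<forall>t\<ge>0. u x t \<ge> 0)"
      using ex_solution by (elim exE conjE) (rule that)
    have u_nonneg: "u x t \<ge> 0" if "t \<ge> 0" for x t
      using u(6) F_nonneg less_imp_le[OF u0_pos] that by blast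
    have u_eq: "time_deriv u x t = laplacian u x t + F (u x t)" if "t > 0" for x t
      using u(4) that by blast
    have uU: "u x t \<le> U x t" if t: "t \<ge> 0" for x t
    proof -
      obtain R where R: "\<And>x s. 0 \<le> s \<Longrightarrow> s \<le> t \<Longrightarrow> \<bar>u x s\<bar> \<le> R"
        using spec[OF u(3), of t] unfolding bounded_iff by fastforce
      have "u x t - U x t \<le> 0"
      proof (rule parabolic_maximum_principle[where d = "\<lambda>x t. u x t - U x t" and T = t and B = R and K = K])
        have "continuous_on (UNIV \<times> {0..}) (\<lambda>(x, t). u x t - U x t)"
          using continuous_on_diff[OF u(2) Uc] by (simp add: case_prod_beta)
        then show "continuous_on (UNIV \<times> {0..t}) (\<lambda>(x, t). u x t - U x t)"
          by (rule continuous_on_subset) auto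
        show "u x s - U x s \<le> R" if "0 \<le> s" "s \<le> t" for x s
          using R[OF that, of x] U(1)[OF that(1), of x] by linarith
        show "u x 0 - U x 0 \<le> 0" for x using u(5) u0U by simp
        show "\<exists>a p q. parabolic_jet (\<lambda>x t. u x t - U x t) x s a p q \<and> a \<le> (\<Sum>i\<in>Basis. q i) + K * (u x s - U x s)"
          if s: "0 < s" "s \<le> t" and pos: "u x s - U x s > 0" for x s
        proof -
          obtain a p' q where pU: "parabolic_jet U x s a p' q" "a - (\<Sum>i\<in>Basis. q i) \<ge> f (U x s)"
            using Usup[of s x] s by auto
          note pu = C21_parabolic_jet[OF u(1) s(1), of x]
          have "F (u x s) - F (U x s) \<le> K * (u x s - U x s)" using F_lip[of "u x s" "U x s"] pos by simp
          moreover have "F (U x s) = f (U x s)" using U[of s x] s by (intro F_eq) auto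
          ultimately have "time_deriv u x s - a \<le> (\<Sum>i\<in>Basis. space_deriv i (space_deriv i u) x s - q i) + K * (u x s - U x s)"
            unfolding sum_subtractf u_eq[OF s(1)] laplacian_def using pU(2) by linarith
          then show ?thesis using parabolic_jet_diff[OF pu pU(1)] by blast
        qed
      qed (use K t in auto)
      then show ?thesis by simp
    qed
    \<comment> \<open>Since \<open>0 \<le> u \<le> U \<le> m0\<close>, the truncation is never
      active along the solution.\<close>
    have "F (u x t) = f (u x t)" if "t \<ge> 0" for x t
      using u_nonneg[OF that, of x] uU[OF that, of x] U(2)[OF that, of x] by (intro F_eq) auto
    then have "time_deriv u x t = laplacian u x t + f (u x t)" if "t > 0" for x t
      using u_eq[OF that, of x] that by simp
    then have "global_solution f u0 u"
      unfolding global_solution_def using u(1,2,3,5) u_nonneg by blast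
    then show ?thesis unfolding u0_def by blast
  qed
  with c0(1,2) show ?thesis using that by blast
qed

end

theorem theorem5p2:
  fixes p r :: real and f f' f'' :: "real \<Rightarrow> real"
  assumes p: "p > 1 + 2 / real DIM('a::euclidean_space)"
    and r: "r > 0"
    and f_C1: "\<And>u. u \<ge> 0 \<Longrightarrow> (f has_real_derivative f' u) (at u within {0..})"
      "continuous_on {0..} f'"
    and f_C2: "\<And>u. u > 0 \<Longrightarrow> (f' has_real_derivative f'' u) (at u)"
      "continuous_on {0<..} f''"
    and f_zero: "f 0 = 0"
    and f_pos: "\<And>u. u > 0 \<Longrightarrow> f u > 0"
    and f'_pos: "\<And>u. u > 0 \<Longrightarrow> f' u > 0"
    and f''_pos: "\<And>u. u > 0 \<Longrightarrow> f'' u > 0"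
    and f_int: "\<And>u. u > 0 \<Longrightarrow> set_integrable lborel {u..} (\<lambda>s. 1 / f s)"
    and f_near_0: "\<And>u. 0 < u \<Longrightarrow> u < 1 \<Longrightarrow> f u = u powr p * ln (exp 1 + 1 / u) powr (- r)"
  shows "\<exists>c0 c1. 0 < c0 \<and> c0 \<le> c1 \<and>
           (\<forall>c. 0 < c \<and> c < c0 \<longrightarrow>
              (\<exists>u :: 'a \<Rightarrow> real \<Rightarrow> real. global_solution f (initial_datum p r c) u)) \<and>
           (\<forall>c. c > c1 \<longrightarrow>
              \<not> (\<exists>u :: 'a \<Rightarrow> real \<Rightarrow> real. global_solution f (initial_datum p r c) u))"
proof -
  note fujita = p
  have "p > 1" using p by (rule less_trans[rotated]) simp
  interpret fujita_nonlinearity f f' p r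
    by standard (use \<open>p > 1\<close> r f_C1 f_zero f_pos f'_pos f_int f_near_0 in auto)
  obtain c0 where c0: "c0 > 0" "c0 \<le> 1"
    "\<And>c. 0 < c \<Longrightarrow> c < c0 \<Longrightarrow> \<exists>u :: 'a \<Rightarrow> real \<Rightarrow> real. global_solution f (initial_datum p r c) u"
    using global_solution_small[OF fujita] by metis
  obtain c1 where c1: "c1 \<ge> 1"
    "\<And>c. c > c1 \<Longrightarrow> \<not> (\<exists>u :: 'a \<Rightarrow> real \<Rightarrow> real. global_solution f (initial_datum p r c) u)"
    using no_global_solution_large[where 'a = 'a] by metis
  \<comment> \<open>The thresholds are ordered because \<open>c0 \<le> 1 \<le> c1\<close>.\<close>
  show ?thesis using c0 c1 by (intro exI[of _ c0] exI[of _ c1]) auto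
qed

end
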